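(* Let $F$ be a field of characteristic $0$. A $T$-ideal $I$ of $\mathcal S_n(\infty)$ is prime if and only if it is the ideal of trace identities of one of the algebras $F(m_1,\dots,m_k;a_1,\dots,a_k)$, where $m_1,\dots,m_k$ and $a_1,\dots,a_k$ are positive integers with $\sum_j m_ja_j=n$.
   Context: An algebra with trace is an associative unital $F$-algebra $R$ with an $F$-linear map $t:R\to R$ such that $t(a)b=b\,t(a)$, $t(ab)=t(ba)$, $t(t(a)b)=t(a)t(b)$ for all $a,b\in R$. Homomorphisms of trace algebras commute with $t$. A trace ideal is a two-sided ideal $I$ with $t(I)\subset I$. A trace algebra is prime if it is nonzero and, for trace ideals $I,J$, $IJ=0$ implies $I=0$ or $J=0$; a trace ideal $P$ of $R$ is prime if $R/P$ is a prime trace algebra. The free algebra with trace on a set $X$ of variables is $F\langle X\rangle[\mathrm{tr}(M)]$, the polynomial ring over the free algebra $F\langle X\rangle$ in commuting (central) variables $\mathrm{tr}(M)$, $M$ ranging over monomials up to cyclic equivalence. A $T$-ideal of a (relatively) free trace algebra is a trace ideal stable under all trace-compatible endomorphisms. Define $\sigma_i(x)$ by $\sum_{i\ge 0}(-1)^i\sigma_i(x)u^i=\exp\bigl(-\sum_{j\ge1}\frac{\mathrm{tr}(x^j)}{j}u^j\bigr)$ and $CH_n(x):=x^n+\sum_{i=1}^n(-1)^i\sigma_i(x)x^{n-i}$. Then $\mathcal S_n(\infty)$ is the free algebra with trace over $F$ in countably many variables modulo the $T$-ideal generated by $CH_n(x)$ and $\mathrm{tr}(1)-n$ (the free $n$-Cayley–Hamilton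 algebra). $F(m_1,\dots,m_k;a_1,\dots,a_k):=\bigoplus_{i=1}^kM_{m_i}(F)$ with trace $t(r_1,\dots,r_k)=\sum_{i=1}^ka_i\,\mathrm{tr}(r_i)$, $\mathrm{tr}$ the matrix trace. Its ideal of trace identities in $\mathcal S_n(\infty)$ is the set of elements sent to $0$ by every trace-algebra homomorphism $\mathcal S_n(\infty)\to F(m_1,\dots,m_k;a_1,\dots,a_k)$. *)

theory Defs
  imports
    "HOL-Library.Poly_Mapping"
    "HOL-Computational_Algebra.Formal_Power_Series"
    "HOL-Algebra.Ideal_Product"
    "HOL-Algebra.QuotRing"
    "Jordan_Normal_Form.VS_Connect"
begin

section \<open>Algebras with trace\<close>

record ('f, 'a) trace_alg = "('f, 'a) module" +
  trc :: "'a \<Rightarrow> 'a"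

text \<open>The scalars form a type of class \<^class>\<open>field\<close>, viewed as the record \<^term>\<open>class_ring\<close>.\<close>

locale trace_algebra = ring R + module "class_ring :: 'f::field ring" R
  for R :: "('f::field, 'a, 'm) trace_alg_scheme" (structure) +
  assumes smult_mult_left:
      "\<lbrakk>x \<in> carrier R; y \<in> carrier R\<rbrakk> \<Longrightarrow> (c \<odot> x) \<otimes> y = c \<odot> (x \<otimes> y)"
    and smult_mult_right:
      "\<lbrakk>x \<in> carrier R; y \<in> carrier R\<rbrakk> \<Longrightarrow> x \<otimes> (c \<odot> y) = c \<odot> (x \<otimes> y)"
    and trc_closed: "x \<in> carrier R \<Longrightarrow> trc R x \<in> carrier R"
    and trc_add:
      "\<lbrakk>x \<in> carrier R; y \<in> carrier R\<rbrakk> \<Longrightarrow> trc R (x \<oplus> y) = trc R x \<oplus> trc R y"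
    and trc_smult: "x \<in> carrier R \<Longrightarrow> trc R (c \<odot> x) = c \<odot> trc R x"
    and trc_central:
      "\<lbrakk>a \<in> carrier R; b \<in> carrier R\<rbrakk> \<Longrightarrow> trc R a \<otimes> b = b \<otimes> trc R a"
    and trc_commute:
      "\<lbrakk>a \<in> carrier R; b \<in> carrier R\<rbrakk> \<Longrightarrow> trc R (a \<otimes> b) = trc R (b \<otimes> a)"
    and trc_trc_mult:
      "\<lbrakk>a \<in> carrier R; b \<in> carrier R\<rbrakk> \<Longrightarrow> trc R (trc R a \<otimes> b) = trc R a \<otimes> trc R b"

definition trace_hom ::
  "('f, 'a, 'm) trace_alg_scheme \<Rightarrow> ('f, 'b, 'n) trace_alg_scheme \<Rightarrow> ('a \<Rightarrow> 'b) set" where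
  "trace_hom R S = {h \<in> Ring.ring_hom R S.
     (\<forall>c. \<forall>x\<in>carrier R. h (c \<odot>\<^bsub>R\<^esub> x) = c \<odot>\<^bsub>S\<^esub> h x) \<and>
     (\<forall>x\<in>carrier R. h (trc R x) = trc S (h x))}"

text \<open>Ideals are automatically closed under scalars, since \<open>c \<odot> x = (c \<odot> \<one>) \<otimes> x\<close>.\<close>

definition trace_ideal :: "'a set \<Rightarrow> ('f, 'a, 'm) trace_alg_scheme \<Rightarrow> bool" where
  "trace_ideal I R \<longleftrightarrow> ideal I R \<and> trc R ` I \<subseteq> I"

definition trace_quot ::
  "('f, 'a, 'm) trace_alg_scheme \<Rightarrow> 'a set \<Rightarrow> ('f, 'a set) trace_alg" where
  "trace_quot R I = \<lparr>
     carrier = carrier (R Quot I),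
     mult = mult (R Quot I),
     one = one (R Quot I),
     zero = zero (R Quot I),
     add = add (R Quot I),
     smult = (\<lambda>c A. \<Union>a\<in>A. I +>\<^bsub>R\<^esub> (c \<odot>\<^bsub>R\<^esub> a)),
     trc = (\<lambda>A. \<Union>a\<in>A. I +>\<^bsub>R\<^esub> trc R a)\<rparr>"

definition prime_trace_algebra :: "('f::field, 'a, 'm) trace_alg_scheme \<Rightarrow> bool" where
  "prime_trace_algebra R \<longleftrightarrow> trace_algebra R \<and> carrier R \<noteq> {\<zero>\<^bsub>R\<^esub>} \<and>
     (\<forall>I J. trace_ideal I R \<and> trace_ideal J R \<and> I \<cdot>\<^bsub>R\<^esub> J = {\<zero>\<^bsub>R\<^esub>} \<longrightarrow>
        I = {\<zero>\<^bsub>R\<^esub>} \<or> J = {\<zero>\<^bsub>R\<^esub>})"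

definition prime_trace_ideal :: "'a set \<Rightarrow> ('f::field, 'a, 'm) trace_alg_scheme \<Rightarrow> bool" where
  "prime_trace_ideal P R \<longleftrightarrow> trace_ideal P R \<and> prime_trace_algebra (trace_quot R P)"

definition T_ideal :: "'a set \<Rightarrow> ('f, 'a, 'm) trace_alg_scheme \<Rightarrow> bool" where
  "T_ideal I R \<longleftrightarrow> trace_ideal I R \<and> (\<forall>h\<in>trace_hom R R. h ` I \<subseteq> I)"

definition T_ideal_gen :: "('f, 'a, 'm) trace_alg_scheme \<Rightarrow> 'a set \<Rightarrow> 'a set" where
  "T_ideal_gen R G = \<Inter>{I. T_ideal I R \<and> G \<subseteq> I}"

definition trace_identities ::
  "('f, 'a, 'm) trace_alg_scheme \<Rightarrow> ('f, 'b, 'n) trace_alg_scheme \<Rightarrow> 'a set" where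
  "trace_identities S A = {f \<in> carrier S. \<forall>h\<in>trace_hom S A. h f = \<zero>\<^bsub>A\<^esub>}"


section \<open>The free algebra with trace\<close>

text \<open>
  Words (monomials) under concatenation, written additively because \<^typ>\<open>'a \<Rightarrow>\<^sub>0 'b\<close> multiplies
  by convolution over an additive monoid of exponents. Hence \<open>'x word \<Rightarrow>\<^sub>0 'f\<close> is the free
  associative unital algebra on \<open>'x\<close>.
\<close>

datatype 'x word = Word "'x list"

primrec letters :: "'x word \<Rightarrow> 'x list" where
  "letters (Word xs) = xs"

instantiation word :: (type) monoid_add
begin

definition "0 = Word []"
definition "v + w = Word (letters v @ letters w)"

instance
proof
  fix a b c :: "'a word"
  show "a + b + c = a + (b + c)" by (simp add: plus_word_def)
  show "0 + a = a" by (cases a) (simp add: plus_word_def zero_word_def)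
  show "a + 0 = a" by (cases a) (simp add: plus_word_def zero_word_def)
qed

end

definition cyc_eq :: "'x word \<Rightarrow> 'x word \<Rightarrow> bool" where
  "cyc_eq v w \<longleftrightarrow> (\<exists>k. letters w = rotate k (letters v))"

quotient_type 'x cyc = "'x word" / cyc_eq
proof (rule equivpI)
  show "reflp cyc_eq"
    unfolding cyc_eq_def by (rule reflpI) (metis rotate0 id_apply)
  show "symp cyc_eq"
  proof (rule sympI)
    fix v w :: "'a word" assume "cyc_eq v w"
    then obtain k where k: "letters w = rotate k (letters v)"
      unfolding cyc_eq_def by blast
    let ?n = "length (letters v)"
    have "rotate (?n - k mod ?n) (letters w) = rotate ((?n - k mod ?n) + k mod ?n) (letters v)"
      unfolding k rotate_rotate [symmetric] using rotate_conv_mod [of k "letters v"] by simp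
    also have "\<dots> = letters v"
    proof (cases "?n = 0")
      case False
      then have "(?n - k mod ?n) + k mod ?n = ?n"
        using mod_less_divisor [of ?n k] by linarith
      then show ?thesis by simp
    qed simp
    finally show "cyc_eq w v" unfolding cyc_eq_def by metis
  qed
  show "transp cyc_eq"
    unfolding cyc_eq_def by (rule transpI) (metis rotate_rotate)
qed

text \<open>
  \<open>F\<langle>X\<rangle>[tr(M)]\<close>: polynomials over the free algebra in central variables indexed by cyclic
  words. An exponent of type \<open>'x cyc \<Rightarrow>\<^sub>0 nat\<close> is a monomial in the variables \<open>tr(M)\<close>. The
  empty word is included, so \<open>tr(1)\<close> is one of the variables.
\<close>

type_synonym ('x, 'f) free_tr = "('x cyc \<Rightarrow>\<^sub>0 nat) \<Rightarrow>\<^sub>0 ('x word \<Rightarrow>\<^sub>0 'f)"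

definition scal :: "'f \<Rightarrow> ('x, 'f::field) free_tr" where
  "scal c = Poly_Mapping.single 0 (Poly_Mapping.single 0 c)"

definition var :: "'x \<Rightarrow> ('x, 'f::field) free_tr" where
  "var x = Poly_Mapping.single 0 (Poly_Mapping.single (Word [x]) 1)"

text \<open>The linear map with \<open>w \<cdot> T \<mapsto> tr(w) \<cdot> T\<close> for words \<open>w\<close> and monomials \<open>T\<close> in the \<open>tr(M)\<close>.\<close>

definition free_trc :: "('x, 'f::field) free_tr \<Rightarrow> ('x, 'f) free_tr" where
  "free_trc p = (\<Sum>T\<in>Poly_Mapping.keys p.
     \<Sum>w\<in>Poly_Mapping.keys (Poly_Mapping.lookup p T).
     Poly_Mapping.single (T + Poly_Mapping.single (abs_cyc w) 1)
       (Poly_Mapping.single 0 (Poly_Mapping.lookup (Poly_Mapping.lookup p T) w)))"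

definition free_trace_algebra :: "('f::field, ('x, 'f) free_tr) trace_alg" where
  "free_trace_algebra = \<lparr>carrier = UNIV, mult = (*), one = 1, zero = 0, add = (+),
     smult = (\<lambda>c p. scal c * p), trc = free_trc\<rparr>"


section \<open>The free Cayley-Hamilton algebra\<close>

text \<open>
  The power series \<open>exp g\<close>, for \<open>g\<close> without constant term. The library's exponential series
  needs coefficients in a field.
\<close>

definition fps_exp_of :: "('x, 'f::field_char_0) free_tr fps \<Rightarrow> ('x, 'f) free_tr fps" where
  "fps_exp_of g = fps_compose (Abs_fps (\<lambda>k. scal (1 / fact k))) g"

definition tr_sigma :: "nat \<Rightarrow> ('x, 'f::field_char_0) free_tr \<Rightarrow> ('x, 'f) free_tr" where
  "tr_sigma i x = (-1) ^ i * fps_nth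
     (fps_exp_of (- Abs_fps (\<lambda>j. if j = 0 then 0 else scal (1 / of_nat j) * free_trc (x ^ j)))) i"

definition CH :: "nat \<Rightarrow> ('x, 'f::field_char_0) free_tr \<Rightarrow> ('x, 'f) free_tr" where
  "CH n x = x ^ n + (\<Sum>i=1..n. (-1) ^ i * tr_sigma i x * x ^ (n - i))"

definition free_CH_algebra :: "nat \<Rightarrow> ('f::field_char_0, (nat, 'f) free_tr set) trace_alg" where
  "free_CH_algebra n = trace_quot free_trace_algebra
     (T_ideal_gen free_trace_algebra {CH n (var 0), free_trc 1 - of_nat n})"


section \<open>The algebras $F(m_1,\dots,m_k;a_1,\dots,a_k)$\<close>

definition mat_trace :: "'f::field mat \<Rightarrow> 'f" where
  "mat_trace A = (\<Sum>i<dim_row A. A $$ (i, i))"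

definition block_one :: "nat list \<Rightarrow> 'f::field mat list" where
  "block_one ms = map 1\<^sub>m ms"

text \<open>A tuple of matrices is a list of matrices, of sizes given by \<open>ms\<close>; the trace with
  weights \<open>as\<close> is a scalar multiple of the unit tuple.\<close>

definition block_algebra :: "nat list \<Rightarrow> nat list \<Rightarrow> ('f::field, 'f mat list) trace_alg" where
  "block_algebra ms as = \<lparr>
     carrier = {rs. length rs = length ms \<and> (\<forall>i<length ms. rs ! i \<in> carrier_mat (ms ! i) (ms ! i))},
     mult = map2 (*),
     one = block_one ms,
     zero = map (\<lambda>m. 0\<^sub>m m m) ms,
     add = map2 (+),
     smult = (\<lambda>c. map ((\<cdot>\<^sub>m) c)),
     trc = (\<lambda>rs. map ((\<cdot>\<^sub>m) (\<Sum>i<length ms. of_nat (as ! i) * mat_trace (rs ! i))) (block_one ms))\<rparr>"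

end

theory Submission
  imports Defs "Jordan_Normal_Form.Char_Poly" "HOL-Computational_Algebra.Polynomial_FPS"
    "HOL-Computational_Algebra.Fraction_Field" "HOL-Algebra.Algebraic_Closure_Type"
begin

text \<open>
  Identities of \<open>F(m\<^sub>1,\<dots>,m\<^sub>k;a\<^sub>1,\<dots>,a\<^sub>k)\<close> form a prime ideal: if \<open>f\<close> and \<open>g\<close> are not identities, then for fresh
  variables \<open>y\<close>, \<open>z\<close> the traces of \<open>f y\<close> and \<open>g z\<close> are nonzero polynomial functions, since the trace form is
  nondegenerate, and the product of two such functions over an infinite field is nonzero.

  Conversely, let \<open>I\<close> be a prime $T$-ideal, lifted to the free algebra with trace. By the Cayley-Hamilton
  identity the radical of the trace form is nil of bounded index modulo \<open>I\<close>, so by Higman's argument the form is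
  nondegenerate modulo \<open>I\<close>, and the traces form a domain modulo \<open>I\<close>. Let \<open>K\<close> be the algebraic closure of its field of
  fractions, and let \<open>R\<close> be the free algebra over \<open>K\<close> modulo the radical of the trace form; \<open>I\<close> is the kernel of the
  map to \<open>R\<close>. The identities hold in \<open>R\<close> by a density argument. In \<open>R\<close> Newton's identities
  show that nilpotent elements have trace \<open>0\<close> and that a nonzero idempotent has a positive integer as its trace. So \<open>1\<close> is a
  sum of orthogonal indecomposable idempotents \<open>e\<close>, each with \<open>e R e = K e\<close>, and nondegeneracy of the
  trace turns them into matrix units of a direct sum of matrix algebras over \<open>K\<close> with weights \<open>tr(e)\<close>. The \<open>F\<close>-span of the matrix units
  is the required algebra, and by density it has the same identities as \<open>R\<close>.
\<close>


text \<open>Modulo a prime ideal nothing is known to be finite dimensional, and F need not be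
  algebraically closed. Finiteness comes from n alone. Let c_0 = 1, c_1, ... be the coefficients
  that Newton's identities attach to an element. The trace of the Cayley-Hamilton identity
  multiplied by the element gives c_(n+1) = 0. For an idempotent of trace t the recursion is (k+1)
  c_(k+1) = (k - t) c_k, so t is one of 0, ..., n; for a nilpotent element whose higher powers have
  trace 0 it is (k+1) c_(k+1) = - t c_k, so t = 0. As traces of orthogonal idempotents add up,
  splitting 1 must stop.

  The passage from F to K and back costs nothing because F is infinite: the value of a trace
  polynomial depends polynomially on each scalar coefficient of its arguments, so one that vanishes
  on an F-subspace of R vanishes on the K-span. This serves twice, for the image of the free algebra
  and for the F-span of the matrix units, both of which span R over K. The resulting algebra over F
  need not lie in the quotient by I; only their identities are compared.\<close>

section \<open>Functions of finite support\<close>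

lemma poly_mapping_additive_induct [case_names zero single add]:
  assumes "P 0" "\<And>k v. P (Poly_Mapping.single k v)" "\<And>p q. P p \<Longrightarrow> P q \<Longrightarrow> P (p + q)"
  shows "P (p :: 'a \<Rightarrow>\<^sub>0 'b::comm_monoid_add)"
proof (induction p rule: update_induct)
  case const
  show ?case by fact
next
  case (update f a b)
  have "Poly_Mapping.update a b f = f + Poly_Mapping.single a b"
    using update(1) by (intro poly_mapping_eqI)
      (auto simp: lookup_update lookup_add lookup_single when_def in_keys_iff)
  then show ?case using assms update by metis
qed

text \<open>Serves twice: over an additive monoid it extends a map linearly from a basis, over a
  commutative multiplicative monoid it evaluates a monomial from its exponents. When each
  \<open>g k\<close> turns sums into products, so does \<open>pprod\<close>, although supports do
  not add up.\<close>

definition pprod :: "('g, 'm) monoid_scheme \<Rightarrow> ('a \<Rightarrow> 'v \<Rightarrow> 'g) \<Rightarrow> ('a \<Rightarrow>\<^sub>0 'v::zero) \<Rightarrow> 'g" where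
  "pprod G g p = finprod G (\<lambda>k. g k (Poly_Mapping.lookup p k)) (Poly_Mapping.keys p)"

context comm_monoid
begin

lemma pprod_superset:
  assumes "\<And>k v. g k v \<in> carrier G" "\<And>k. g k 0 = \<one>" "finite A" "Poly_Mapping.keys p \<subseteq> A"
  shows "pprod G g p = finprod G (\<lambda>k. g k (Poly_Mapping.lookup p k)) A"
  unfolding pprod_def
  by (rule finprod_mono_neutral_cong_left) (use assms in \<open>auto simp: in_keys_iff\<close>)

lemma pprod_closed: "(\<And>k v. g k v \<in> carrier G) \<Longrightarrow> pprod G g p \<in> carrier G"
  unfolding pprod_def by (rule finprod_closed) auto

lemma pprod_add:
  fixes p q :: "'i \<Rightarrow>\<^sub>0 'v::comm_monoid_add"
  assumes c: "\<And>k v. g k v \<in> carrier G" and z: "\<And>k. g k 0 = \<one>"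
    and a: "\<And>k u v. g k (u + v) = g k u \<otimes> g k v"
  shows "pprod G g (p + q) = pprod G g p \<otimes> pprod G g q"
proof -
  let ?A = "Poly_Mapping.keys p \<union> Poly_Mapping.keys q"
  have "pprod G g (p + q) = finprod G (\<lambda>k. g k (Poly_Mapping.lookup (p + q) k)) ?A"
    by (rule pprod_superset) (use c z Poly_Mapping.keys_add[of p q] in auto)
  also have "\<dots> = finprod G (\<lambda>k. g k (Poly_Mapping.lookup p k) \<otimes> g k (Poly_Mapping.lookup q k)) ?A"
    by (simp add: lookup_add a)
  also have "\<dots> = finprod G (\<lambda>k. g k (Poly_Mapping.lookup p k)) ?A
      \<otimes> finprod G (\<lambda>k. g k (Poly_Mapping.lookup q k)) ?A"
    by (rule finprod_multf) (auto simp: c)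
  also have "\<dots> = pprod G g p \<otimes> pprod G g q"
    using pprod_superset[of g ?A p] pprod_superset[of g ?A q] c z by auto
  finally show ?thesis .
qed

lemma pprod_single:
  assumes "\<And>k v. g k v \<in> carrier G" "\<And>k. g k 0 = \<one>"
  shows "pprod G g (Poly_Mapping.single k v) = g k v"
  by (subst pprod_superset[of g "{k}"]) (use assms in \<open>auto\<close>)

lemma pprod_zero: "pprod G g 0 = \<one>"
  by (simp add: pprod_def)

end


section \<open>The free algebra with trace\<close>

definition mon :: "'x word \<Rightarrow> ('x, 'f::field) free_tr" where
  "mon w = Poly_Mapping.single 0 (Poly_Mapping.single w 1)"

abbreviation fterm :: "('x cyc \<Rightarrow>\<^sub>0 nat) \<Rightarrow> 'x word \<Rightarrow> 'f \<Rightarrow> ('x, 'f::field) free_tr" where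
  "fterm T w c \<equiv> Poly_Mapping.single T (Poly_Mapping.single w c)"

lemma letters_inject: "letters v = letters w \<longleftrightarrow> v = w"
  by (cases v; cases w) auto

lemma letters_zero [simp]: "letters 0 = []"
  by (simp add: zero_word_def)

lemma letters_plus [simp]: "letters (v + w) = letters v @ letters w"
  by (simp add: plus_word_def)

lemma abs_cyc_commute: "abs_cyc (v + w) = abs_cyc (w + v)"
proof -
  have "cyc_eq (v + w) (w + v)"
    unfolding cyc_eq_def by (rule exI[of _ "length (letters v)"]) (simp add: rotate_append)
  then show ?thesis by (simp add: cyc.abs_eq_iff)
qed

lemma free_tr_induct [case_names fterm add]:
  assumes t: "\<And>T w c. P (fterm T w c)" and a: "\<And>p q. P p \<Longrightarrow> P q \<Longrightarrow> P (p + q)"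
  shows "P (p :: ('x, 'f::field) free_tr)"
proof -
  have z: "P 0" using t[of 0 0 0] by simp
  have s: "P (Poly_Mapping.single T v)" for T v
    by (induction v rule: poly_mapping_additive_induct)
      (use z t a in \<open>auto simp: single_add\<close>)
  show ?thesis
    by (induction p rule: poly_mapping_additive_induct) (use z s a in auto)
qed

text \<open>\<open>free_trc\<close> sums over two layers of supports, and cancellation can make the
  support of a sum smaller than the union. As one \<open>pprod\<close> inside another, each layer
  becomes additive by \<open>pprod_add\<close>.\<close>

lemma free_trc_alt:
  "free_trc p = pprod (add_monoid class_ring) (\<lambda>T q. pprod (add_monoid class_ring) (\<lambda>w c.
      fterm (T + Poly_Mapping.single (abs_cyc w) 1) 0 c) q) p"
  unfolding free_trc_def pprod_def finsum_def[symmetric]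
  by (simp add: class_ring_simps)

lemma free_trc_add: "free_trc (p + q) = free_trc p + free_trc q"
proof -
  interpret A: comm_monoid "add_monoid (class_ring :: ('a, 'b) free_tr ring)"
    by (rule comm_monoidI) (auto simp: add.assoc add.commute)
  let ?f = "\<lambda>T w c. fterm (T + Poly_Mapping.single (abs_cyc w) 1) 0 c"
  have i: "pprod (add_monoid class_ring) (?f T) (u + v) =
    pprod (add_monoid class_ring) (?f T) u + pprod (add_monoid class_ring) (?f T) v"
    for T and u v :: "'a word \<Rightarrow>\<^sub>0 'b"
    using A.pprod_add[of "?f T" u v] by (simp add: single_add)
  let ?M = "add_monoid (class_ring :: ('a, 'b) free_tr ring)"
  have "pprod ?M (\<lambda>T q. pprod ?M (?f T) q) (p + q) =
    pprod ?M (\<lambda>T q. pprod ?M (?f T) q) p \<otimes>\<^bsub>?M\<^esub> pprod ?M (\<lambda>T q. pprod ?M (?f T) q) q"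
  proof (rule A.pprod_add)
    show "pprod ?M (?f T) 0 = \<one>\<^bsub>?M\<^esub>" for T :: "'a cyc \<Rightarrow>\<^sub>0 nat"
      by (rule A.pprod_zero)
  qed (use i in auto)
  then show ?thesis by (simp add: free_trc_alt)
qed

lemma free_trc_fterm [simp]:
  "free_trc (fterm T w c) = fterm (T + Poly_Mapping.single (abs_cyc w) 1) 0 c"
proof (cases "c = 0")
  case False
  then have "Poly_Mapping.single w c \<noteq> 0"
    by (metis lookup_single_eq lookup_zero)
  with False show ?thesis by (simp add: free_trc_def)
qed (simp add: free_trc_def)

lemma free_trc_zero [simp]: "free_trc 0 = 0"
  by (simp add: free_trc_def)

lemma fterm_mult: "fterm S v a * fterm T w b = fterm (S + T) (v + w) (a * b)"
  by (simp add: mult_single)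

lemma scal_add: "scal (a + b) = scal a + scal b"
  by (simp add: scal_def single_add)

lemma scal_mult: "scal (a * b) = scal a * scal b"
  by (simp add: scal_def mult_single)

lemma scal_1 [simp]: "scal 1 = 1"
  by (simp add: scal_def)

lemma scal_0 [simp]: "scal 0 = 0"
  by (simp add: scal_def)

lemma fterm_central: "fterm T 0 c * p = p * fterm T 0 c"
  by (induction p rule: free_tr_induct)
    (auto simp: fterm_mult algebra_simps)

lemma scal_central: "scal c * p = p * scal c"
  unfolding scal_def by (rule fterm_central)

lemma scal_uminus: "scal (- a) = - scal a"
  by (metis add.right_inverse eq_neg_iff_add_eq_0 scal_0 scal_add add.commute)

lemma scal_of_nat: "scal (of_nat n) = of_nat n"
  by (induction n) (auto simp: scal_add)

lemma free_trc_central: "free_trc p * q = q * free_trc p"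
  by (induction p rule: free_tr_induct)
    (auto simp: free_trc_add fterm_central algebra_simps)

lemma free_trc_commute: "free_trc (p * q) = free_trc (q * p)"
proof (induction p rule: free_tr_induct)
  case (fterm T w c)
  show ?case
    by (induction q rule: free_tr_induct)
      (auto simp: free_trc_add fterm_mult algebra_simps abs_cyc_commute)
qed (auto simp: free_trc_add algebra_simps)

lemma free_trc_scal: "free_trc (scal c * p) = scal c * free_trc p"
  by (induction p rule: free_tr_induct)
    (auto simp: free_trc_add fterm_mult algebra_simps scal_def)

lemma free_trc_mult: "free_trc (free_trc p * q) = free_trc p * free_trc q"
proof (induction p rule: free_tr_induct)
  case (fterm T w c)
  show ?case
    by (induction q rule: free_tr_induct)
      (auto simp: free_trc_add fterm_mult algebra_simps)
qed (auto simp: free_trc_add algebra_simps)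

lemma free_trace_algebra_simps [simp]:
  "carrier free_trace_algebra = UNIV"
  "mult free_trace_algebra = (*)"
  "one free_trace_algebra = 1"
  "zero free_trace_algebra = 0"
  "add free_trace_algebra = (+)"
  "module.smult free_trace_algebra = (\<lambda>c p. scal c * p)"
  "trc free_trace_algebra = free_trc"
  by (auto simp: free_trace_algebra_def)

lemma trace_algebra_free: "trace_algebra free_trace_algebra"
proof -
  have r: "ring (free_trace_algebra :: ('b, ('a,'b) free_tr) trace_alg)"
  proof (unfold_locales, goal_cases)
    case 7 then show ?case by (auto simp: Units_def intro: exI[of _ "- _"] )
  qed (auto simp: algebra_simps Units_def intro: exI[of _ "- _"])
  interpret r: ring "free_trace_algebra :: ('b, ('a,'b) free_tr) trace_alg" by fact
  have m: "module class_ring (free_trace_algebra :: ('b, ('a,'b) free_tr) trace_alg)"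
    by unfold_locales (auto simp: scal_add scal_mult algebra_simps)
  interpret m: module class_ring "free_trace_algebra :: ('b, ('a,'b) free_tr) trace_alg" by fact
  show ?thesis
  proof unfold_locales
    fix c :: 'b and x y :: "('a, 'b) free_tr"
    have "x * (scal c * y) = scal c * (x * y)"
      by (simp only: mult.assoc[symmetric] scal_central[of c x])
    then show "x \<otimes>\<^bsub>free_trace_algebra\<^esub> (c \<odot>\<^bsub>free_trace_algebra\<^esub> y)
        = c \<odot>\<^bsub>free_trace_algebra\<^esub> (x \<otimes>\<^bsub>free_trace_algebra\<^esub> y)"
      by simp
  qed (simp_all add: mult.assoc free_trc_add free_trc_scal free_trc_mult,
    (rule free_trc_central free_trc_commute)+)
qed

text \<open>Each variable tr(M) is the trace of a word representing M, so the variables in X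
  generate everything once the trace counts as an operation. This is the induction for properties
  that are accessible only through the operations of a trace algebra, such as the behaviour of
  values under evaluation.\<close>

lemma free_tr_generate [case_names scal var add mult trc]:
  assumes s: "\<And>c. P (scal c)" and v: "\<And>x. P (Defs.var x)"
    and a: "\<And>p q. P p \<Longrightarrow> P q \<Longrightarrow> P (p + q)"
    and m: "\<And>p q. P p \<Longrightarrow> P q \<Longrightarrow> P (p * q)"
    and t: "\<And>p. P p \<Longrightarrow> P (free_trc p)"
  shows "P (p :: ('x, 'f::field) free_tr)"
proof -
  have w: "P (mon w)" for w
  proof (cases w)
    case (Word xs)
    have "P (mon (Word xs))"
    proof (induction xs)
      case Nil
      show ?case using s[of 1] by (simp add: mon_def scal_def zero_word_def)
    next
      case (Cons x xs)
      have "mon (Word (x # xs)) = Defs.var x * mon (Word xs)"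
        by (simp add: mon_def Defs.var_def fterm_mult plus_word_def)
      with Cons v m show ?case by metis
    qed
    with Word show ?thesis by simp
  qed
  have c: "P (fterm (Poly_Mapping.single M k) 0 1)" for M k
  proof (induction k)
    case 0
    show ?case using s[of 1] by (simp add: scal_def)
  next
    case (Suc k)
    have "fterm (Poly_Mapping.single M (Suc k)) 0 1 =
       fterm (Poly_Mapping.single M k) 0 (1::'f) * free_trc (mon (rep_cyc M))"
      using Quotient3_abs_rep[OF Quotient3_cyc, of M]
      by (simp add: mon_def mult_single flip: single_add)
    with Suc w m t show ?case by metis
  qed
  have T: "P (fterm T 0 1)" for T
  proof (induction T rule: poly_mapping_additive_induct)
    case zero
    show ?case using s[of 1] by (simp add: scal_def)
  next
    case (single k v)
    show ?case by (rule c)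
  next
    case (add p q)
    then show ?case using m[OF add] by (simp add: mult_single)
  qed
  show ?thesis
  proof (induction p rule: free_tr_induct)
    case (fterm T w c)
    have "fterm T w c = scal c * (fterm T 0 1 * mon w)"
      by (simp add: scal_def mon_def mult_single)
    with s T \<open>\<And>w. P (mon w)\<close> m show ?case by metis
  qed (use a in auto)
qed

section \<open>The universal property\<close>

lemma trace_homD:
  assumes "h \<in> trace_hom R S"
  shows "x \<in> carrier R \<Longrightarrow> h x \<in> carrier S"
    and "x \<in> carrier R \<Longrightarrow> y \<in> carrier R \<Longrightarrow> h (x \<oplus>\<^bsub>R\<^esub> y) = h x \<oplus>\<^bsub>S\<^esub> h y"
    and "x \<in> carrier R \<Longrightarrow> y \<in> carrier R \<Longrightarrow> h (x \<otimes>\<^bsub>R\<^esub> y) = h x \<otimes>\<^bsub>S\<^esub> h y"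
    and "h \<one>\<^bsub>R\<^esub> = \<one>\<^bsub>S\<^esub>"
    and "x \<in> carrier R \<Longrightarrow> h (c \<odot>\<^bsub>R\<^esub> x) = c \<odot>\<^bsub>S\<^esub> h x"
    and "x \<in> carrier R \<Longrightarrow> h (trc R x) = trc S (h x)"
  using assms by (auto simp: trace_hom_def Ring.ring_hom_def)

lemma trace_homI:
  assumes "\<And>x. x \<in> carrier R \<Longrightarrow> h x \<in> carrier S"
    and "\<And>x y. x \<in> carrier R \<Longrightarrow> y \<in> carrier R \<Longrightarrow> h (x \<oplus>\<^bsub>R\<^esub> y) = h x \<oplus>\<^bsub>S\<^esub> h y"
    and "\<And>x y. x \<in> carrier R \<Longrightarrow> y \<in> carrier R \<Longrightarrow> h (x \<otimes>\<^bsub>R\<^esub> y) = h x \<otimes>\<^bsub>S\<^esub> h y"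
    and "h \<one>\<^bsub>R\<^esub> = \<one>\<^bsub>S\<^esub>"
    and "\<And>c x. x \<in> carrier R \<Longrightarrow> h (c \<odot>\<^bsub>R\<^esub> x) = c \<odot>\<^bsub>S\<^esub> h x"
    and "\<And>x. x \<in> carrier R \<Longrightarrow> h (trc R x) = trc S (h x)"
  shows "h \<in> trace_hom R S"
  using assms by (auto simp: trace_hom_def Ring.ring_hom_def)

lemma trace_hom_comp:
  assumes "g \<in> trace_hom R S" "h \<in> trace_hom S T"
  shows "h \<circ> g \<in> trace_hom R T"
proof -
  have c: "g x \<in> carrier S" if "x \<in> carrier R" for x
    using trace_homD(1)[OF assms(1) that] .
  have "h \<circ> g \<in> Ring.ring_hom R T"
    using assms by (auto simp: trace_hom_def intro: ring_hom_trans)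
  then show ?thesis
    using assms c by (auto simp: trace_hom_def)
qed

lemma trace_algebra_ring: "trace_algebra R \<Longrightarrow> ring R"
  by (simp add: trace_algebra_def)

lemma (in ring) ring_add_comm_monoid: "comm_monoid (add_monoid R)"
  by (rule a_comm_monoid)

lemma (in ring) ring_l_distr: "x \<in> carrier R \<Longrightarrow> y \<in> carrier R \<Longrightarrow> z \<in> carrier R \<Longrightarrow>
    (x \<oplus> y) \<otimes> z = x \<otimes> z \<oplus> y \<otimes> z"
  by (rule l_distr)

lemma (in ring) ring_r_distr: "x \<in> carrier R \<Longrightarrow> y \<in> carrier R \<Longrightarrow> z \<in> carrier R \<Longrightarrow>
    z \<otimes> (x \<oplus> y) = z \<otimes> x \<oplus> z \<otimes> y"
  by (rule r_distr)

context trace_algebra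
begin

text \<open>Here the inherited unqualified names of the ring axioms refer to the ring of scalars.\<close>

lemmas is_ring = trace_algebra_ring[OF trace_algebra_axioms]
lemmas add_comm_monoid = ring.ring_add_comm_monoid[OF is_ring]
lemmas ta_assoc = monoid.m_assoc[OF ring.is_monoid[OF is_ring]]
lemmas ta_l_distr = ring.ring_l_distr[OF is_ring]
lemmas ta_r_distr = ring.ring_r_distr[OF is_ring]
lemmas smult_zero_left = smult_l_null[simplified]
lemmas smult_add_left = smult_l_distr[simplified]
lemmas smult_smult = smult_assoc1[simplified]
lemmas smult_one_left = smult_one[simplified]
lemmas ta_pow_mult = monoid.nat_pow_mult[OF ring.is_monoid[OF is_ring]]

text \<open>A monomial in the tr(M) is evaluated by a product over its support, which asks for a
  commutative monoid. The values of the tr(M) are central, while R itself need not be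
  commutative.\<close>

definition center_monoid :: "'a monoid" where
  "center_monoid = \<lparr>carrier = {z \<in> carrier R. \<forall>b\<in>carrier R. z \<otimes> b = b \<otimes> z},
     monoid.mult = mult R, one = one R\<rparr>"

lemma center_monoid_simps [simp]:
  "monoid.mult center_monoid = mult R" "one center_monoid = one R"
  by (auto simp: center_monoid_def)

lemma center_closed: "x \<in> carrier center_monoid \<Longrightarrow> x \<in> carrier R"
  by (simp add: center_monoid_def)

lemma center_comm: "x \<in> carrier center_monoid \<Longrightarrow> b \<in> carrier R \<Longrightarrow> x \<otimes> b = b \<otimes> x"
  by (simp add: center_monoid_def)

lemma center_mult:
  assumes "x \<in> carrier center_monoid" "y \<in> carrier center_monoid"
  shows "x \<otimes> y \<in> carrier center_monoid"
proof -
  note c = center_closed[OF assms(1)] center_closed[OF assms(2)]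
  have "(x \<otimes> y) \<otimes> b = b \<otimes> (x \<otimes> y)" if b: "b \<in> carrier R" for b
  proof -
    have "(x \<otimes> y) \<otimes> b = x \<otimes> (y \<otimes> b)" using c b by (simp only: ta_assoc)
    also have "\<dots> = x \<otimes> (b \<otimes> y)" using center_comm[OF assms(2) b] by simp
    also have "\<dots> = (x \<otimes> b) \<otimes> y" using c b by (simp only: ta_assoc)
    also have "\<dots> = (b \<otimes> x) \<otimes> y" using center_comm[OF assms(1) b] by simp
    also have "\<dots> = b \<otimes> (x \<otimes> y)" using c b by (simp only: ta_assoc)
    finally show ?thesis .
  qed
  then show ?thesis using c by (auto simp: center_monoid_def)
qed

lemma comm_monoid_center: "comm_monoid center_monoid"
  unfolding comm_monoid_def comm_monoid_axioms_def monoid_def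
proof (intro conjI allI impI)
  fix x y z
  assume x: "x \<in> carrier center_monoid" and y: "y \<in> carrier center_monoid"
  then show "x \<otimes>\<^bsub>center_monoid\<^esub> y \<in> carrier center_monoid"
    and "x \<otimes>\<^bsub>center_monoid\<^esub> y = y \<otimes>\<^bsub>center_monoid\<^esub> x"
    using center_mult[OF x y] center_comm[OF x center_closed[OF y]] by simp_all
  assume z: "z \<in> carrier center_monoid"
  with x y show "x \<otimes>\<^bsub>center_monoid\<^esub> y \<otimes>\<^bsub>center_monoid\<^esub> z =
      x \<otimes>\<^bsub>center_monoid\<^esub> (y \<otimes>\<^bsub>center_monoid\<^esub> z)"
    using center_closed[OF x] center_closed[OF y] center_closed[OF z] by (simp add: ta_assoc)
next
  show "\<one>\<^bsub>center_monoid\<^esub> \<in> carrier center_monoid"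
    by (simp add: center_monoid_def)
next
  fix x assume x: "x \<in> carrier center_monoid"
  show "\<one>\<^bsub>center_monoid\<^esub> \<otimes>\<^bsub>center_monoid\<^esub> x = x" "x \<otimes>\<^bsub>center_monoid\<^esub> \<one>\<^bsub>center_monoid\<^esub> = x"
    using center_closed[OF x] by simp_all
qed

sublocale C: comm_monoid center_monoid
  by (rule comm_monoid_center)

section \<open>Evaluation of trace polynomials at a point\<close>

definition word_val :: "('x \<Rightarrow> 'a) \<Rightarrow> 'x word \<Rightarrow> 'a" where
  "word_val s w = foldr (\<lambda>x a. s x \<otimes> a) (letters w) \<one>"

definition cyc_val :: "('x \<Rightarrow> 'a) \<Rightarrow> 'x cyc \<Rightarrow> 'a" where
  "cyc_val s M = trc R (word_val s (rep_cyc M))"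

definition mon_val :: "('x \<Rightarrow> 'a) \<Rightarrow> ('x cyc \<Rightarrow>\<^sub>0 nat) \<Rightarrow> 'a" where
  "mon_val s T = pprod center_monoid (\<lambda>M k. cyc_val s M [^] k) T"

definition lin_val :: "('x \<Rightarrow> 'a) \<Rightarrow> ('x word \<Rightarrow>\<^sub>0 'f) \<Rightarrow> 'a" where
  "lin_val s q = pprod (add_monoid R) (\<lambda>w c. c \<odot> word_val s w) q"

definition free_eval :: "('x \<Rightarrow> 'a) \<Rightarrow> ('x, 'f) free_tr \<Rightarrow> 'a" where
  "free_eval s p = pprod (add_monoid R) (\<lambda>T q. mon_val s T \<otimes> lin_val s q) p"

context
  fixes s :: "'x \<Rightarrow> 'a"
  assumes s: "s x \<in> carrier R"
begin

lemma foldr_closed: "foldr (\<lambda>x a. s x \<otimes> a) xs \<one> \<in> carrier R"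
  by (induction xs) (auto simp: s)

lemma word_val_closed [simp]: "word_val s w \<in> carrier R"
  unfolding word_val_def by (rule foldr_closed)

lemma foldr_append_eq: "foldr (\<lambda>x a. s x \<otimes> a) (xs @ ys) \<one>
    = foldr (\<lambda>x a. s x \<otimes> a) xs \<one> \<otimes> foldr (\<lambda>x a. s x \<otimes> a) ys \<one>"
proof (induction xs)
  case Nil
  show ?case using foldr_closed[of ys] by simp
next
  case (Cons x xs)
  then show ?case using foldr_closed[of ys] foldr_closed[of xs] s by (simp add: ta_assoc)
qed

lemma word_val_plus: "word_val s (v + w) = word_val s v \<otimes> word_val s w"
  using foldr_append_eq by (simp add: word_val_def)

lemma word_val_zero: "word_val s 0 = \<one>"
  by (simp add: word_val_def)

text \<open>A rotation exchanges an initial and a final piece of the word, and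
  \<open>trc_commute\<close> allows that. Hence the representative chosen in \<open>cyc_val\<close>
  does not matter.\<close>

lemma trc_word_rotate: "trc R (word_val s (Word (rotate k xs))) = trc R (word_val s (Word xs))"
proof -
  let ?k = "k mod length xs"
  have "Word (rotate k xs) = Word (drop ?k xs) + Word (take ?k xs)"
    by (simp add: plus_word_def rotate_drop_take)
  moreover have "Word xs = Word (take ?k xs) + Word (drop ?k xs)"
    by (simp add: plus_word_def)
  ultimately show ?thesis
    by (metis word_val_plus word_val_closed trc_commute)
qed

lemma cyc_val_abs: "cyc_val s (abs_cyc w) = trc R (word_val s w)"
proof -
  have "cyc_eq (rep_cyc (abs_cyc w)) w"
    by (metis Quotient3_cyc Quotient3_abs_rep cyc.abs_eq_iff)
  then obtain k where "letters w = rotate k (letters (rep_cyc (abs_cyc w)))"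
    by (auto simp: cyc_eq_def)
  then have "w = Word (rotate k (letters (rep_cyc (abs_cyc w))))"
    by (metis letters.simps letters_inject)
  then show ?thesis unfolding cyc_val_def
    using trc_word_rotate[of k "letters (rep_cyc (abs_cyc w))"]
    by (metis letters.simps letters_inject)
qed

lemma cyc_val_center: "cyc_val s M \<in> carrier center_monoid"
  using trc_closed trc_central by (auto simp: center_monoid_def cyc_val_def)

lemma pow_center: "z \<in> carrier center_monoid \<Longrightarrow> z [^] (k::nat) \<in> carrier center_monoid"
  by (induction k) (auto simp: center_mult C.one_closed[simplified])

lemma mon_val_center: "mon_val s T \<in> carrier center_monoid"
  unfolding mon_val_def by (rule C.pprod_closed) (intro pow_center cyc_val_center)

lemma mon_val_closed [simp]: "mon_val s T \<in> carrier R"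
  using mon_val_center[of T] by (rule center_closed)

lemma mon_val_central: "b \<in> carrier R \<Longrightarrow> mon_val s T \<otimes> b = b \<otimes> mon_val s T"
  using mon_val_center[of T] by (rule center_comm)

lemma mon_val_plus: "mon_val s (S + T) = mon_val s S \<otimes> mon_val s T"
proof -
  have c: "cyc_val s M \<in> carrier R" for M
    by (simp add: cyc_val_def trc_closed)
  show ?thesis
    unfolding mon_val_def
    using C.pprod_add[of "\<lambda>M k. cyc_val s M [^] k" S T]
    by (simp add: pow_center cyc_val_center ta_pow_mult[symmetric] c)
qed

lemma mon_val_zero: "mon_val s 0 = \<one>"
  unfolding mon_val_def using C.pprod_zero by simp

lemma mon_val_trmon: "mon_val s (Poly_Mapping.single (abs_cyc w) 1) = trc R (word_val s w)"
proof -
  have c: "cyc_val s M \<in> carrier R" for M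
    by (simp add: cyc_val_def trc_closed)
  have p: "x [^] Suc 0 = x" if "x \<in> carrier R" for x
    using that by simp
  show ?thesis
    unfolding mon_val_def
    using C.pprod_single[of "\<lambda>M k. cyc_val s M [^] k" "abs_cyc w" "1::nat"]
    by (simp add: pow_center cyc_val_center c cyc_val_abs trc_closed p)
qed

lemma lin_val_closed [simp]: "lin_val s q \<in> carrier R"
  unfolding lin_val_def using comm_monoid.pprod_closed[OF add_comm_monoid, of "\<lambda>w c. c \<odot> word_val s w" q]
  by simp

lemma lin_val_zero: "lin_val s 0 = \<zero>"
  unfolding lin_val_def using comm_monoid.pprod_zero[OF add_comm_monoid, of "\<lambda>w c. c \<odot> word_val s w"]
  by simp

lemma lin_val_add: "lin_val s (p + q) = lin_val s p \<oplus> lin_val s q"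
  unfolding lin_val_def using comm_monoid.pprod_add[OF add_comm_monoid, of "\<lambda>w c. c \<odot> word_val s w" p q]
  by (simp add: smult_zero_left smult_add_left)

lemma lin_val_single: "lin_val s (Poly_Mapping.single w c) = c \<odot> word_val s w"
  unfolding lin_val_def using comm_monoid.pprod_single[OF add_comm_monoid, of "\<lambda>w c. c \<odot> word_val s w" w c]
  by (simp add: smult_zero_left)

lemma free_eval_closed [simp]: "free_eval s p \<in> carrier R"
  unfolding free_eval_def using comm_monoid.pprod_closed[OF add_comm_monoid, of "\<lambda>T q. mon_val s T \<otimes> lin_val s q" p]
  by simp

lemma free_eval_add: "free_eval s (p + q) = free_eval s p \<oplus> free_eval s q"
  unfolding free_eval_def using comm_monoid.pprod_add[OF add_comm_monoid, of "\<lambda>T q. mon_val s T \<otimes> lin_val s q" p q]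
  by (simp add: lin_val_zero lin_val_add ta_r_distr)

lemma free_eval_fterm: "free_eval s (fterm T w c) = mon_val s T \<otimes> (c \<odot> word_val s w)"
  unfolding free_eval_def
  using comm_monoid.pprod_single[OF add_comm_monoid, of "\<lambda>T q. mon_val s T \<otimes> lin_val s q" T "Poly_Mapping.single w c"]
  by (simp add: lin_val_zero lin_val_single)

lemma smult_mult: "x \<in> carrier R \<Longrightarrow> y \<in> carrier R \<Longrightarrow> (a \<odot> x) \<otimes> (b \<odot> y) = (a * b) \<odot> (x \<otimes> y)"
  by (simp add: smult_mult_left smult_mult_right smult_smult[symmetric] mult.commute)

lemma free_eval_fterm_mult:
  "free_eval s (fterm S v a * fterm T w b) = free_eval s (fterm S v a) \<otimes> free_eval s (fterm T w b)"
proof -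
  let ?v = "word_val s v" and ?w = "word_val s w"
  have "free_eval s (fterm S v a) \<otimes> free_eval s (fterm T w b)
      = mon_val s S \<otimes> ((a \<odot> ?v) \<otimes> mon_val s T) \<otimes> (b \<odot> ?w)"
    by (simp add: free_eval_fterm ta_assoc)
  also have "\<dots> = mon_val s S \<otimes> (mon_val s T \<otimes> (a \<odot> ?v)) \<otimes> (b \<odot> ?w)"
    using mon_val_central[of "a \<odot> ?v" T] by simp
  also have "\<dots> = (mon_val s S \<otimes> mon_val s T) \<otimes> ((a \<odot> ?v) \<otimes> (b \<odot> ?w))"
    by (simp add: ta_assoc)
  also have "\<dots> = free_eval s (fterm S v a * fterm T w b)"
    by (simp add: fterm_mult free_eval_fterm mon_val_plus word_val_plus smult_mult)
  finally show ?thesis by simp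
qed

lemma free_eval_mult: "free_eval s (p * q) = free_eval s p \<otimes> free_eval s q"
proof (induction p rule: free_tr_induct)
  case (fterm T w c)
  show ?case
    by (induction q rule: free_tr_induct)
      (simp_all only: free_eval_fterm_mult free_eval_add distrib_left, simp add: ta_r_distr)
qed (simp add: free_eval_add distrib_right ta_l_distr)

lemma free_eval_scal: "free_eval s (scal c) = c \<odot> \<one>"
  by (simp add: scal_def free_eval_fterm mon_val_zero word_val_zero)

text \<open>The value of a monomial is a product of traces, and \<open>trc_trc_mult\<close> pulls
  out one trace at a time.\<close>

lemma trc_mon_val: "x \<in> carrier R \<Longrightarrow> trc R (mon_val s T \<otimes> x) = mon_val s T \<otimes> trc R x"
proof (induction T arbitrary: x rule: poly_mapping_additive_induct)
  case zero
  then show ?case by (simp add: mon_val_zero trc_closed)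
next
  case (single M k)
  have M: "M = abs_cyc (rep_cyc M)"
    using Quotient3_abs_rep[OF Quotient3_cyc] by metis
  let ?t = "mon_val s (Poly_Mapping.single M 1)"
  have t: "?t = trc R (word_val s (rep_cyc M))"
    by (subst M) (simp only: mon_val_trmon)
  show ?case using single
  proof (induction k arbitrary: x)
    case 0
    then show ?case by (simp add: mon_val_zero trc_closed)
  next
    case (Suc k)
    have e: "Poly_Mapping.single M (Suc k) = Poly_Mapping.single M 1 + Poly_Mapping.single M k"
      by (simp flip: single_add)
    have "trc R (mon_val s (Poly_Mapping.single M (Suc k)) \<otimes> x)
      = trc R (?t \<otimes> (mon_val s (Poly_Mapping.single M k) \<otimes> x))"
      unfolding e mon_val_plus using Suc.prems by (simp add: ta_assoc)
    also have "\<dots> = ?t \<otimes> trc R (mon_val s (Poly_Mapping.single M k) \<otimes> x)"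
      unfolding t using Suc.prems by (intro trc_trc_mult) auto
    finally show ?case
      unfolding e mon_val_plus using Suc by (simp add: ta_assoc trc_closed)
  qed
next
  case (add p q)
  then show ?case by (simp add: mon_val_plus ta_assoc trc_closed)
qed

lemma free_eval_trc: "free_eval s (free_trc p) = trc R (free_eval s p)"
proof (induction p rule: free_tr_induct)
  case (fterm T w c)
  have "free_eval s (free_trc (fterm T w c))
      = (mon_val s T \<otimes> trc R (word_val s w)) \<otimes> (c \<odot> \<one>)"
    using mon_val_trmon[of w]
    by (simp add: free_eval_fterm mon_val_plus word_val_zero)
  also have "\<dots> = mon_val s T \<otimes> trc R (c \<odot> word_val s w)"
    by (simp add: ta_assoc smult_mult_right trc_smult trc_closed)
  also have "\<dots> = trc R (free_eval s (fterm T w c))"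
    by (simp add: free_eval_fterm trc_mon_val)
  finally show ?case .
qed (simp add: free_trc_add free_eval_add trc_add)

lemma free_eval_hom: "free_eval s \<in> trace_hom free_trace_algebra R"
proof (rule trace_homI)
  show "free_eval s \<one>\<^bsub>free_trace_algebra\<^esub> = \<one>"
    using free_eval_scal[of 1] by (simp add: smult_one_left)
qed (simp_all add: free_eval_add free_eval_mult free_eval_trc free_eval_scal smult_mult_left)

lemma free_eval_var [simp]: "free_eval s (Defs.var x) = s x"
  by (simp add: Defs.var_def free_eval_fterm mon_val_zero word_val_def s smult_one_left)

end

lemma free_eval_unique:
  assumes h: "h \<in> trace_hom free_trace_algebra R"
  shows "h = free_eval (\<lambda>x. h (Defs.var x))"
proof
  fix p
  let ?s = "\<lambda>x. h (Defs.var x)"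
  note H = trace_homD[OF h, simplified]
  have s: "?s x \<in> carrier R" for x using H(1) by simp
  note E = free_eval_add[of ?s, OF s] free_eval_mult[of ?s, OF s] free_eval_trc[of ?s, OF s]
    free_eval_scal[of ?s, OF s] free_eval_var[of ?s, OF s]
  show "h p = free_eval ?s p"
  proof (induction p rule: free_tr_generate)
    case (scal c)
    show ?case using H(4) H(5)[where c = c and x = 1] by (simp add: E)
  qed (simp_all add: H E)
qed

end

section \<open>Newton's identities\<close>

text \<open>The series to be exponentiated has scalar multiples of traces as coefficients, so it is
  central although its coefficient ring is not commutative. That is enough for the derivative of its
  powers.\<close>

lemma fps_central_commute:
  fixes g f :: "'a::ring_1 fps"
  assumes "\<And>j a. fps_nth g j * a = a * fps_nth g j"
  shows "g * f = f * g"
proof (rule fps_ext)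
  fix n
  have "fps_nth (f * g) n = (\<Sum>i=0..n. fps_nth f (n - i) * fps_nth g (n - (n - i)))"
    unfolding fps_mult_nth by (rule sum.reindex_bij_witness[of _ "\<lambda>i. n - i" "\<lambda>i. n - i"]) auto
  also have "\<dots> = fps_nth (g * f) n"
    unfolding fps_mult_nth by (rule sum.cong) (auto simp: assms)
  finally show "fps_nth (g * f) n = fps_nth (f * g) n" by simp
qed

lemma fps_central_deriv_power:
  fixes g :: "'a::ring_1 fps"
  assumes "\<And>j a. fps_nth g j * a = a * fps_nth g j"
  shows "fps_deriv (g ^ Suc k) = of_nat (Suc k) * (fps_deriv g * g ^ k)"
proof (induction k)
  case (Suc k)
  have "fps_deriv (g ^ Suc (Suc k)) = g * fps_deriv (g ^ Suc k) + fps_deriv g * g ^ Suc k"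
    by (simp add: fps_deriv_mult)
  also have "g * fps_deriv (g ^ Suc k) = of_nat (Suc k) * (fps_deriv g * g ^ k) * g"
    unfolding Suc by (rule fps_central_commute) (rule assms)
  also have "\<dots> = of_nat (Suc k) * (fps_deriv g * g ^ Suc k)"
    by (simp only: power_Suc2 mult.assoc)
  finally show ?case
    by (simp only: of_nat_Suc[of "Suc k"] distrib_right mult_1_left add.commute)
qed simp

lemma fps_power_nth_eq_0:
  fixes g :: "'a::ring_1 fps"
  assumes "fps_nth g 0 = 0" "n < i"
  shows "fps_nth (g ^ i) n = 0"
  using assms(2)
proof (induction i arbitrary: n)
  case (Suc i)
  have "fps_nth g j * fps_nth (g ^ i) (n - j) = 0" if "j \<in> {0..n}" for j
    using Suc.prems Suc.IH[of "n - j"] that by (cases j) (auto simp: assms(1))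
  then show ?case by (simp add: fps_mult_nth)
qed simp

text \<open>The bound \<open>m\<close> is left open so that a single range of summation serves all
  coefficients up to \<open>m\<close> when two sums are exchanged; the powers of \<open>g\<close>
  beyond \<open>n\<close> contribute nothing, since \<open>g\<close> has no constant term.\<close>

lemma fps_exp_of_nth:
  assumes "fps_nth g 0 = 0" "n \<le> m"
  shows "fps_nth (fps_exp_of g) n = (\<Sum>i\<le>m. scal (1 / fact i) * fps_nth (g ^ i) n)"
proof -
  have "fps_nth (fps_exp_of g) n = (\<Sum>i=0..n. scal (1 / fact i) * fps_nth (g ^ i) n)"
    by (simp add: fps_exp_of_def fps_compose_nth)
  also have "\<dots> = (\<Sum>i\<le>m. scal (1 / fact i) * fps_nth (g ^ i) n)"
    by (rule sum.mono_neutral_left) (use assms in \<open>auto simp: fps_power_nth_eq_0\<close>)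
  finally show ?thesis .
qed

text \<open>Comparison of coefficients in (exp g)' = g' exp g, an equation obtained from the
  derivatives of the single powers of \<open>g\<close>.\<close>

lemma fps_exp_of_newton:
  assumes g0: "fps_nth g 0 = 0" and c: "\<And>j a. fps_nth g j * a = a * fps_nth g j"
  shows "of_nat (Suc n) * fps_nth (fps_exp_of g) (Suc n) =
    (\<Sum>j\<le>n. of_nat (Suc j) * fps_nth g (Suc j) * fps_nth (fps_exp_of g) (n - j))"
proof -
  have "of_nat (Suc n) * fps_nth (fps_exp_of g) (Suc n) =
      (\<Sum>i\<le>Suc n. scal (1 / fact i) * fps_nth (fps_deriv (g ^ i)) n)"
    unfolding fps_exp_of_nth[OF g0 order_refl] sum_distrib_left
    by (rule sum.cong) (simp_all only: fps_deriv_nth Suc_eq_plus1 scal_of_nat[symmetric]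
      mult.assoc[symmetric] scal_mult[symmetric] mult.commute[of "of_nat _" "_ / _"])
  also have "\<dots> = (\<Sum>i\<le>n. scal (1 / fact (Suc i)) * fps_nth (fps_deriv (g ^ Suc i)) n)"
    by (subst sum.atMost_Suc_shift) simp
  also have "\<dots> = (\<Sum>i\<le>n. scal (1 / fact i) * fps_nth (fps_deriv g * g ^ i) n)"
  proof (rule sum.cong, rule refl)
    fix i
    have "fps_nth (of_nat (Suc i) * (fps_deriv g * g ^ i)) n
        = of_nat (Suc i) * fps_nth (fps_deriv g * g ^ i) n"
      unfolding fps_of_nat[symmetric] by (simp only: fps_mult_left_const_nth)
    then have "scal (1 / fact (Suc i)) * fps_nth (fps_deriv (g ^ Suc i)) n
        = scal (1 / fact (Suc i)) * scal (of_nat (Suc i)) * fps_nth (fps_deriv g * g ^ i) n"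
      unfolding fps_central_deriv_power[OF c] by (simp only: scal_of_nat mult.assoc)
    then show "scal (1 / fact (Suc i)) * fps_nth (fps_deriv (g ^ Suc i)) n
        = scal (1 / fact i) * fps_nth (fps_deriv g * g ^ i) n"
      by (simp add: scal_mult[symmetric] del: of_nat_Suc power_Suc)
  qed
  also have "\<dots> = (\<Sum>i\<le>n. \<Sum>j\<le>n. fps_nth (fps_deriv g) j * (scal (1 / fact i) * fps_nth (g ^ i) (n - j)))"
  proof (rule sum.cong, rule refl)
    fix i
    have "scal (1 / fact i) * (fps_nth (fps_deriv g) j * a) = fps_nth (fps_deriv g) j * (scal (1 / fact i) * a)" for j a
      by (simp only: mult.assoc[symmetric] scal_central[of _ "fps_nth (fps_deriv g) j"])
    then show "scal (1 / fact i) * fps_nth (fps_deriv g * g ^ i) n =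
        (\<Sum>j\<le>n. fps_nth (fps_deriv g) j * (scal (1 / fact i) * fps_nth (g ^ i) (n - j)))"
      by (simp only: fps_mult_nth sum_distrib_left atLeast0AtMost)
  qed
  also have "\<dots> = (\<Sum>j\<le>n. fps_nth (fps_deriv g) j * fps_nth (fps_exp_of g) (n - j))"
    by (subst sum.swap) (simp add: fps_exp_of_nth[OF g0, of "n - _" n] sum_distrib_left)
  finally show ?thesis by simp
qed

text \<open>The signs of \<open>tr_sigma\<close> cancel against those of \<open>CH\<close>: this is
  the coefficient of degree n - i in the formal characteristic polynomial of degree n, and its
  recursion has no alternating signs.\<close>

definition csig :: "nat \<Rightarrow> ('x, 'f::field_char_0) free_tr \<Rightarrow> ('x, 'f) free_tr" where
  "csig i x = (-1) ^ i * tr_sigma i x"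

lemma csig_alt: "csig i x = fps_nth
     (fps_exp_of (- Abs_fps (\<lambda>j. if j = 0 then 0 else scal (1 / of_nat j) * free_trc (x ^ j)))) i"
  unfolding csig_def tr_sigma_def
  by (simp add: mult.assoc[symmetric] power_mult_distrib[symmetric] flip: power_add)

lemma csig_0 [simp]: "csig 0 x = 1"
  by (simp add: csig_alt fps_exp_of_def fps_compose_nth)

text \<open>Differentiating the exponent removes the denominators j. In characteristic 0 these
  identities determine every \<open>csig\<close> from the traces of powers, and this is how
  \<open>csig\<close> is computed in all algebras below.\<close>

lemma csig_newton:
  "of_nat (Suc n) * csig (Suc n) x = - (\<Sum>j\<le>n. free_trc (x ^ Suc j) * csig (n - j) x)"
proof -
  let ?g = "- Abs_fps (\<lambda>j. if j = 0 then 0 else scal (1 / of_nat j) * free_trc (x ^ j))"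
  have "of_nat (Suc n) * fps_nth (fps_exp_of ?g) (Suc n) =
    (\<Sum>j\<le>n. of_nat (Suc j) * fps_nth ?g (Suc j) * fps_nth (fps_exp_of ?g) (n - j))"
  proof (rule fps_exp_of_newton)
    show "fps_nth ?g j * a = a * fps_nth ?g j" for j a
      by (auto simp: mult.assoc free_trc_central[of _ a])
        (simp only: mult.assoc[symmetric] scal_central[of _ a])
  qed simp
  also have "\<dots> = (\<Sum>j\<le>n. - (free_trc (x ^ Suc j) * csig (n - j) x))"
    unfolding csig_alt[symmetric]
  proof (rule sum.cong, rule refl)
    fix j
    have "of_nat (Suc j) * fps_nth ?g (Suc j)
       = - (scal (of_nat (Suc j) * (1 / of_nat (Suc j))) * free_trc (x ^ Suc j))"
      unfolding scal_mult by (simp add: scal_of_nat mult.assoc del: of_nat_Suc power_Suc)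
    then show "of_nat (Suc j) * fps_nth ?g (Suc j) * csig (n - j) x = - (free_trc (x ^ Suc j) * csig (n - j) x)"
      by (simp del: of_nat_Suc power_Suc)
  qed
  finally show ?thesis by (simp add: csig_alt sum_negf)
qed

lemma CH_alt: "CH n x = (\<Sum>i\<le>n. csig i x * x ^ (n - i))"
proof -
  have "(\<Sum>i\<le>n. csig i x * x ^ (n - i)) = csig 0 x * x ^ (n - 0) + (\<Sum>i=1..n. csig i x * x ^ (n - i))"
    by (simp add: sum.atLeast_Suc_atMost atMost_atLeast0)
  moreover have "tr_sigma 0 x = 1" using csig_0[of x] unfolding csig_def by simp
  ultimately show ?thesis by (simp add: CH_def csig_def)
qed


section \<open>Prime trace ideals of the free algebra with trace\<close>

lemma trace_ideal_free:
  "trace_ideal I (free_trace_algebra :: ('f::field, ('x, 'f) free_tr) trace_alg) \<longleftrightarrow>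
    0 \<in> I \<and> (\<forall>a\<in>I. \<forall>b\<in>I. a + b \<in> I) \<and> (\<forall>a\<in>I. \<forall>b. a * b \<in> I \<and> b * a \<in> I) \<and> (\<forall>a\<in>I. free_trc a \<in> I)"
  (is "?L = ?R")
proof
  interpret trace_algebra "free_trace_algebra :: ('f, ('x, 'f) free_tr) trace_alg"
    by (rule trace_algebra_free)
  assume ?L
  then interpret ideal I "free_trace_algebra :: ('f, ('x, 'f) free_tr) trace_alg"
    by (simp add: trace_ideal_def)
  show ?R
    using \<open>?L\<close> additive_subgroup.a_closed[OF is_additive_subgroup] additive_subgroup.zero_closed[OF is_additive_subgroup]
      I_l_closed I_r_closed
    by (auto simp: trace_ideal_def)
next
  interpret trace_algebra "free_trace_algebra :: ('f, ('x, 'f) free_tr) trace_alg"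
    by (rule trace_algebra_free)
  assume R: ?R
  have m: "- a \<in> I" if "a \<in> I" for a
    using R that mult_minus1[of a] by metis
  have inv: "inv\<^bsub>add_monoid (free_trace_algebra :: ('f, ('x, 'f) free_tr) trace_alg)\<^esub> a = - a" for a
    using abelian_group.minus_equality[OF ring.is_abelian_group[OF is_ring], of "- a" a]
    by (simp add: a_inv_def)
  have "ideal I (free_trace_algebra :: ('f, ('x, 'f) free_tr) trace_alg)"
  proof (rule idealI[OF is_ring])
    show "subgroup I (add_monoid (free_trace_algebra :: ('f, ('x, 'f) free_tr) trace_alg))"
      by (rule subgroup.intro) (use R m inv in auto)
  qed (use R in auto)
  with R show ?L by (auto simp: trace_ideal_def)
qed

text \<open>Primeness of the quotient by \<open>I\<close>, read off in the free algebra: a product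
  of ideals being 0 becomes its lying in \<open>I\<close>.\<close>

definition free_prime :: "('x, 'f::field) free_tr set \<Rightarrow> bool" where
  "free_prime I \<longleftrightarrow> trace_ideal I free_trace_algebra \<and> 1 \<notin> I \<and>
    (\<forall>J K. trace_ideal J free_trace_algebra \<and> trace_ideal K free_trace_algebra \<and>
       (\<forall>a\<in>J. \<forall>b\<in>K. a * b \<in> I) \<longrightarrow> J \<subseteq> I \<or> K \<subseteq> I)"

text \<open>A trace is central and can be pulled out of the trace map, so its multiples form a trace
  ideal. Primeness is applied to the ideals generated by the two traces; modulo \<open>I\<close>,
  traces thus have no zero divisors among themselves.\<close>

lemma free_prime_trc:
  assumes I: "free_prime I" and ab: "free_trc a * free_trc b \<in> I"
  shows "free_trc a \<in> I \<or> free_trc b \<in> I"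
proof -
  have tI: "trace_ideal {free_trc a * r | r. True} free_trace_algebra" for a :: "('a, 'b) free_tr"
    unfolding trace_ideal_free
  proof (intro conjI ballI allI)
    show "0 \<in> {free_trc a * r | r. True}" by (auto intro: exI[of _ 0])
  next
    fix x y assume "x \<in> {free_trc a * r | r. True}" "y \<in> {free_trc a * r | r. True}"
    then show "x + y \<in> {free_trc a * r | r. True}"
      by (auto simp flip: distrib_left)
  next
    fix x y assume "x \<in> {free_trc a * r | r. True}"
    then obtain r where r: "x = free_trc a * r" by auto
    show "x * y \<in> {free_trc a * r | r. True}" by (auto simp: r mult.assoc)
    have "y * x = free_trc a * (y * r)"
      unfolding r by (simp only: mult.assoc[symmetric] free_trc_central[of a y])
    then show "y * x \<in> {free_trc a * r | r. True}" by auto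
  next
    fix x assume "x \<in> {free_trc a * r | r. True}"
    then show "free_trc x \<in> {free_trc a * r | r. True}" by (auto simp: free_trc_mult)
  qed
  have I': "trace_ideal I free_trace_algebra" using I by (simp add: free_prime_def)
  have "x * y \<in> I" if x: "x \<in> {free_trc a * r | r. True}" and y: "y \<in> {free_trc b * r | r. True}" for x y
  proof -
    obtain r s where "x = free_trc a * r" "y = free_trc b * s" using x y by auto
    then have "x * y = free_trc a * (r * free_trc b) * s" by (simp add: mult.assoc)
    also have "\<dots> = free_trc a * free_trc b * (r * s)"
      unfolding free_trc_central[of b r, symmetric] by (simp add: mult.assoc)
    finally show ?thesis using ab I' by (simp add: trace_ideal_free)
  qed
  then have "{free_trc a * r | r. True} \<subseteq> I \<or> {free_trc b * r | r. True} \<subseteq> I"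
    using I tI unfolding free_prime_def by blast
  then show ?thesis
    by (metis (mono_tags, lifting) mem_Collect_eq mult.right_neutral subsetD)
qed

text \<open>Replacing $c$ by $2c$ and subtracting $2^m$ times the original relation removes the top term.\<close>

lemma polynomial_coeffs_mem:
  fixes I :: "('x, 'f::field_char_0) free_tr set"
  assumes I: "trace_ideal I free_trace_algebra"
    and "\<And>c. (\<Sum>i\<le>m. scal (c ^ i) * v i) \<in> I" and "i \<le> m"
  shows "v i \<in> I"
proof -
  have add: "a \<in> I \<Longrightarrow> b \<in> I \<Longrightarrow> a + b \<in> I" and mult: "a \<in> I \<Longrightarrow> b * a \<in> I" for a b
    using I by (auto simp: trace_ideal_free)
  have diff: "a \<in> I \<Longrightarrow> b \<in> I \<Longrightarrow> a - b \<in> I" for a b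
    using add[of a "- b"] mult[of b "-1"] by simp
  have sm: "finite A \<Longrightarrow> (\<And>i. i \<in> A \<Longrightarrow> f i \<in> I) \<Longrightarrow> sum f A \<in> I" for A :: "nat set" and f
    by (induction A rule: finite_induct) (use add mult[of _ 0] I in \<open>auto simp: trace_ideal_free\<close>)
  show ?thesis using assms(2,3)
  proof (induction m arbitrary: v i)
    case 0
    then show ?case using "0.prems"(1)[of 1] by simp
  next
    case (Suc m)
    define u where "u i = scal (2 ^ i - 2 ^ Suc m) * v i" for i
    have u: "u i \<in> I" if "i \<le> m" for i
    proof (rule Suc.IH[OF _ that])
      fix c :: 'f
      have "(\<Sum>i\<le>Suc m. scal ((2 * c) ^ i) * v i) - scal (2 ^ Suc m) * (\<Sum>i\<le>Suc m. scal (c ^ i) * v i)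
          = (\<Sum>i\<le>Suc m. scal ((2 * c) ^ i - 2 ^ Suc m * c ^ i) * v i)"
        by (simp only: sum_distrib_left sum_subtractf[symmetric] mult.assoc[symmetric]
            scal_mult[symmetric] left_diff_distrib[symmetric])
          (simp only: diff_conv_add_uminus scal_add scal_uminus)
      also have "\<dots> = (\<Sum>i\<le>m. scal (c ^ i) * u i)"
        unfolding u_def mult.assoc[symmetric] scal_mult[symmetric]
        by (simp add: power_mult_distrib algebra_simps)
      finally have e: "(\<Sum>i\<le>m. scal (c ^ i) * u i) = (\<Sum>i\<le>Suc m. scal ((2 * c) ^ i) * v i)
          - scal (2 ^ Suc m) * (\<Sum>i\<le>Suc m. scal (c ^ i) * v i)" by (rule sym)
      show "(\<Sum>i\<le>m. scal (c ^ i) * u i) \<in> I"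
        unfolding e by (intro diff mult Suc.prems(1))
    qed
    have low: "v i \<in> I" if "i \<le> m" for i
    proof -
      have "(2::'f) ^ i \<noteq> 2 ^ Suc m"
      proof
        assume "(2::'f) ^ i = 2 ^ Suc m"
        then have "of_nat (2 ^ i) = (of_nat (2 ^ Suc m) :: 'f)" by simp
        then have "2 ^ i = (2::nat) ^ Suc m" by (simp only: of_nat_eq_iff)
        then have "i = Suc m" using power_inject_exp[of "2::nat" i "Suc m"] by simp
        with that show False by simp
      qed
      then have "v i = scal (1 / (2 ^ i - 2 ^ Suc m)) * u i"
        unfolding u_def mult.assoc[symmetric] scal_mult[symmetric] by simp
      then show ?thesis using u[OF that] mult by simp
    qed
    have "v (Suc m) = (\<Sum>i\<le>Suc m. scal (1 ^ i) * v i) - (\<Sum>i\<le>m. v i)"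
      by simp
    also have "\<dots> \<in> I"
      by (intro diff Suc.prems(1) sm) (auto intro: low)
    finally show ?case using low Suc.prems(2) le_SucE by blast
  qed
qed

text \<open>The coefficient of c is the linearization of the m-th power at \<open>x\<close> in the
  direction \<open>y\<close>, the one among the \<open>v\<close> that Higman's argument
  uses.\<close>

lemma power_add_scal_expand:
  "\<exists>v. (\<forall>c. (x + scal c * y) ^ m = (\<Sum>k\<le>m. scal (c ^ k) * v k))
    \<and> v 1 = (\<Sum>i<m. x ^ i * y * x ^ (m - 1 - i))"
proof (induction m)
  case 0
  show ?case by (rule exI[of _ "\<lambda>k. if k = 0 then 1 else 0"]) simp
next
  case (Suc m)
  then obtain v where v: "\<And>c. (x + scal c * y) ^ m = (\<Sum>k\<le>m. scal (c ^ k) * v k)"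
    and v1: "v 1 = (\<Sum>i<m. x ^ i * y * x ^ (m - 1 - i))" by blast
  \<comment> \<open>Nothing is known of \<open>v\<close> beyond \<open>m\<close>; cut off there,
    both parts of the product can be summed up to \<open>Suc m\<close>.\<close>
  define v' where "v' k = (if k \<le> m then v k else 0)" for k
  define w where "w k = x * v' k + (if k = 0 then 0 else y * v' (k - 1))" for k
  have v'v: "(\<Sum>k\<le>m. scal (c ^ k) * v k) = (\<Sum>k\<le>m. scal (c ^ k) * v' k)" for c
    by (rule sum.cong) (auto simp: v'_def)
  have xs: "x * (scal b * u) = scal b * (x * u)" "y * (scal b * u) = scal b * (y * u)" for b u
    by (simp_all only: mult.assoc[symmetric] scal_central[of b x] scal_central[of b y])
  have "(x + scal c * y) ^ Suc m = (\<Sum>k\<le>Suc m. scal (c ^ k) * w k)" for c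
  proof -
    have "(x + scal c * y) ^ Suc m = (\<Sum>k\<le>m. scal (c ^ k) * (x * v' k)) + (\<Sum>k\<le>m. scal (c ^ Suc k) * (y * v' k))"
      unfolding power_Suc v v'v distrib_right sum_distrib_left
      by (simp only: mult.assoc xs power_Suc scal_mult sum.distrib)
    also have "(\<Sum>k\<le>m. scal (c ^ k) * (x * v' k)) = (\<Sum>k\<le>Suc m. scal (c ^ k) * (x * v' k))"
      by (simp add: v'_def)
    also have "(\<Sum>k\<le>m. scal (c ^ Suc k) * (y * v' k)) = (\<Sum>k\<le>Suc m. scal (c ^ k) * (if k = 0 then 0 else y * v' (k - 1)))"
      by (subst sum.atMost_Suc_shift) simp
    finally show ?thesis by (simp only: w_def distrib_left sum.distrib)
  qed
  moreover have "w 1 = (\<Sum>i<Suc m. x ^ i * y * x ^ (Suc m - 1 - i))"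
  proof (cases "m = 0")
    case True
    then have "v' 0 = 1" using v[of 0] by (simp add: v'_def)
    with True show ?thesis by (simp add: w_def v'_def)
  next
    case False
    have "v 0 = x ^ m" using v[of 0] by (simp add: power_0_left sum.delta if_distrib[of scal] if_distrib[of "\<lambda>a. a * _"] cong: if_cong)
    then have "w 1 = x * v 1 + y * x ^ m" using False by (simp add: w_def v'_def)
    also have "x * v 1 = (\<Sum>i<m. x ^ Suc i * y * x ^ (m - Suc i))"
      unfolding v1 sum_distrib_left by (simp add: mult.assoc)
    finally show ?thesis by (subst sum.lessThan_Suc_shift) (simp add: add.commute)
  qed
  ultimately show ?case by blast
qed

text \<open>Higman's argument: with $L(x, y) = \sum_{i + j = m} x^i y x^j$ in $I$ by linearization, the double sum
  of $x^i z y^j x^{m-i} y^{m-j}$ is $\sum_j L(x, z y^j) y^{m-j}$ and also $(m+1) x^m z y^m$ modulo $I$.\<close>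

lemma higman:
  fixes I N :: "('x, 'f::field_char_0) free_tr set"
  assumes I: "trace_ideal I free_trace_algebra" and N: "trace_ideal N free_trace_algebra"
    and nil: "\<And>x. x \<in> N \<Longrightarrow> x ^ Suc m \<in> I"
    and x: "x \<in> N" and y: "y \<in> N" and z: "z \<in> N"
  shows "x ^ m * z * y ^ m \<in> I"
proof -
  have add: "a \<in> I \<Longrightarrow> b \<in> I \<Longrightarrow> a + b \<in> I" and mult: "a \<in> I \<Longrightarrow> b * a \<in> I" "a \<in> I \<Longrightarrow> a * b \<in> I" for a b
    using I by (auto simp: trace_ideal_free)
  have diff: "a \<in> I \<Longrightarrow> b \<in> I \<Longrightarrow> a - b \<in> I" for a b
    using add[of a "- b"] mult(1)[of b "-1"] by simp
  have sm: "finite A \<Longrightarrow> (\<And>i. i \<in> A \<Longrightarrow> f i \<in> I) \<Longrightarrow> sum f A \<in> I" for A :: "nat set" and f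
    by (induction A rule: finite_induct) (use add I in \<open>auto simp: trace_ideal_free\<close>)
  have L: "(\<Sum>i\<le>m. p ^ i * q * p ^ (m - i)) \<in> I" if p: "p \<in> N" and q: "q \<in> N" for p q
  proof -
    obtain v where v: "\<And>c. (p + scal c * q) ^ Suc m = (\<Sum>k\<le>Suc m. scal (c ^ k) * v k)"
      and v1: "v 1 = (\<Sum>i<Suc m. p ^ i * q * p ^ (Suc m - 1 - i))"
      using power_add_scal_expand[of p q "Suc m"] by blast
    have "p + scal c * q \<in> N" for c using p q N by (auto simp: trace_ideal_free)
    then have "(\<Sum>k\<le>Suc m. scal (c ^ k) * v k) \<in> I" for c
      using nil v by metis
    then have "v 1 \<in> I" by (rule polynomial_coeffs_mem[OF I]) simp
    then show ?thesis unfolding v1 by (simp add: lessThan_Suc_atMost)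
  qed
  let ?S = "\<lambda>i j. x ^ i * (z * y ^ j) * x ^ (m - i) * y ^ (m - j)"
  have zN: "z * y ^ j \<in> N" for j using z N by (auto simp: trace_ideal_free)
  have xN: "x ^ i \<in> N" if "i > 0" for i
    using x N that by (cases i) (auto simp: trace_ideal_free)
  have "(\<Sum>j\<le>m. \<Sum>i\<le>m. ?S i j) \<in> I"
  proof (rule sm)
    fix j
    have "(\<Sum>i\<le>m. ?S i j) = (\<Sum>i\<le>m. x ^ i * (z * y ^ j) * x ^ (m - i)) * y ^ (m - j)"
      by (simp add: sum_distrib_right)
    then show "(\<Sum>i\<le>m. ?S i j) \<in> I" using mult(2)[OF L[OF x zN]] by simp
  qed simp
  then have 1: "(\<Sum>i\<le>m. \<Sum>j\<le>m. ?S i j) \<in> I" by (subst sum.swap)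
  have S: "(\<Sum>j\<le>m. ?S i j) = x ^ i * z * (\<Sum>j\<le>m. y ^ j * x ^ (m - i) * y ^ (m - j))" for i
    by (simp add: sum_distrib_left mult.assoc)
  \<comment> \<open>For i < m the exponent m - i is positive, so x^(m-i) lies in \<open>N\<close>
    and the inner sum over j is a linearization L(y, x^(m-i)) again. Only the row i = m
    remains.\<close>
  have 2: "(\<Sum>i<m. \<Sum>j\<le>m. ?S i j) \<in> I"
    by (rule sm) (use L[OF y xN] mult(1) in \<open>auto simp: S\<close>)
  have "(\<Sum>i\<le>m. \<Sum>j\<le>m. ?S i j) - (\<Sum>i<m. \<Sum>j\<le>m. ?S i j) = (\<Sum>j\<le>m. ?S m j)"
    by (simp add: lessThan_Suc_atMost[symmetric])
  also have "\<dots> = x ^ m * z * (\<Sum>j\<le>m. y ^ m)"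
    unfolding S by (simp add: power_add[symmetric])
  also have "\<dots> = scal (of_nat (Suc m)) * (x ^ m * z * y ^ m)"
    by (simp only: sum_constant card_atMost scal_of_nat[symmetric] mult.assoc[symmetric]
      scal_central[of _ "x ^ m * z"] scal_central[of _ "x ^ m"]) 
       (simp only: mult.assoc scal_central[of _ z])
  finally have "scal (of_nat (Suc m)) * (x ^ m * z * y ^ m) \<in> I"
    using diff[OF 1 2] by simp
  then have "scal (1 / of_nat (Suc m)) * (scal (of_nat (Suc m)) * (x ^ m * z * y ^ m)) \<in> I"
    by (rule mult)
  then show ?thesis
    by (simp add: mult.assoc[symmetric] scal_mult[symmetric] del: of_nat_Suc)
qed

lemma csig_mem:
  fixes I :: "('x, 'f::field_char_0) free_tr set"
  assumes I: "trace_ideal I free_trace_algebra" and t: "\<And>j. free_trc (x ^ Suc j) \<in> I"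
  shows "csig (Suc i) x \<in> I"
proof -
  have add: "a \<in> I \<Longrightarrow> b \<in> I \<Longrightarrow> a + b \<in> I" and mult: "a \<in> I \<Longrightarrow> b * a \<in> I" "a \<in> I \<Longrightarrow> a * b \<in> I" for a b
    using I by (auto simp: trace_ideal_free)
  have sm: "finite A \<Longrightarrow> (\<And>i. i \<in> A \<Longrightarrow> f i \<in> I) \<Longrightarrow> sum f A \<in> I" for A :: "nat set" and f
    by (induction A rule: finite_induct) (use add I in \<open>auto simp: trace_ideal_free\<close>)
  have "(\<Sum>j\<le>i. free_trc (x ^ Suc j) * csig (i - j) x) \<in> I"
    by (rule sm) (use t mult in auto)
  then have "of_nat (Suc i) * csig (Suc i) x \<in> I"
    unfolding csig_newton using mult(1)[of _ "-1"] by simp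
  then have "scal (1 / of_nat (Suc i)) * (scal (of_nat (Suc i)) * csig (Suc i) x) \<in> I"
    unfolding scal_of_nat by (rule mult)
  then show ?thesis
    by (simp add: mult.assoc[symmetric] scal_mult[symmetric] del: of_nat_Suc)
qed

text \<open>Induction on the nil index. By Higman's argument x^m z y^m lies in \<open>I\<close>, so
  the powers x^m lie in an ideal \<open>A\<close>, and again in an ideal \<open>B\<close>, with A N
  B inside \<open>I\<close>. Primeness puts one of the three factors in \<open>I\<close>: for
  \<open>N\<close> the proof is over, for \<open>A\<close> or \<open>B\<close> the index drops. That
  traces of elements of \<open>N\<close> fall into \<open>I\<close> makes these ideals closed under
  the trace.\<close>

lemma prime_nil_subset:
  fixes I N :: "('x, 'f::field_char_0) free_tr set"
  assumes I: "free_prime I" and N: "trace_ideal N free_trace_algebra" and IN: "I \<subseteq> N"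
    and tN: "\<And>a. a \<in> N \<Longrightarrow> free_trc a \<in> I"
    and nil: "\<And>x. x \<in> N \<Longrightarrow> x ^ m \<in> I"
  shows "N \<subseteq> I"
  using nil
proof (induction m)
  case 0
  have "0 \<in> N" using N by (simp add: trace_ideal_free)
  from 0[OF this] show ?case using I by (simp add: free_prime_def)
next
  case (Suc m)
  have I': "trace_ideal I free_trace_algebra" using I by (simp add: free_prime_def)
  have prime: "J \<subseteq> I \<or> K \<subseteq> I" if "trace_ideal J free_trace_algebra" "trace_ideal K free_trace_algebra"
    "\<And>a b. a \<in> J \<Longrightarrow> b \<in> K \<Longrightarrow> a * b \<in> I" for J K
    using I that unfolding free_prime_def by blast
  note Ifree = I'[unfolded trace_ideal_free] and Nfree = N[unfolded trace_ideal_free]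
  define A where "A = {a \<in> N. \<forall>z\<in>N. \<forall>y\<in>N. a * z * y ^ m \<in> I}"
  define B where "B = {b \<in> N. \<forall>a\<in>A. \<forall>z\<in>N. a * z * b \<in> I}"
  \<comment> \<open>Primeness speaks of two factors. \<open>C\<close> contains N B, so the case of
    three factors splits into \<open>A\<close> with \<open>C\<close> and then \<open>N\<close> with
    \<open>B\<close>.\<close>
  define C where "C = {c \<in> N. \<forall>a\<in>A. a * c \<in> I}"
  have A: "trace_ideal A free_trace_algebra"
    unfolding trace_ideal_free
  proof (intro conjI ballI allI)
    fix a r assume a: "a \<in> A"
    have "a * r * z * y ^ m \<in> I" if "z \<in> N" "y \<in> N" for z y
    proof -
      have "r * z \<in> N" using that Nfree by blast
      then have "a * (r * z) * y ^ m \<in> I" using a that by (auto simp: A_def)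
      then show ?thesis by (simp add: mult.assoc)
    qed
    then show "a * r \<in> A" using a Nfree by (auto simp: A_def)
    show "r * a \<in> A" using a Nfree Ifree by (auto simp: A_def mult.assoc)
  qed (use Ifree Nfree tN in \<open>auto simp: A_def distrib_right\<close>)
  have AN: "a * r \<in> A" if "a \<in> A" for a r using A that by (auto simp: trace_ideal_free)
  have B: "trace_ideal B free_trace_algebra"
    unfolding trace_ideal_free
  proof (intro conjI ballI allI)
    fix b r assume b: "b \<in> B"
    have "a * z * (r * b) \<in> I" if "a \<in> A" "z \<in> N" for a z
    proof -
      have "z * r \<in> N" using that Nfree by blast
      then have "a * (z * r) * b \<in> I" using b that by (auto simp: B_def)
      then show ?thesis by (simp add: mult.assoc)
    qed
    then show "r * b \<in> B" using b Nfree by (auto simp: B_def)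
    show "b * r \<in> B" using b Nfree Ifree by (auto simp: B_def mult.assoc[symmetric])
  qed (use Ifree Nfree tN in \<open>auto simp: B_def distrib_left\<close>)
  have C: "trace_ideal C free_trace_algebra"
    unfolding trace_ideal_free
  proof (intro conjI ballI allI)
    fix c r assume c: "c \<in> C"
    have "a * (r * c) \<in> I" if "a \<in> A" for a
      using c AN[OF that, of r] by (auto simp: C_def mult.assoc[symmetric])
    then show "r * c \<in> C" using c Nfree by (auto simp: C_def)
    show "c * r \<in> C" using c Nfree Ifree by (auto simp: C_def mult.assoc[symmetric])
  qed (use Ifree Nfree tN in \<open>auto simp: C_def distrib_left\<close>)
  have pA: "x ^ m \<in> A" if "x \<in> N" "m > 0" for x
  proof -
    have "x ^ m \<in> N" using that Nfree by (cases m) auto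
    then show ?thesis using higman[OF I' N Suc.prems \<open>x \<in> N\<close>] by (auto simp: A_def)
  qed
  have pB: "x ^ m \<in> B" if "x \<in> N" "m > 0" for x
  proof -
    have "x ^ m \<in> N" using that Nfree by (cases m) auto
    then show ?thesis using that by (auto simp: B_def A_def)
  qed
  show ?case
  proof (cases "m = 0")
    case True
    then show ?thesis using Suc.prems by auto
  next
    case False
    have "A \<subseteq> I \<or> C \<subseteq> I" by (rule prime[OF A C]) (auto simp: C_def)
    then show ?thesis
    proof
      assume "A \<subseteq> I"
      then show ?thesis using Suc.IH pA False by blast
    next
      assume "C \<subseteq> I"
      have "z * b \<in> I" if "z \<in> N" "b \<in> B" for z b
      proof -
        have "z * b \<in> C" using that Nfree by (auto simp: C_def B_def mult.assoc)
        with \<open>C \<subseteq> I\<close> show ?thesis by blast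
      qed
      then have "N \<subseteq> I \<or> B \<subseteq> I" by (intro prime[OF N B]) auto
      then show ?thesis using Suc.IH pB False by blast
    qed
  qed
qed

text \<open>For \<open>x\<close> in the radical \<open>N\<close> the traces of all positive powers
  lie in \<open>I\<close>, hence by Newton's identities so do the \<open>csig\<close> of positive
  index, and modulo \<open>I\<close> the Cayley-Hamilton identity is left with x^n alone.\<close>

lemma free_prime_nondegenerate:
  fixes I :: "('x, 'f::field_char_0) free_tr set"
  assumes I: "free_prime I" and CH: "\<And>p. CH n p \<in> I" and a: "\<And>b. free_trc (a * b) \<in> I"
  shows "a \<in> I"
proof -
  have I': "trace_ideal I free_trace_algebra" using I by (simp add: free_prime_def)
  note Ifree = I'[unfolded trace_ideal_free]
  define N where "N = {a. \<forall>b. free_trc (a * b) \<in> I}"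
  have t1: "free_trc a \<in> I" if "a \<in> N" for a
    using that unfolding N_def by (metis (lifting) mem_Collect_eq mult.right_neutral)
  have N: "trace_ideal N free_trace_algebra"
    unfolding trace_ideal_free
  proof (intro conjI ballI allI)
    fix c r assume c: "c \<in> N"
    have "free_trc (r * c * b) \<in> I" for b
    proof -
      have "free_trc (r * c * b) = free_trc (c * (b * r))"
        using free_trc_commute[of r "c * b"] by (simp add: mult.assoc)
      then show ?thesis using c by (simp add: N_def)
    qed
    then show "r * c \<in> N" by (simp add: N_def)
    show "c * r \<in> N" using c by (simp add: N_def mult.assoc)
    show "free_trc c \<in> N" using t1[OF c] Ifree by (auto simp: N_def free_trc_mult)
  qed (use Ifree in \<open>auto simp: N_def distrib_right free_trc_add\<close>)
  have "N \<subseteq> I"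
  proof (rule prime_nil_subset[OF I N, of n])
    show "I \<subseteq> N" using Ifree by (auto simp: N_def)
    fix x assume x: "x \<in> N"
    show "free_trc x \<in> I" by (rule t1[OF x])
    have "free_trc (x ^ Suc j) \<in> I" for j
      using x by (auto simp: N_def)
    from csig_mem[OF I' this] have c: "csig (Suc i) x \<in> I" for i .
    have s: "(\<Sum>i<n. csig (Suc i) x * x ^ (n - Suc i)) \<in> I"
    proof -
      have "finite A \<Longrightarrow> (\<Sum>i\<in>A. csig (Suc i) x * x ^ (n - Suc i)) \<in> I" for A
        by (induction A rule: finite_induct) (use Ifree c in auto)
      then show ?thesis by simp
    qed
    have "CH n x = x ^ n + (\<Sum>i<n. csig (Suc i) x * x ^ (n - Suc i))"
      unfolding CH_alt lessThan_Suc_atMost[symmetric] by (subst sum.lessThan_Suc_shift) simp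
    then have "x ^ n = CH n x + (-1) * (\<Sum>i<n. csig (Suc i) x * x ^ (n - Suc i))"
      by simp
    also have "\<dots> \<in> I" using CH s Ifree by blast
    finally show "x ^ n \<in> I" .
  qed
  moreover have "a \<in> N" using a by (simp add: N_def)
  ultimately show ?thesis by blast
qed

section \<open>The Cayley-Hamilton theorem and Newton's identities for matrices\<close>

text \<open>The adjugate of X - A is a polynomial in X with matrix coefficients; this is an entry of
  the k-th of them. Working by entries keeps all polynomials over a commutative ring.\<close>

definition adj_coeff :: "'a::idom mat \<Rightarrow> nat \<Rightarrow> nat \<Rightarrow> nat \<Rightarrow> 'a" where
  "adj_coeff A k i j = poly.coeff (adj_mat (char_poly_matrix A) $$ (i, j)) k"

text \<open>The coefficient of X^k in adj(X - A) (X - A) = det(X - A).\<close>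

lemma adj_coeff_rec:
  assumes A: "A \<in> carrier_mat m m" and ij: "i < m" "j < m"
  shows "(if k = 0 then 0 else adj_coeff A (k - 1) i j) - (\<Sum>p<m. adj_coeff A k i p * A $$ (p, j))
      = (if i = j then poly.coeff (char_poly A) k else 0)"
proof -
  let ?X = "char_poly_matrix A" and ?B = "adj_mat (char_poly_matrix A)"
  have X: "?X \<in> carrier_mat m m" using A by simp
  have B: "?B \<in> carrier_mat m m" using adj_mat(1)[OF X] .
  have Xe: "?X $$ (p, j) = (if p = j then [:0, 1:] else 0) + [:- A $$ (p, j):]" if "p < m" for p
    using A that ij by (auto simp: char_poly_matrix_def)
  have "(?B * ?X) $$ (i, j) = (\<Sum>p<m. ?B $$ (i, p) * ?X $$ (p, j))"
    using B X ij by (auto simp: scalar_prod_def atLeast0LessThan)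
  also have "\<dots> = (\<Sum>p<m. (if p = j then ?B $$ (i, p) * [:0, 1:] else 0) + ?B $$ (i, p) * [:- A $$ (p, j):])"
    by (rule sum.cong) (auto simp: Xe algebra_simps)
  also have "\<dots> = pCons 0 (?B $$ (i, j)) + (\<Sum>p<m. smult (- A $$ (p, j)) (?B $$ (i, p)))"
    using ij by (simp add: sum_subtractf sum_negf sum.delta)
  finally have "(?B * ?X) $$ (i, j) = \<dots>" .
  moreover have "(?B * ?X) $$ (i, j) = (if i = j then char_poly A else 0)"
    using adj_mat(3)[OF X] ij by (simp add: char_poly_def)
  ultimately have "pCons 0 (?B $$ (i, j)) + (\<Sum>p<m. smult (- A $$ (p, j)) (?B $$ (i, p)))
      = (if i = j then char_poly A else 0)" by simp
  from arg_cong[where f = "\<lambda>p. poly.coeff p k", OF this]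
  have "(if k = 0 then 0 else poly.coeff (?B $$ (i, j)) (k - 1)) + (\<Sum>p<m. - A $$ (p, j) * poly.coeff (?B $$ (i, p)) k)
      = (if i = j then poly.coeff (char_poly A) k else 0)"
    by (cases k) (auto simp: coeff_sum)
  then show ?thesis
    by (cases "k = 0"; cases "i = j") (simp_all add: adj_coeff_def sum_negf mult.commute)
qed

text \<open>With B_k for the matrix coefficients of the adjugate and c_k for those of the
  characteristic polynomial, the recursion reads B_k = c_(k+1) + B_(k+1) A. It is solved downwards
  from a degree at which the adjugate has no coefficients any more.\<close>

lemma adj_coeff_eq:
  assumes A: "A \<in> carrier_mat m m" and ij: "i < m" "j < m"
  shows "adj_coeff A k i j = (\<Sum>l\<le>m. poly.coeff (char_poly A) (Suc k + l) * (A ^\<^sub>m l) $$ (i, j))"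
proof -
  \<comment> \<open>Starting at N >= m makes the sum on the right vanish there as well, since it
    involves only coefficients of index above m.\<close>
  obtain N where N: "\<And>k i j. k \<ge> N \<Longrightarrow> i < m \<Longrightarrow> j < m \<Longrightarrow> adj_coeff A k i j = 0" and Nm: "N \<ge> m"
  proof
    let ?D = "(\<lambda>(i, j). Polynomial.degree (adj_mat (char_poly_matrix A) $$ (i, j))) ` ({..<m} \<times> {..<m})"
    let ?N = "Suc (Max (insert m ?D))"
    show "?N \<ge> m" by (simp add: le_SucI)
    fix k i j assume k: "k \<ge> ?N" and "i < m" "j < m"
    then have "Polynomial.degree (adj_mat (char_poly_matrix A) $$ (i, j)) \<in> insert m ?D" by auto
    then have "Polynomial.degree (adj_mat (char_poly_matrix A) $$ (i, j)) \<le> Max (insert m ?D)"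
      by (intro Max_ge) auto
    then show "adj_coeff A k i j = 0"
      unfolding adj_coeff_def using k by (intro coeff_eq_0) simp
  qed
  have c0: "poly.coeff (char_poly A) l = 0" if "l > m" for l
    using degree_monic_char_poly[OF A] that by (auto intro: coeff_eq_0)
  have pw: "A ^\<^sub>m l \<in> carrier_mat m m" for l using A by simp
  have "adj_coeff A (N - d) i j = (\<Sum>l\<le>m. poly.coeff (char_poly A) (Suc (N - d) + l) * (A ^\<^sub>m l) $$ (i, j))"
    if "d \<le> N" "i < m" "j < m" for d i j
    using that
  proof (induction d arbitrary: i j)
    case 0
    then show ?case using N Nm by (simp add: c0)
  next
    case (Suc d)
    define k where "k = N - Suc d"
    have kd: "N - d = Suc k" using Suc.prems by (simp add: k_def)
    have "adj_coeff A k i j = (if i = j then poly.coeff (char_poly A) (Suc k) else 0)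
        + (\<Sum>p<m. adj_coeff A (Suc k) i p * A $$ (p, j))"
      using adj_coeff_rec[OF A, of i j "Suc k"] Suc.prems by (simp add: algebra_simps)
    also have "(\<Sum>p<m. adj_coeff A (Suc k) i p * A $$ (p, j))
       = (\<Sum>p<m. \<Sum>l\<le>m. poly.coeff (char_poly A) (Suc (Suc k) + l) * ((A ^\<^sub>m l) $$ (i, p) * A $$ (p, j)))"
      using Suc.IH[unfolded kd] Suc.prems by (simp add: sum_distrib_right mult.assoc)
    also have "\<dots> = (\<Sum>l\<le>m. poly.coeff (char_poly A) (Suc (Suc k) + l) * (A ^\<^sub>m Suc l) $$ (i, j))"
    proof (subst sum.swap, rule sum.cong, rule refl)
      fix l
      have "(A ^\<^sub>m Suc l) $$ (i, j) = (\<Sum>p<m. (A ^\<^sub>m l) $$ (i, p) * A $$ (p, j))"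
        using pw[of l] A Suc.prems by (auto simp: scalar_prod_def atLeast0LessThan)
      then show "(\<Sum>p<m. poly.coeff (char_poly A) (Suc (Suc k) + l) * ((A ^\<^sub>m l) $$ (i, p) * A $$ (p, j)))
        = poly.coeff (char_poly A) (Suc (Suc k) + l) * (A ^\<^sub>m Suc l) $$ (i, j)"
        by (simp add: sum_distrib_left)
    qed
    also have "(if i = j then poly.coeff (char_poly A) (Suc k) else 0)
        = poly.coeff (char_poly A) (Suc k) * (A ^\<^sub>m 0) $$ (i, j)"
      using A Suc.prems by auto
    also have "poly.coeff (char_poly A) (Suc k) * (A ^\<^sub>m 0) $$ (i, j) +
        (\<Sum>l\<le>m. poly.coeff (char_poly A) (Suc (Suc k) + l) * (A ^\<^sub>m Suc l) $$ (i, j))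
        = (\<Sum>l\<le>Suc m. poly.coeff (char_poly A) (Suc k + l) * (A ^\<^sub>m l) $$ (i, j))"
      by (subst sum.atMost_Suc_shift) simp
    also have "\<dots> = (\<Sum>l\<le>m. poly.coeff (char_poly A) (Suc k + l) * (A ^\<^sub>m l) $$ (i, j))"
      by (simp add: c0)
    finally show ?case by (simp add: k_def)
  qed
  from this[of "N - k" i j] show ?thesis
  proof (cases "k \<le> N")
    case False
    then show ?thesis using N[of k i j] ij Nm by (simp add: c0)
  qed (use ij in \<open>simp\<close>)
qed

text \<open>The recursion at k = 0 has no preceding coefficient and gives c_0 = - B_0 A; inserting
  the formula for B_0 turns this into the theorem.\<close>

lemma cayley_hamilton_entry:
  fixes A :: "'a::idom mat"
  assumes A: "A \<in> carrier_mat m m" and ij: "i < m" "j < m"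
  shows "(\<Sum>l\<le>m. poly.coeff (char_poly A) l * (A ^\<^sub>m l) $$ (i, j)) = 0"
proof -
  have c0: "poly.coeff (char_poly A) l = 0" if "l > m" for l
    using degree_monic_char_poly[OF A] that by (auto intro: coeff_eq_0)
  have pw: "A ^\<^sub>m l \<in> carrier_mat m m" for l using A by simp
  have "(\<Sum>l\<le>m. poly.coeff (char_poly A) l * (A ^\<^sub>m l) $$ (i, j))
      = (\<Sum>l\<le>Suc m. poly.coeff (char_poly A) l * (A ^\<^sub>m l) $$ (i, j))"
    by (simp add: c0)
  also have "\<dots> = poly.coeff (char_poly A) 0 * (A ^\<^sub>m 0) $$ (i, j)
      + (\<Sum>l\<le>m. poly.coeff (char_poly A) (Suc l) * (A ^\<^sub>m Suc l) $$ (i, j))"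
    by (subst sum.atMost_Suc_shift) simp
  also have "(\<Sum>l\<le>m. poly.coeff (char_poly A) (Suc l) * (A ^\<^sub>m Suc l) $$ (i, j))
      = (\<Sum>p<m. adj_coeff A 0 i p * A $$ (p, j))"
  proof -
    have "(A ^\<^sub>m Suc l) $$ (i, j) = (\<Sum>p<m. (A ^\<^sub>m l) $$ (i, p) * A $$ (p, j))" for l
      using pw[of l] A ij by (auto simp: scalar_prod_def atLeast0LessThan)
    then show ?thesis
      using ij by (simp add: adj_coeff_eq[OF A] sum_distrib_left sum_distrib_right sum.swap[of _ "{..m}"] mult.assoc
        del: pow_mat.simps)
  qed
  also have "poly.coeff (char_poly A) 0 * (A ^\<^sub>m 0) $$ (i, j) = (if i = j then poly.coeff (char_poly A) 0 else 0)"
    using A ij by auto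
  also have "\<dots> = - (\<Sum>p<m. adj_coeff A 0 i p * A $$ (p, j))"
    using adj_coeff_rec[OF A ij, of 0] by simp
  also have "\<dots> + (\<Sum>p<m. adj_coeff A 0 i p * A $$ (p, j)) = 0"
    by simp
  finally show ?thesis .
qed

lemma mat_trace_alt: "A \<in> carrier_mat m m \<Longrightarrow> mat_trace A = (\<Sum>i<m. A $$ (i, i))"
  by (auto simp: mat_trace_def)

lemma mat_trace_add: "A \<in> carrier_mat m m \<Longrightarrow> B \<in> carrier_mat m m \<Longrightarrow>
    mat_trace (A + B) = mat_trace A + mat_trace B"
  by (auto simp: mat_trace_def sum.distrib)

lemma mat_trace_smult: "A \<in> carrier_mat m m \<Longrightarrow> mat_trace (c \<cdot>\<^sub>m A) = c * mat_trace A"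
  by (auto simp: mat_trace_def sum_distrib_left)

lemma mat_trace_one: "mat_trace (1\<^sub>m m) = of_nat m"
  by (simp add: mat_trace_def)

lemma mat_trace_mult_alt: "A \<in> carrier_mat m m \<Longrightarrow> B \<in> carrier_mat m m \<Longrightarrow>
    mat_trace (A * B) = (\<Sum>i<m. \<Sum>k<m. A $$ (i, k) * B $$ (k, i))"
  by (auto simp: mat_trace_def scalar_prod_def atLeast0LessThan intro!: sum.cong)

lemma mat_trace_mult: "A \<in> carrier_mat m m \<Longrightarrow> B \<in> carrier_mat m m \<Longrightarrow>
    mat_trace (A * B) = mat_trace (B * A)"
  by (subst mat_trace_mult_alt, assumption, assumption, subst sum.swap)
    (simp add: mat_trace_mult_alt mult.commute)

lemma mat_power_add:
  assumes A: "A \<in> carrier_mat m m"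
  shows "A ^\<^sub>m (k + l) = A ^\<^sub>m k * A ^\<^sub>m l"
proof (induction l)
  case 0
  show ?case using A by (simp add: right_mult_one_mat[of _ m m])
next
  case (Suc l)
  have "A ^\<^sub>m k \<in> carrier_mat m m" "A ^\<^sub>m l \<in> carrier_mat m m" using A by simp_all
  with Suc show ?case using A by (simp add: assoc_mult_mat[of _ m m _ m _ m])
qed

text \<open>The derivative of det(X - A) is the trace of the adjugate, whose coefficients are known
  as polynomials in \<open>A\<close>.\<close>

lemma newton_pderiv:
  fixes A :: "'f::field mat"
  assumes A: "A \<in> carrier_mat m m"
  shows "of_nat (Suc k) * poly.coeff (char_poly A) (Suc k)
      = (\<Sum>l\<le>m. poly.coeff (char_poly A) (Suc k + l) * mat_trace (A ^\<^sub>m l))"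
proof -
  have X: "char_poly_matrix A \<in> carrier_mat m m" using A by simp
  have pw: "A ^\<^sub>m l \<in> carrier_mat m m" for l using A by simp
  have d: "adj_mat (char_poly_matrix A) $$ (i, i) = char_poly (mat_delete A i i)" if "i < m" for i
  proof -
    have "char_poly_matrix (mat_delete A i i) = mat_delete (char_poly_matrix A) i i"
      using A that by (intro eq_matI) (auto simp: char_poly_matrix_def mat_delete_def)
    then show ?thesis
      using X that by (simp add: adj_mat_def cofactor_def char_poly_def) 
  qed
  have "of_nat (Suc k) * poly.coeff (char_poly A) (Suc k) = poly.coeff (pderiv (char_poly A)) k"
    by (simp add: coeff_pderiv)
  also have "\<dots> = (\<Sum>i<m. adj_coeff A k i i)"
    by (simp add: pderiv_char_poly[OF A] coeff_sum adj_coeff_def d)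
  also have "\<dots> = (\<Sum>i<m. \<Sum>l\<le>m. poly.coeff (char_poly A) (Suc k + l) * (A ^\<^sub>m l) $$ (i, i))"
    by (rule sum.cong) (simp_all add: adj_coeff_eq[OF A])
  also have "\<dots> = (\<Sum>l\<le>m. poly.coeff (char_poly A) (Suc k + l) * mat_trace (A ^\<^sub>m l))"
    by (subst sum.swap) (simp add: mat_trace_alt[OF pw] sum_distrib_left)
  finally show ?thesis .
qed

text \<open>The series det(1 - uA). Its logarithmic derivative is minus the generating function of
  the tr(A^(j+1)), so products of such series correspond to sums of traces.\<close>

definition fps_char :: "'f::field mat \<Rightarrow> 'f fps" where
  "fps_char A = fps_of_poly (reflect_poly (char_poly A))"

lemma fps_char_nth:
  assumes "A \<in> carrier_mat m m"
  shows "fps_nth (fps_char A) k = (if k \<le> m then poly.coeff (char_poly A) (m - k) else 0)"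
  using degree_monic_char_poly[OF assms] by (simp add: fps_char_def coeff_reflect_poly)

text \<open>As long as k + 1 is at most m, this is the derivative formula with its term l = 0 moved
  to the other side; beyond m it is the trace of the Cayley-Hamilton theorem multiplied by a power
  of \<open>A\<close>.\<close>

lemma newton_matrix:
  fixes A :: "'f::field mat"
  assumes A: "A \<in> carrier_mat m m"
  shows "of_nat (Suc k) * fps_nth (fps_char A) (Suc k)
    = - (\<Sum>j\<le>k. mat_trace (A ^\<^sub>m Suc j) * fps_nth (fps_char A) (k - j))"
proof -
  let ?c = "poly.coeff (char_poly A)" and ?p = "\<lambda>l. mat_trace (A ^\<^sub>m l)"
  have c0: "?c l = 0" if "l > m" for l
    using degree_monic_char_poly[OF A] that by (auto intro: coeff_eq_0)
  have pw: "A ^\<^sub>m l \<in> carrier_mat m m" for l using A by simp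
  have p0: "?p 0 = of_nat m" using A by (simp add: mat_trace_one)
  show ?thesis
  proof (cases "Suc k \<le> m")
    case True
    define d where "d = m - Suc k"
    have m: "m = Suc (d + k)" using True by (simp add: d_def)
    \<comment> \<open>For d = 0 the derivative says nothing; the equation is then the trace of the
      Cayley-Hamilton theorem itself.\<close>
    have 1: "of_nat d * ?c d = (\<Sum>l\<le>m. ?c (d + l) * ?p l)"
    proof (cases d)
      case 0
      have "(\<Sum>i<m. \<Sum>l\<le>m. ?c l * (A ^\<^sub>m l) $$ (i, i)) = 0"
        using cayley_hamilton_entry[OF A] by simp
      then show ?thesis unfolding 0
        by (subst (asm) sum.swap) (simp add: mat_trace_alt[OF pw] sum_distrib_left)
    next
      case (Suc k)
      then show ?thesis using newton_pderiv[OF A, of k] by simp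
    qed
    have "(\<Sum>l\<le>m. ?c (d + l) * ?p l) = (\<Sum>l\<le>Suc k. ?c (d + l) * ?p l)"
      by (rule sum.mono_neutral_right) (auto simp: c0 m)
    also have "\<dots> = ?c d * ?p 0 + (\<Sum>j\<le>k. ?c (d + Suc j) * ?p (Suc j))"
      by (subst sum.atMost_Suc_shift) simp
    finally have "of_nat d * ?c d = of_nat m * ?c d + (\<Sum>j\<le>k. ?c (d + Suc j) * ?p (Suc j))"
      using 1 by (simp only: p0 mult.commute)
    also have "of_nat m * ?c d = of_nat d * ?c d + of_nat (Suc k) * ?c d"
      by (simp add: m algebra_simps)
    finally have "of_nat (Suc k) * ?c d + (\<Sum>j\<le>k. ?c (d + Suc j) * ?p (Suc j)) = 0"
      by (simp only: add.assoc add_cancel_right_right)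
    then have "of_nat (Suc k) * ?c d = - (\<Sum>j\<le>k. ?c (d + Suc j) * ?p (Suc j))"
      by (simp only: eq_neg_iff_add_eq_0)
    also have "(\<Sum>j\<le>k. ?c (d + Suc j) * ?p (Suc j)) = (\<Sum>j\<le>k. ?p (Suc j) * fps_nth (fps_char A) (k - j))"
    proof (rule sum.cong, rule refl)
      fix j assume "j \<in> {..k}"
      then have "m - (k - j) = d + Suc j" "k - j \<le> m" by (auto simp: m)
      then show "?c (d + Suc j) * ?p (Suc j) = ?p (Suc j) * fps_nth (fps_char A) (k - j)"
        by (simp add: fps_char_nth[OF A])
    qed
    finally show ?thesis using True by (simp add: fps_char_nth[OF A] d_def)
  next
    case False
    define e where "e = k - m"
    have k: "k = e + m" using False by (simp add: e_def)
    have "(\<Sum>i<m. \<Sum>p<m. (\<Sum>l\<le>m. ?c l * (A ^\<^sub>m l) $$ (i, p)) * (A ^\<^sub>m Suc e) $$ (p, i)) = 0"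
      using cayley_hamilton_entry[OF A] by simp
    also have "(\<Sum>i<m. \<Sum>p<m. (\<Sum>l\<le>m. ?c l * (A ^\<^sub>m l) $$ (i, p)) * (A ^\<^sub>m Suc e) $$ (p, i))
       = (\<Sum>l\<le>m. ?c l * (\<Sum>i<m. \<Sum>p<m. (A ^\<^sub>m l) $$ (i, p) * (A ^\<^sub>m Suc e) $$ (p, i)))"
      by (simp add: sum_distrib_left sum_distrib_right sum.swap[of _ "{..m}"] mult.assoc del: pow_mat.simps)
    also have "\<dots> = (\<Sum>l\<le>m. ?c l * ?p (l + Suc e))"
    proof (rule sum.cong, rule refl)
      fix l
      have "A ^\<^sub>m (l + Suc e) = A ^\<^sub>m l * A ^\<^sub>m Suc e"
        by (rule mat_power_add[OF A])
      then have "?p (l + Suc e) = (\<Sum>i<m. \<Sum>p<m. (A ^\<^sub>m l) $$ (i, p) * (A ^\<^sub>m Suc e) $$ (p, i))"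
        using pw[of l] pw[of "Suc e"] by (simp only: mat_trace_mult_alt)
      then show "?c l * (\<Sum>i<m. \<Sum>p<m. (A ^\<^sub>m l) $$ (i, p) * (A ^\<^sub>m Suc e) $$ (p, i)) = ?c l * ?p (l + Suc e)"
        by simp
    qed
    also have "\<dots> = (\<Sum>j\<in>{e..k}. ?p (Suc j) * ?c (j - e))"
      by (rule sum.reindex_bij_witness[of _ "\<lambda>j. j - e" "\<lambda>l. l + e"]) (auto simp: k algebra_simps)
    also have "\<dots> = (\<Sum>j\<in>{e..k}. ?p (Suc j) * fps_nth (fps_char A) (k - j))"
    proof (rule sum.cong, rule refl)
      fix j assume "j \<in> {e..k}"
      then have "m - (k - j) = j - e" "k - j \<le> m" by (auto simp: k)
      then show "?p (Suc j) * ?c (j - e) = ?p (Suc j) * fps_nth (fps_char A) (k - j)"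
        by (simp add: fps_char_nth[OF A])
    qed
    also have "\<dots> = (\<Sum>j\<le>k. ?p (Suc j) * fps_nth (fps_char A) (k - j))"
      by (rule sum.mono_neutral_left) (auto simp: fps_char_nth[OF A] k)
    finally show ?thesis using False by (simp add: fps_char_nth[OF A])
  qed
qed

lemma fps_char_deriv:
  fixes A :: "'f::field mat"
  assumes A: "A \<in> carrier_mat m m"
  shows "fps_deriv (fps_char A) = - Abs_fps (\<lambda>j. mat_trace (A ^\<^sub>m Suc j)) * fps_char A"
proof (rule fps_ext)
  fix k
  show "fps_nth (fps_deriv (fps_char A)) k = fps_nth (- Abs_fps (\<lambda>j. mat_trace (A ^\<^sub>m Suc j)) * fps_char A) k"
    using newton_matrix[OF A, of k]
    by (simp add: fps_mult_nth sum_negf atLeast0AtMost)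
qed

lemma mat_poly_annihilate:
  fixes A :: "'f::field mat"
  assumes A: "A \<in> carrier_mat m m" and "char_poly A dvd g" and N: "Polynomial.degree g \<le> N" and ij: "i < m" "j < m"
  shows "(\<Sum>l\<le>N. poly.coeff g l * (A ^\<^sub>m l) $$ (i, j)) = 0"
proof -
  \<comment> \<open>The entry (i, j) of p(A). The induction on the cofactor of
    \<open>char_poly A\<close> in \<open>g\<close> uses only that this is linear in p and that a
    factor X becomes a factor \<open>A\<close>.\<close>
  define E where "E p i j = (\<Sum>l\<le>Polynomial.degree p. poly.coeff p l * (A ^\<^sub>m l) $$ (i, j))" for p i j
  have EN: "E p i j = (\<Sum>l\<le>N. poly.coeff p l * (A ^\<^sub>m l) $$ (i, j))" if "Polynomial.degree p \<le> N" for p N i j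
    unfolding E_def by (rule sum.mono_neutral_left) (use that in \<open>auto simp: coeff_eq_0\<close>)
  have pw: "A ^\<^sub>m l \<in> carrier_mat m m" for l using A by simp
  have Eadd: "E (p + q) i j = E p i j + E q i j" for p q i j
  proof -
    let ?N = "max (Polynomial.degree p) (Polynomial.degree q)"
    have "Polynomial.degree (p + q) \<le> ?N" by (rule degree_add_le_max)
    then show ?thesis
      using EN[of p ?N] EN[of q ?N] EN[of "p + q" ?N] by (simp add: sum.distrib algebra_simps)
  qed
  have Esm: "E (smult a p) i j = a * E p i j" for a p i j
    using EN[of "smult a p" "Polynomial.degree p"] by (simp add: E_def sum_distrib_left degree_smult_le mult.assoc)
  have EX: "E (pCons 0 p) i j = (\<Sum>q<m. E p i q * A $$ (q, j))" if "i < m" "j < m" for p i j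
  proof -
    have "E (pCons 0 p) i j = (\<Sum>l\<le>Suc (Polynomial.degree p). poly.coeff (pCons 0 p) l * (A ^\<^sub>m l) $$ (i, j))"
      by (rule EN) (rule degree_pCons_le)
    also have "\<dots> = (\<Sum>l\<le>Polynomial.degree p. poly.coeff p l * (A ^\<^sub>m Suc l) $$ (i, j))"
      by (subst sum.atMost_Suc_shift) simp
    also have "\<dots> = (\<Sum>l\<le>Polynomial.degree p. \<Sum>q<m. poly.coeff p l * (A ^\<^sub>m l) $$ (i, q) * A $$ (q, j))"
      using pw A that by (intro sum.cong)
        (auto simp: scalar_prod_def atLeast0LessThan sum_distrib_left mult.assoc)
    also have "\<dots> = (\<Sum>q<m. E p i q * A $$ (q, j))"
      by (subst sum.swap) (simp add: E_def sum_distrib_right)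
    finally show ?thesis .
  qed
  have "\<forall>i<m. \<forall>j<m. E (char_poly A * q) i j = 0" for q
  proof (induction q)
    case 0
    show ?case by (simp add: E_def)
  next
    case (pCons a q)
    have "E (char_poly A) i j = 0" if "i < m" "j < m" for i j
      using cayley_hamilton_entry[OF A that] degree_monic_char_poly[OF A] by (simp add: E_def)
    then show ?case using pCons by (simp add: Eadd Esm EX)
  qed
  then show ?thesis using assms(2) ij EN[OF N, of i j] by (auto simp: dvd_def)
qed

section \<open>The algebras of tuples of matrices\<close>

definition block_trace :: "nat list \<Rightarrow> nat list \<Rightarrow> 'f::field mat list \<Rightarrow> 'f" where
  "block_trace ms as rs = (\<Sum>i<length ms. of_nat (as ! i) * mat_trace (rs ! i))"

lemma block_algebra_simps [simp]:
  "mult (block_algebra ms as) = map2 (*)"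
  "one (block_algebra ms as) = map 1\<^sub>m ms"
  "zero (block_algebra ms as) = map (\<lambda>m. 0\<^sub>m m m) ms"
  "add (block_algebra ms as) = map2 (+)"
  "module.smult (block_algebra ms as) = (\<lambda>c. map ((\<cdot>\<^sub>m) c))"
  "trc (block_algebra ms as) = (\<lambda>rs. map ((\<cdot>\<^sub>m) (block_trace ms as rs)) (map 1\<^sub>m ms))"
  by (auto simp: block_algebra_def block_one_def block_trace_def)

lemma block_carrier: "rs \<in> carrier (block_algebra ms as) \<longleftrightarrow>
    length rs = length ms \<and> (\<forall>l<length ms. rs ! l \<in> carrier_mat (ms ! l) (ms ! l))"
  by (simp add: block_algebra_def)

lemma block_nth:
  assumes "rs \<in> carrier (block_algebra ms as)" "l < length ms"
  shows "length rs = length ms" "rs ! l \<in> carrier_mat (ms ! l) (ms ! l)"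
  using assms by (auto simp: block_carrier)

lemma block_eqI:
  assumes "length rs = length ms" "length ss = length ms" "\<And>l. l < length ms \<Longrightarrow> rs ! l = ss ! l"
  shows "rs = ss"
  using assms by (intro nth_equalityI) auto

lemma block_trace_add:
  assumes "rs \<in> carrier (block_algebra ms as)" "ss \<in> carrier (block_algebra ms as)"
  shows "block_trace ms as (map2 (+) rs ss) = block_trace ms as rs + block_trace ms as ss"
  unfolding block_trace_def sum.distrib[symmetric]
  by (rule sum.cong) (use assms in \<open>auto simp: block_carrier mat_trace_add algebra_simps\<close>)

lemma block_trace_smult:
  assumes "rs \<in> carrier (block_algebra ms as)"
  shows "block_trace ms as (map ((\<cdot>\<^sub>m) c) rs) = c * block_trace ms as rs"
  unfolding block_trace_def sum_distrib_left
  by (rule sum.cong) (use assms in \<open>auto simp: block_carrier mat_trace_smult algebra_simps\<close>)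

lemma block_trace_mult:
  assumes "rs \<in> carrier (block_algebra ms as)" "ss \<in> carrier (block_algebra ms as)"
  shows "block_trace ms as (map2 (*) rs ss) = block_trace ms as (map2 (*) ss rs)"
  unfolding block_trace_def
proof (rule sum.cong, rule refl)
  fix l assume l: "l \<in> {..<length ms}"
  have "rs ! l \<in> carrier_mat (ms ! l) (ms ! l)" "ss ! l \<in> carrier_mat (ms ! l) (ms ! l)"
    using assms l by (auto simp: block_carrier)
  from mat_trace_mult[OF this] assms l
  show "of_nat (as ! l) * mat_trace (map2 (*) rs ss ! l) = of_nat (as ! l) * mat_trace (map2 (*) ss rs ! l)"
    by (simp add: block_carrier)
qed

lemma mat_smult_assoc: "(a * b) \<cdot>\<^sub>m A = a \<cdot>\<^sub>m (b \<cdot>\<^sub>m (A :: 'f::field mat))"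
  by (rule eq_matI) auto

lemma mat_one_smult: "1 \<cdot>\<^sub>m A = (A :: 'f::field mat)"
  by (rule eq_matI) auto

lemma ring_block: "ring (block_algebra ms as :: ('f::field, 'f mat list) trace_alg)"
proof (rule ringI)
  let ?B = "block_algebra ms as :: ('f, 'f mat list) trace_alg"
  show "abelian_group ?B"
  proof (rule abelian_groupI)
    fix x assume x: "x \<in> carrier ?B"
    show "\<exists>y\<in>carrier ?B. y \<oplus>\<^bsub>?B\<^esub> x = \<zero>\<^bsub>?B\<^esub>"
      by (rule bexI[of _ "map ((\<cdot>\<^sub>m) (- 1)) x"])
        (use x in \<open>auto simp: block_carrier intro!: nth_equalityI eq_matI\<close>)
  qed (auto simp: block_carrier intro!: nth_equalityI comm_add_mat assoc_add_mat left_add_zero_mat)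
  show "monoid ?B"
    by (rule monoidI) (auto simp: block_carrier assoc_mult_mat intro!: nth_equalityI left_mult_one_mat right_mult_one_mat assoc_mult_mat)
qed (auto simp: block_carrier intro!: nth_equalityI add_mult_distrib_mat mult_add_distrib_mat)

lemma trace_algebra_block: "trace_algebra (block_algebra ms as :: ('f::field, 'f mat list) trace_alg)"
proof -
  let ?B = "block_algebra ms as :: ('f, 'f mat list) trace_alg"
  interpret B: ring ?B by (rule ring_block)
  have m: "module class_ring ?B"
    by (rule moduleI, rule class_cring.cring_axioms, rule B.is_abelian_group)
      (auto simp: block_carrier mat_smult_assoc mat_one_smult
        intro!: nth_equalityI add_smult_distrib_left_mat add_smult_distrib_right_mat)
  interpret module class_ring ?B by fact
  have s: "map ((\<cdot>\<^sub>m) c) (map 1\<^sub>m ms) \<in> carrier ?B" for c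
    by (auto simp: block_carrier)
  show ?thesis
  proof unfold_locales
    fix a b assume a: "a \<in> carrier ?B" and b: "b \<in> carrier ?B"
    show "trc ?B (a \<otimes>\<^bsub>?B\<^esub> b) = trc ?B (b \<otimes>\<^bsub>?B\<^esub> a)"
      using block_trace_mult[OF a b] by simp
    have "map2 (*) (map ((\<cdot>\<^sub>m) c) (map 1\<^sub>m ms)) b = map ((\<cdot>\<^sub>m) c) b" for c
      using b by (intro block_eqI)
        (auto simp: block_carrier mult_smult_assoc_mat[OF one_carrier_mat] left_mult_one_mat)
    then show "trc ?B (trc ?B a \<otimes>\<^bsub>?B\<^esub> b) = trc ?B a \<otimes>\<^bsub>?B\<^esub> trc ?B b"
      using block_trace_smult[OF b] b a
      by (auto simp: block_carrier intro!: nth_equalityI)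
    have c: "x ! l \<in> carrier_mat (ms ! l) (ms ! l)" if "x \<in> carrier ?B" "l < length ms" for x l
      using that by (simp add: block_carrier)
    fix c :: 'f
    show "(c \<odot>\<^bsub>?B\<^esub> a) \<otimes>\<^bsub>?B\<^esub> b = c \<odot>\<^bsub>?B\<^esub> (a \<otimes>\<^bsub>?B\<^esub> b)"
      "a \<otimes>\<^bsub>?B\<^esub> (c \<odot>\<^bsub>?B\<^esub> b) = c \<odot>\<^bsub>?B\<^esub> (a \<otimes>\<^bsub>?B\<^esub> b)"
      using a b mult_smult_assoc_mat[OF c[OF a] c[OF b]] mult_smult_distrib[OF c[OF a] c[OF b]]
      by (auto simp: block_carrier intro!: nth_equalityI)
  qed (auto simp: block_trace_add block_trace_smult simp: block_carrier intro!: nth_equalityI eq_matI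
      simp: algebra_simps)
qed


section \<open>Characteristic polynomial and Newton's identities for a weighted tuple of
  matrices\<close>

lemma fps_deriv_power_log:
  fixes F G :: "'f::field fps"
  assumes "fps_deriv F = G * F"
  shows "fps_deriv (F ^ k) = of_nat k * G * F ^ k"
  by (induction k) (simp_all add: assms algebra_simps)

lemma fps_deriv_prod_log:
  fixes F G :: "'a \<Rightarrow> 'f::field fps"
  assumes "finite A" "\<And>l. l \<in> A \<Longrightarrow> fps_deriv (F l) = G l * F l"
  shows "fps_deriv (prod F A) = sum G A * prod F A"
  using assms by (induction A rule: finite_induct) (simp_all add: algebra_simps)

lemma fps_prod_nth_0:
  fixes F :: "'a \<Rightarrow> 'f::field fps"
  shows "fps_nth (\<Prod>l\<in>A. F l ^ k l) 0 = (\<Prod>l\<in>A. fps_nth (F l) 0 ^ k l)"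
proof -
  have "fps_nth (G ^ j) 0 = fps_nth G 0 ^ j" for G :: "'f fps" and j
    by (induction j) simp_all
  then show ?thesis by (induction A rule: infinite_finite_induct) simp_all
qed

text \<open>The characteristic polynomial of the block diagonal matrix in which block l is repeated
  \<open>as ! l\<close> times; the ordinary trace of that matrix is \<open>block_trace\<close>. Its
  size is the sum of the m_l a_l, which is why the n of \<open>CH n\<close> has to be this
  sum.\<close>

definition block_char :: "nat list \<Rightarrow> nat list \<Rightarrow> 'f::field mat list \<Rightarrow> 'f poly" where
  "block_char ms as rs = (\<Prod>l<length ms. char_poly (rs ! l) ^ (as ! l))"

definition block_fps :: "nat list \<Rightarrow> nat list \<Rightarrow> 'f::field mat list \<Rightarrow> 'f fps" where
  "block_fps ms as rs = fps_of_poly (reflect_poly (block_char ms as rs))"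

context
  fixes ms as :: "nat list" and h :: "('x, 'f::field_char_0) free_tr \<Rightarrow> 'f mat list"
  assumes h: "h \<in> trace_hom free_trace_algebra (block_algebra ms as)"
begin

lemmas hom_block = trace_homD[OF h, simplified]

lemma hom_block_nth:
  assumes "l < length ms"
  shows "length (h p) = length ms" "h p ! l \<in> carrier_mat (ms ! l) (ms ! l)"
    "h (p + q) ! l = h p ! l + h q ! l" "h (p * q) ! l = h p ! l * h q ! l"
    "h 1 ! l = 1\<^sub>m (ms ! l)" "h (scal c * p) ! l = c \<cdot>\<^sub>m h p ! l"
    "h (free_trc p) ! l = block_trace ms as (h p) \<cdot>\<^sub>m 1\<^sub>m (ms ! l)"
    "h (scal c) ! l = c \<cdot>\<^sub>m 1\<^sub>m (ms ! l)"
proof -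
  have len: "length (h p) = length ms" for p
    using hom_block(1)[of p] by (simp add: block_carrier)
  show "length (h p) = length ms" by (rule len)
  show "h p ! l \<in> carrier_mat (ms ! l) (ms ! l)"
    using hom_block(1)[of p] assms by (simp add: block_carrier)
  show "h (p + q) ! l = h p ! l + h q ! l" "h (p * q) ! l = h p ! l * h q ! l"
    "h 1 ! l = 1\<^sub>m (ms ! l)" "h (scal c * p) ! l = c \<cdot>\<^sub>m h p ! l"
    "h (free_trc p) ! l = block_trace ms as (h p) \<cdot>\<^sub>m 1\<^sub>m (ms ! l)"
    using hom_block(2)[of p q] hom_block(3)[of p q] hom_block(4)
      trace_homD(5)[OF h, of p c] hom_block(6)[of p] assms
    by (simp_all add: len)
  show "h (scal c) ! l = c \<cdot>\<^sub>m 1\<^sub>m (ms ! l)"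
    using trace_homD(5)[OF h, of 1 c] hom_block(4) assms by simp
qed

lemma hom_block_power: "l < length ms \<Longrightarrow> h (p ^ k) ! l = (h p ! l) ^\<^sub>m k"
proof (induction k)
  case (Suc k)
  have "p ^ Suc k = p ^ k * p" by (rule power_Suc2)
  with Suc show ?case by (simp only: hom_block_nth pow_mat.simps)
qed (use carrier_matD(1)[OF hom_block_nth(2)[of l p]] in \<open>auto simp: hom_block_nth\<close>)

lemma hom_block_powers: "h (p ^ k) = map (\<lambda>A. A ^\<^sub>m k) (h p)"
proof (cases "ms = []")
  case True
  then show ?thesis using hom_block(1) by (simp add: block_carrier)
next
  case False
  then have "0 < length ms" by simp
  note len = hom_block_nth(1)[OF this]
  show ?thesis by (rule nth_equalityI) (simp_all add: len hom_block_power)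
qed

lemma hom_block_entry_sum:
  assumes "finite A" "l < length ms" "i < ms ! l" "j < ms ! l"
  shows "h (sum q A) ! l $$ (i, j) = (\<Sum>k\<in>A. h (q k) ! l $$ (i, j))"
  using assms(1)
proof (induction A rule: finite_induct)
  case empty
  have "h 0 ! l = 0 \<cdot>\<^sub>m 1\<^sub>m (ms ! l)" using hom_block_nth(8)[OF assms(2), of 0] by simp
  then show ?case using assms by simp
next
  case (insert x A)
  have "h (sum q A) ! l \<in> carrier_mat (ms ! l) (ms ! l)" by (rule hom_block_nth) fact
  from carrier_matD[OF this] insert show ?case using assms by (simp add: hom_block_nth)
qed

end

context
  fixes ms as :: "nat list" and n :: nat
  assumes as_pos: "\<And>l. l < length ms \<Longrightarrow> 0 < as ! l"
    and n: "(\<Sum>l<length ms. ms ! l * as ! l) = n"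
begin

lemma block_char_degree:
  assumes "rs \<in> carrier (block_algebra ms as :: ('f::field, 'f mat list) trace_alg)"
  shows "Polynomial.degree (block_char ms as rs) = n"
proof -
  have d: "Polynomial.degree (char_poly (rs ! l)) = ms ! l" "monic (char_poly (rs ! l))" if "l < length ms" for l
    using degree_monic_char_poly[of "rs ! l" "ms ! l"] block_nth[OF assms that] by auto
  have "Polynomial.degree (block_char ms as rs)
      = (\<Sum>l<length ms. Polynomial.degree (char_poly (rs ! l) ^ (as ! l)))"
    unfolding block_char_def
    by (rule degree_prod_eq_sum_degree) (use d in \<open>force\<close>)
  also have "\<dots> = (\<Sum>l<length ms. ms ! l * as ! l)"
  proof (rule sum.cong, rule refl)
    fix l assume l: "l \<in> {..<length ms}"
    then have "char_poly (rs ! l) \<noteq> 0" using d(2)[of l] by force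
    then show "Polynomial.degree (char_poly (rs ! l) ^ (as ! l)) = ms ! l * as ! l"
      using d(1)[of l] l by (simp add: degree_power_eq)
  qed
  finally show ?thesis using n by simp
qed

lemma block_fps_alt: "block_fps ms as rs = (\<Prod>l<length ms. fps_char (rs ! l) ^ (as ! l))"
  unfolding block_fps_def block_char_def fps_char_def
  by (simp add: reflect_poly_prod reflect_poly_power fps_of_poly_prod fps_of_poly_power)

lemma block_fps_nth:
  assumes "rs \<in> carrier (block_algebra ms as :: ('f::field, 'f mat list) trace_alg)"
  shows "fps_nth (block_fps ms as rs) k = (if k \<le> n then poly.coeff (block_char ms as rs) (n - k) else 0)"
  using block_char_degree[OF assms] by (simp add: block_fps_def coeff_reflect_poly)

lemma block_fps_0:
  assumes "rs \<in> carrier (block_algebra ms as :: ('f::field, 'f mat list) trace_alg)"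
  shows "fps_nth (block_fps ms as rs) 0 = 1"
proof -
  have "fps_nth (fps_char (rs ! l)) 0 = 1" if "l < length ms" for l
    using degree_monic_char_poly[of "rs ! l" "ms ! l"] block_nth[OF assms that]
    by (simp add: fps_char_nth[of _ "ms ! l"])
  then show ?thesis
    unfolding block_fps_alt by (simp add: fps_prod_nth_0)
qed

text \<open>Logarithmic derivatives add over the product of the \<open>fps_char\<close>, with the
  weights as multiplicities, exactly as \<open>block_trace\<close> adds up the traces.\<close>

lemma block_newton:
  assumes rs: "rs \<in> carrier (block_algebra ms as :: ('f::field, 'f mat list) trace_alg)"
  shows "of_nat (Suc k) * fps_nth (block_fps ms as rs) (Suc k) =
    - (\<Sum>j\<le>k. block_trace ms as (map (\<lambda>A. A ^\<^sub>m Suc j) rs) * fps_nth (block_fps ms as rs) (k - j))"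
proof -
  have len: "length rs = length ms" using rs by (simp add: block_carrier)
  let ?G = "\<lambda>l. of_nat (as ! l) * - Abs_fps (\<lambda>j. mat_trace ((rs ! l) ^\<^sub>m Suc j))"
  have "fps_deriv (block_fps ms as rs) = sum ?G {..<length ms} * block_fps ms as rs"
    unfolding block_fps_alt
    by (rule fps_deriv_prod_log, simp, rule fps_deriv_power_log, rule fps_char_deriv)
      (use block_nth[OF rs] in auto)
  moreover have "fps_nth (sum ?G {..<length ms}) j = - block_trace ms as (map (\<lambda>A. A ^\<^sub>m Suc j) rs)" for j
    by (simp add: block_trace_def fps_sum_nth len sum_negf fps_of_nat[symmetric] del: pow_mat.simps)
  ultimately have "fps_nth (fps_deriv (block_fps ms as rs)) k =
      - (\<Sum>j\<le>k. block_trace ms as (map (\<lambda>A. A ^\<^sub>m Suc j) rs) * fps_nth (block_fps ms as rs) (k - j))"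
    by (simp add: fps_mult_nth atLeast0AtMost sum_negf del: pow_mat.simps)
  then show ?thesis by simp
qed

text \<open>As the weights are positive, the characteristic polynomial of each block divides the
  product and so the product annihilates each block.\<close>

lemma block_cayley_hamilton:
  assumes rs: "rs \<in> carrier (block_algebra ms as :: ('f::field, 'f mat list) trace_alg)"
    and l: "l < length ms" and ij: "i < ms ! l" "j < ms ! l"
  shows "(\<Sum>k\<le>n. fps_nth (block_fps ms as rs) k * ((rs ! l) ^\<^sub>m (n - k)) $$ (i, j)) = 0"
proof -
  have "char_poly (rs ! l) dvd char_poly (rs ! l) ^ (as ! l)"
    using as_pos[OF l] by (intro dvd_power) auto
  also have "\<dots> dvd block_char ms as rs"
    unfolding block_char_def using l by (intro dvd_prodI) auto
  finally have "(\<Sum>k\<le>n. poly.coeff (block_char ms as rs) k * ((rs ! l) ^\<^sub>m k) $$ (i, j)) = 0"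
    using ij block_char_degree[OF rs] block_nth[OF rs l]
    by (intro mat_poly_annihilate[of _ "ms ! l"]) auto
  also have "(\<Sum>k\<le>n. poly.coeff (block_char ms as rs) k * ((rs ! l) ^\<^sub>m k) $$ (i, j))
    = (\<Sum>k\<le>n. fps_nth (block_fps ms as rs) k * ((rs ! l) ^\<^sub>m (n - k)) $$ (i, j))"
    by (rule sum.reindex_bij_witness[of _ "\<lambda>k. n - k" "\<lambda>k. n - k"]) (auto simp: block_fps_nth[OF rs])
  finally show ?thesis .
qed

context
  fixes h :: "('x, 'f::field_char_0) free_tr \<Rightarrow> 'f mat list"
  assumes h: "h \<in> trace_hom free_trace_algebra (block_algebra ms as)"
begin

lemmas hb = hom_block[OF h]
lemmas hb_nth = hom_block_nth[OF h]
lemmas hb_power = hom_block_power[OF h]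
lemmas hb_powers = hom_block_powers[OF h]
lemmas hb_entry_sum = hom_block_entry_sum[OF h]

text \<open>Both sides start with the unit and obey Newton's recursion with the same traces of
  powers; characteristic 0 allows the division by k + 1.\<close>

lemma hom_block_csig:
  assumes l: "l < length ms" "i < ms ! l" "j < ms ! l"
  shows "h (csig k p) ! l = fps_nth (block_fps ms as (h p)) k \<cdot>\<^sub>m 1\<^sub>m (ms ! l)"
proof (induction k rule: less_induct)
  case (less k)
  let ?f = "fps_nth (block_fps ms as (h p))" and ?m = "ms ! l"
  have hp: "h p \<in> carrier (block_algebra ms as)" by (rule hb)
  note car = hb_nth(2)[OF l(1)]
  show ?case
  proof (cases k)
    case 0
    then show ?thesis using block_fps_0[OF hp] l by (auto simp: hb_nth intro!: eq_matI)
  next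
    case (Suc k')
    have e: "h (scal (of_nat (Suc k')) * csig (Suc k') p) ! l $$ (a, b)
        = of_nat (Suc k') * ?f (Suc k') * 1\<^sub>m ?m $$ (a, b)" if ab: "a < ?m" "b < ?m" for a b
    proof -
      have "scal (of_nat (Suc k')) * csig (Suc k') p =
          (\<Sum>j\<le>k'. scal (- 1) * (free_trc (p ^ Suc j) * csig (k' - j) p))"
        unfolding scal_of_nat csig_newton by (simp add: scal_uminus sum_negf)
      then have "h (scal (of_nat (Suc k')) * csig (Suc k') p) ! l $$ (a, b)
        = (\<Sum>j\<le>k'. h (scal (- 1) * (free_trc (p ^ Suc j) * csig (k' - j) p)) ! l $$ (a, b))"
        by (simp only: hb_entry_sum[OF finite_atMost l(1) ab])
      also have "\<dots> = (\<Sum>j\<le>k'. - (block_trace ms as (map (\<lambda>A. A ^\<^sub>m Suc j) (h p)) * ?f (k' - j)) * 1\<^sub>m ?m $$ (a, b))"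
      proof (rule sum.cong, rule refl)
        fix j
        have "h (csig (k' - j) p) ! l = ?f (k' - j) \<cdot>\<^sub>m 1\<^sub>m ?m"
          by (rule less) (simp add: Suc)
        moreover have "(c \<cdot>\<^sub>m 1\<^sub>m ?m) * (d \<cdot>\<^sub>m 1\<^sub>m ?m) = (c * d) \<cdot>\<^sub>m (1\<^sub>m ?m :: 'f mat)" for c d
          by (simp add: mult_smult_assoc_mat[OF one_carrier_mat smult_carrier_mat[OF one_carrier_mat]] left_mult_one_mat
            mult_smult_distrib[OF one_carrier_mat one_carrier_mat] mat_smult_assoc)
        ultimately show "h (scal (- 1) * (free_trc (p ^ Suc j) * csig (k' - j) p)) ! l $$ (a, b)
          = - (block_trace ms as (map (\<lambda>A. A ^\<^sub>m Suc j) (h p)) * ?f (k' - j)) * 1\<^sub>m ?m $$ (a, b)"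
          using ab by (simp add: hb_nth[OF l(1)] hb_powers[symmetric] del: power_Suc pow_mat.simps)
      qed
      also have "\<dots> = of_nat (Suc k') * ?f (Suc k') * 1\<^sub>m ?m $$ (a, b)"
        unfolding block_newton[OF hp] by (simp add: sum_distrib_right sum_negf del: pow_mat.simps)
      finally show ?thesis .
    qed
    show ?thesis
    proof (rule eq_matI)
      fix a b assume "a < dim_row (?f k \<cdot>\<^sub>m 1\<^sub>m ?m)" "b < dim_col (?f k \<cdot>\<^sub>m 1\<^sub>m ?m)"
      then have ab: "a < ?m" "b < ?m" by simp_all
      have "of_nat (Suc k') * h (csig (Suc k') p) ! l $$ (a, b)
          = of_nat (Suc k') * (?f (Suc k') * 1\<^sub>m ?m $$ (a, b))"
        using e[OF ab] car[of "csig (Suc k') p"] ab by (simp add: hb_nth[OF l(1)] del: of_nat_Suc)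
      then have "h (csig (Suc k') p) ! l $$ (a, b) = ?f (Suc k') * 1\<^sub>m ?m $$ (a, b)"
        by (simp only: mult_cancel_left of_nat_eq_0_iff) simp
      then show "h (csig k p) ! l $$ (a, b) = (?f k \<cdot>\<^sub>m 1\<^sub>m ?m) $$ (a, b)"
        using ab by (simp add: Suc)
    qed (use car[of "csig k p"] in auto)
  qed
qed

lemma hom_block_CH: "h (CH n p) = \<zero>\<^bsub>block_algebra ms as\<^esub>"
proof (rule block_eqI)
  show "length (h (CH n p)) = length ms" using hb(1)[of "CH n p"] by (simp add: block_carrier)
  fix l assume l: "l < length ms"
  have hp: "h p \<in> carrier (block_algebra ms as)" by (rule hb)
  note car = hb_nth(2)[OF l]
  have "h (CH n p) ! l = 0\<^sub>m (ms ! l) (ms ! l)"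
  proof (rule eq_matI)
    fix i j assume "i < dim_row (0\<^sub>m (ms ! l) (ms ! l) :: 'f mat)" "j < dim_col (0\<^sub>m (ms ! l) (ms ! l) :: 'f mat)"
    then have ij: "i < ms ! l" "j < ms ! l" by simp_all
    have "h (CH n p) ! l $$ (i, j) = (\<Sum>k\<le>n. h (csig k p * p ^ (n - k)) ! l $$ (i, j))"
      unfolding CH_alt by (rule hb_entry_sum) (use l ij in auto)
    also have "\<dots> = (\<Sum>k\<le>n. fps_nth (block_fps ms as (h p)) k * ((h p ! l) ^\<^sub>m (n - k)) $$ (i, j))"
    proof (rule sum.cong, rule refl)
      fix k
      have pw: "(h p ! l) ^\<^sub>m (n - k) \<in> carrier_mat (ms ! l) (ms ! l)" using car[of p] by simp
      show "h (csig k p * p ^ (n - k)) ! l $$ (i, j) =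
          fps_nth (block_fps ms as (h p)) k * ((h p ! l) ^\<^sub>m (n - k)) $$ (i, j)"
        using carrier_matD[OF pw] ij l by (simp add: hb_nth[OF l] hom_block_csig[OF l ij] hb_power
          mult_smult_assoc_mat[OF one_carrier_mat pw] left_mult_one_mat[OF pw])
    qed
    also have "\<dots> = 0" by (rule block_cayley_hamilton[OF hp l ij])
    finally show "h (CH n p) ! l $$ (i, j) = 0\<^sub>m (ms ! l) (ms ! l) $$ (i, j)" using ij by simp
  qed (use car[of "CH n p"] in auto)
  then show "h (CH n p) ! l = \<zero>\<^bsub>block_algebra ms as\<^esub> ! l" using l by simp
qed simp

lemma hom_block_trace_one: "h (free_trc 1 - of_nat n) = \<zero>\<^bsub>block_algebra ms as\<^esub>"
proof (rule block_eqI)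
  show "length (h (free_trc 1 - of_nat n)) = length ms"
    using hb(1) by (simp add: block_carrier)
  fix l assume l: "l < length ms"
  have e: "free_trc 1 - of_nat n = free_trc (1 :: ('x, 'f) free_tr) + scal (- of_nat n)"
    by (simp add: scal_uminus scal_of_nat)
  have "block_trace ms as (h 1) = of_nat n"
    unfolding n[symmetric] using hb(4) by (simp add: block_trace_def mat_trace_one mult.commute)
  then show "h (free_trc 1 - of_nat n) ! l = \<zero>\<^bsub>block_algebra ms as\<^esub> ! l"
    unfolding e using l by (auto simp: hb_nth[OF l] intro!: eq_matI)
qed simp

end

end

section \<open>Quotients of algebras with trace\<close>

lemma (in ring) idealI_closed:
  assumes "A \<subseteq> carrier R" "\<zero> \<in> A" "\<And>a b. a \<in> A \<Longrightarrow> b \<in> A \<Longrightarrow> a \<oplus> b \<in> A"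
    "\<And>a x. a \<in> A \<Longrightarrow> x \<in> carrier R \<Longrightarrow> x \<otimes> a \<in> A"
    "\<And>a x. a \<in> A \<Longrightarrow> x \<in> carrier R \<Longrightarrow> a \<otimes> x \<in> A"
  shows "ideal A R"
proof (rule idealI[OF ring_axioms])
  have inv: "inv\<^bsub>add_monoid R\<^esub> a = \<ominus> a" for a by (simp add: a_inv_def)
  have "\<ominus> a \<in> A" if "a \<in> A" for a
  proof -
    have "\<ominus> a = (\<ominus> \<one>) \<otimes> a" using assms(1) that by (auto simp: l_minus)
    then show ?thesis using assms(4) that by simp
  qed
  then show "subgroup A (add_monoid R)"
    by (intro subgroup.intro) (use assms inv in auto)
qed (use assms in auto)

lemma trace_quot_simps [simp]:
  "carrier (trace_quot R I) = carrier (R Quot I)"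
  "mult (trace_quot R I) = mult (R Quot I)"
  "one (trace_quot R I) = one (R Quot I)"
  "zero (trace_quot R I) = zero (R Quot I)"
  "add (trace_quot R I) = add (R Quot I)"
  by (simp_all add: trace_quot_def)

lemma trace_algebra_image:
  fixes R :: "('f::field, 'a, 'm) trace_alg_scheme" and Q :: "('f, 'b, 'n) trace_alg_scheme"
  assumes R: "trace_algebra R" and Q: "ring Q" and h: "h \<in> trace_hom R Q"
    and surj: "h ` carrier R = carrier Q"
  shows "trace_algebra Q"
proof -
  interpret R: trace_algebra R by fact
  interpret Q: ring Q by fact
  note H = trace_homD[OF h]
  note [simp] = R.trc_closed
  have ex: "\<exists>x\<in>carrier R. y = h x" if "y \<in> carrier Q" for y
    using that surj by auto
  have m: "module class_ring Q"
  proof (rule moduleI, rule class_cring.cring_axioms, rule Q.is_abelian_group)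
    fix a b :: 'f and x assume x: "x \<in> carrier Q"
    then obtain u where u: "u \<in> carrier R" "x = h u" using ex by auto
    show "a \<odot>\<^bsub>Q\<^esub> x \<in> carrier Q"
      using u by (simp add: H(1) H(5)[symmetric])
    show "(a \<oplus>\<^bsub>class_ring\<^esub> b) \<odot>\<^bsub>Q\<^esub> x = (a \<odot>\<^bsub>Q\<^esub> x) \<oplus>\<^bsub>Q\<^esub> (b \<odot>\<^bsub>Q\<^esub> x)"
      using u R.smult_add_left[of u a b] by (simp add: H(5)[symmetric] H(2)[symmetric])
    show "(a \<otimes>\<^bsub>class_ring\<^esub> b) \<odot>\<^bsub>Q\<^esub> x = a \<odot>\<^bsub>Q\<^esub> (b \<odot>\<^bsub>Q\<^esub> x)"
      using u R.smult_smult[of u a b] by (simp add: H(5)[symmetric])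
    show "\<one>\<^bsub>class_ring\<^esub> \<odot>\<^bsub>Q\<^esub> x = x"
      using u R.smult_one_left[of u] by (simp add: H(5)[symmetric])
    fix y assume "y \<in> carrier Q"
    then obtain v where v: "v \<in> carrier R" "y = h v" using ex by auto
    show "a \<odot>\<^bsub>Q\<^esub> (x \<oplus>\<^bsub>Q\<^esub> y) = (a \<odot>\<^bsub>Q\<^esub> x) \<oplus>\<^bsub>Q\<^esub> (a \<odot>\<^bsub>Q\<^esub> y)"
      using u v R.smult_r_distr[of a u v] by (simp add: H(5)[symmetric] H(2)[symmetric])
  qed
  interpret module class_ring Q by fact
  show ?thesis
  proof (rule trace_algebra.intro)
    show "ring Q" by fact
    show "module class_ring Q" by fact
    show "trace_algebra_axioms Q"
    proof
      fix c :: 'f and x y assume x: "x \<in> carrier Q" and y: "y \<in> carrier Q"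
      obtain u where u: "u \<in> carrier R" "x = h u" using ex[OF x] by auto
      obtain v where v: "v \<in> carrier R" "y = h v" using ex[OF y] by auto
      note e = H(2,3)[symmetric] H(5)[symmetric] H(6)[symmetric]
      show "c \<odot>\<^bsub>Q\<^esub> x \<otimes>\<^bsub>Q\<^esub> y = c \<odot>\<^bsub>Q\<^esub> (x \<otimes>\<^bsub>Q\<^esub> y)"
        using u v R.smult_mult_left[of u v c] by (simp add: e)
      show "x \<otimes>\<^bsub>Q\<^esub> (c \<odot>\<^bsub>Q\<^esub> y) = c \<odot>\<^bsub>Q\<^esub> (x \<otimes>\<^bsub>Q\<^esub> y)"
        using u v R.smult_mult_right[of u v c] by (simp add: e)
      show "trc Q x \<in> carrier Q"
        using u by (simp add: H(6)[symmetric] H(1))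
      show "trc Q (x \<oplus>\<^bsub>Q\<^esub> y) = trc Q x \<oplus>\<^bsub>Q\<^esub> trc Q y"
        using u v R.trc_add[of u v] by (simp add: e)
      show "trc Q (c \<odot>\<^bsub>Q\<^esub> x) = c \<odot>\<^bsub>Q\<^esub> trc Q x"
        using u R.trc_smult[of u c] by (simp add: e)
      show "trc Q x \<otimes>\<^bsub>Q\<^esub> y = y \<otimes>\<^bsub>Q\<^esub> trc Q x"
        using u v R.trc_central[of u v] by (simp add: e)
      show "trc Q (x \<otimes>\<^bsub>Q\<^esub> y) = trc Q (y \<otimes>\<^bsub>Q\<^esub> x)"
        using u v R.trc_commute[of u v] by (simp add: e)
      show "trc Q (trc Q x \<otimes>\<^bsub>Q\<^esub> y) = trc Q x \<otimes>\<^bsub>Q\<^esub> trc Q y"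
        using u v R.trc_trc_mult[of u v] by (simp add: e)
    qed
  qed
qed

lemma
  fixes R :: "('f::field, 'a, 'm) trace_alg_scheme"
  assumes R: "trace_algebra R" and I: "trace_ideal I R"
  shows trace_quot_hom: "(\<lambda>x. I +>\<^bsub>R\<^esub> x) \<in> trace_hom R (trace_quot R I)"
    and trace_quot_surj: "(\<lambda>x. I +>\<^bsub>R\<^esub> x) ` carrier R = carrier (trace_quot R I)"
    and trace_quot_kernel: "x \<in> carrier R \<Longrightarrow> I +>\<^bsub>R\<^esub> x = \<zero>\<^bsub>trace_quot R I\<^esub> \<longleftrightarrow> x \<in> I"
    and trace_algebra_quot: "trace_algebra (trace_quot R I)"
proof -
  have rR: "ring R" by (rule trace_algebra_ring[OF R])
  interpret r: ring R by (rule rR)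
  interpret R: trace_algebra R by fact
  have idl: "ideal I R" using I by (simp add: trace_ideal_def)
  interpret I: ideal I R by fact
  let ?Q = "trace_quot R I" and ?h = "\<lambda>x. I +>\<^bsub>R\<^esub> x"
  have rQ: "ring (R Quot I)" by (rule I.quotient_is_ring)
  interpret q: ring "R Quot I" by (rule rQ)
  have ringQ: "ring ?Q"
  proof (rule ringI)
    show "abelian_group ?Q"
    proof (rule abelian_groupI)
      fix x assume x: "x \<in> carrier ?Q"
      show "\<exists>y\<in>carrier ?Q. y \<oplus>\<^bsub>?Q\<^esub> x = \<zero>\<^bsub>?Q\<^esub>"
        by (rule bexI[of _ "\<ominus>\<^bsub>R Quot I\<^esub> x"]) (use x q.l_neg in auto)
    qed (use q.a_assoc q.a_comm in auto)
    show "monoid ?Q"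
      by (rule monoidI) (use q.m_assoc in auto)
  qed (use q.l_distr q.r_distr in auto)
  show surj: "?h ` carrier R = carrier ?Q"
    by (auto simp: FactRing_simps)
  show "I +>\<^bsub>R\<^esub> x = \<zero>\<^bsub>?Q\<^esub> \<longleftrightarrow> x \<in> I" if "x \<in> carrier R" for x
    using ring.a_rcos_zero[OF rR idl] I.a_rcos_self[OF that] I.a_rcos_const[of x] by (auto simp: FactRing_def)
  have Icarr: "i \<in> carrier R" if "i \<in> I" for i using I.Icarr that .
  have cos: "?h u = ?h x" if x: "x \<in> carrier R" and u: "u \<in> ?h x" for u x
    using I.a_repr_independence'[OF u x] by simp
  have smI: "c \<odot>\<^bsub>R\<^esub> i \<in> I" if i: "i \<in> I" for c i
  proof -
    have "c \<odot>\<^bsub>R\<^esub> i = (c \<odot>\<^bsub>R\<^esub> \<one>\<^bsub>R\<^esub>) \<otimes>\<^bsub>R\<^esub> i"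
      using R.smult_mult_left[of "\<one>\<^bsub>R\<^esub>" i c] Icarr[OF i] r.l_one r.one_closed by simp
    then show ?thesis using I.I_l_closed[OF i, of "c \<odot>\<^bsub>R\<^esub> \<one>\<^bsub>R\<^esub>"] R.smult_closed[of c "\<one>\<^bsub>R\<^esub>"] r.one_closed by simp
  qed
  have trI: "trc R i \<in> I" if "i \<in> I" for i using I that by (auto simp: trace_ideal_def)
  \<comment> \<open>\<open>trace_quot\<close> defines its operations as unions over the elements of
    a coset. An additive map that preserves \<open>I\<close> sends a coset into a single coset, so
    the union is that coset.\<close>
  have un: "(\<Union>a\<in>?h x. ?h (f a)) = ?h (f x)"
    if x: "x \<in> carrier R" and f: "\<And>a b. a \<in> carrier R \<Longrightarrow> b \<in> carrier R \<Longrightarrow> f (a \<oplus>\<^bsub>R\<^esub> b) = f a \<oplus>\<^bsub>R\<^esub> f b"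
      and fI: "\<And>i. i \<in> I \<Longrightarrow> f i \<in> I" and fc: "\<And>a. a \<in> carrier R \<Longrightarrow> f a \<in> carrier R" for x f
  proof -
    have "?h (f a) = ?h (f x)" if a: "a \<in> ?h x" for a
    proof -
      obtain i where i: "i \<in> I" "a = i \<oplus>\<^bsub>R\<^esub> x" using a by (auto simp: a_r_coset_def')
      have "f a = f i \<oplus>\<^bsub>R\<^esub> f x" using i x f Icarr by simp
      then have "f a \<in> ?h (f x)" using fI[OF i(1)] by (auto simp: a_r_coset_def')
      then show ?thesis using cos fc x by simp
    qed
    then show ?thesis using I.a_rcos_self[OF x] by blast
  qed
  show hom: "?h \<in> trace_hom R ?Q"
  proof (rule trace_homI)
    fix x assume x: "x \<in> carrier R"
    show "?h x \<in> carrier ?Q" using surj x by blast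
    show "?h (c \<odot>\<^bsub>R\<^esub> x) = c \<odot>\<^bsub>?Q\<^esub> ?h x" for c
      using un[OF x, of "\<lambda>x. c \<odot>\<^bsub>R\<^esub> x"] smI R.smult_r_distr[of c] R.smult_closed[of c]
      by (simp add: trace_quot_def)
    show "?h (trc R x) = trc ?Q (?h x)"
      using un[OF x, of "trc R"] trI R.trc_add R.trc_closed
      by (simp add: trace_quot_def)
    fix y assume y: "y \<in> carrier R"
    show "?h (x \<oplus>\<^bsub>R\<^esub> y) = ?h x \<oplus>\<^bsub>?Q\<^esub> ?h y" "?h (x \<otimes>\<^bsub>R\<^esub> y) = ?h x \<otimes>\<^bsub>?Q\<^esub> ?h y"
      using I.rcos_ring_hom x y by (auto simp: Ring.ring_hom_def)
  next
    show "?h \<one>\<^bsub>R\<^esub> = \<one>\<^bsub>?Q\<^esub>" by (simp add: FactRing_def)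
  qed
  show "trace_algebra ?Q" by (rule trace_algebra_image[OF R ringQ hom surj])
qed

lemma trace_hom_zero:
  assumes h: "h \<in> trace_hom R S" and "ring R" "ring S"
  shows "h \<zero>\<^bsub>R\<^esub> = \<zero>\<^bsub>S\<^esub>"
proof -
  interpret R: ring R by fact
  interpret S: ring S by fact
  have "h \<zero>\<^bsub>R\<^esub> \<oplus>\<^bsub>S\<^esub> h \<zero>\<^bsub>R\<^esub> = h \<zero>\<^bsub>R\<^esub>"
    using trace_homD(2)[OF h, of "\<zero>\<^bsub>R\<^esub>" "\<zero>\<^bsub>R\<^esub>"] by simp
  then show ?thesis using trace_homD(1)[OF h, of "\<zero>\<^bsub>R\<^esub>"]
    by (metis R.zero_closed S.add.r_cancel_one' S.zero_closed)
qed

lemma trace_hom_diff: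
  assumes h: "h \<in> trace_hom R S" and "ring R" "ring S" and x: "x \<in> carrier R" and y: "y \<in> carrier R"
  shows "h (x \<ominus>\<^bsub>R\<^esub> y) = h x \<ominus>\<^bsub>S\<^esub> h y"
proof -
  interpret R: ring R by fact
  interpret S: ring S by fact
  have "h (\<ominus>\<^bsub>R\<^esub> y) \<oplus>\<^bsub>S\<^esub> h y = \<zero>\<^bsub>S\<^esub>"
    using trace_homD(2)[OF h, of "\<ominus>\<^bsub>R\<^esub> y" y] y trace_hom_zero[OF assms(1-3)] by (simp add: R.l_neg)
  then have "h (\<ominus>\<^bsub>R\<^esub> y) = \<ominus>\<^bsub>S\<^esub> h y"
    using trace_homD(1)[OF h] y by (metis R.a_inv_closed S.minus_equality)
  then show ?thesis
    using trace_homD(2)[OF h, of x "\<ominus>\<^bsub>R\<^esub> y"] x y by (simp add: a_minus_def)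
qed

lemma trace_hom_factor:
  assumes R: "trace_algebra R" and Q: "trace_algebra Q" and S: "trace_algebra S"
    and p: "p \<in> trace_hom R Q" and surj: "p ` carrier R = carrier Q"
    and g: "g \<in> trace_hom R S"
    and ker: "\<And>x. x \<in> carrier R \<Longrightarrow> p x = \<zero>\<^bsub>Q\<^esub> \<Longrightarrow> g x = \<zero>\<^bsub>S\<^esub>"
  obtains k where "k \<in> trace_hom Q S" "\<And>x. x \<in> carrier R \<Longrightarrow> k (p x) = g x"
proof
  note rings = trace_algebra_ring[OF R] trace_algebra_ring[OF Q] trace_algebra_ring[OF S]
  interpret R: ring R by (rule rings)
  interpret Q: ring Q by (rule rings)
  interpret S: ring S by (rule rings)
  interpret TR: trace_algebra R by (rule R)
  \<comment> \<open>Any preimage will do: two of them differ by an element of the kernel of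
    \<open>p\<close>, which \<open>g\<close> kills.\<close>
  let ?k = "\<lambda>y. g (SOME x. x \<in> carrier R \<and> p x = y)"
  show k: "?k (p x) = g x" if x: "x \<in> carrier R" for x
  proof -
    have "g z = g x" if z: "z \<in> carrier R \<and> p z = p x" for z
    proof -
      have zR: "z \<in> carrier R" and pz: "p z = p x" using z by auto
      have d: "z \<ominus>\<^bsub>R\<^esub> x \<in> carrier R" using zR x by (rule R.minus_closed)
      have "p (z \<ominus>\<^bsub>R\<^esub> x) = p z \<ominus>\<^bsub>Q\<^esub> p x"
        by (rule trace_hom_diff[OF p rings(1,2) zR x])
      also have "\<dots> = \<zero>\<^bsub>Q\<^esub>"
        unfolding pz using Q.r_neg[OF trace_homD(1)[OF p x]] by (simp add: a_minus_def)
      finally have "g (z \<ominus>\<^bsub>R\<^esub> x) = \<zero>\<^bsub>S\<^esub>" by (rule ker[OF d])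
      then have "g z \<ominus>\<^bsub>S\<^esub> g x = \<zero>\<^bsub>S\<^esub>"
        unfolding trace_hom_diff[OF g rings(1,3) zR x] .
      then show "g z = g x"
        using S.r_right_minus_eq[OF trace_homD(1)[OF g zR] trace_homD(1)[OF g x]] by blast
    qed
    then show ?thesis using someI[of "\<lambda>z. z \<in> carrier R \<and> p z = p x" x] x by blast
  qed
  have ex: "\<exists>x\<in>carrier R. y = p x" if "y \<in> carrier Q" for y using that surj by auto
  note P = trace_homD[OF p] and G = trace_homD[OF g]
  show "?k \<in> trace_hom Q S"
  proof (rule trace_homI)
    fix y assume "y \<in> carrier Q"
    then obtain x where x: "x \<in> carrier R" "y = p x" using ex by auto
    show "?k y \<in> carrier S" using x k G(1) by simp
    show "?k (c \<odot>\<^bsub>Q\<^esub> y) = c \<odot>\<^bsub>S\<^esub> ?k y" for c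
      using k[OF x(1)] k[of "c \<odot>\<^bsub>R\<^esub> x"] x TR.smult_closed[of c x] P(5)[OF x(1)] G(5)[OF x(1)] by simp
    show "?k (trc Q y) = trc S (?k y)"
      using k[OF x(1)] k[of "trc R x"] x TR.trc_closed P(6)[OF x(1)] G(6)[OF x(1)] by simp
    fix y' assume "y' \<in> carrier Q"
    then obtain x' where x': "x' \<in> carrier R" "y' = p x'" using ex by auto
    show "?k (y \<oplus>\<^bsub>Q\<^esub> y') = ?k y \<oplus>\<^bsub>S\<^esub> ?k y'"
      using k[OF x(1)] k[OF x'(1)] k[of "x \<oplus>\<^bsub>R\<^esub> x'"] x x' P(2)[OF x(1) x'(1)] G(2)[OF x(1) x'(1)] by simp
    show "?k (y \<otimes>\<^bsub>Q\<^esub> y') = ?k y \<otimes>\<^bsub>S\<^esub> ?k y'"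
      using k[OF x(1)] k[OF x'(1)] k[of "x \<otimes>\<^bsub>R\<^esub> x'"] x x' P(3)[OF x(1) x'(1)] G(3)[OF x(1) x'(1)] by simp
  next
    show "?k \<one>\<^bsub>Q\<^esub> = \<one>\<^bsub>S\<^esub>"
      using k[of "\<one>\<^bsub>R\<^esub>"] P(4) G(4) by simp
  qed
qed

section \<open>Reduction to the free algebra with trace\<close>

text \<open>Trace ideals travel along \<open>p\<close> in both directions. Images of ideals serve to
  show that \<open>I\<close> is prime, preimages to show that \<open>Q\<close> is.\<close>

lemma prime_trace_algebra_iff:
  fixes Q :: "('f::field, 'b, 'n) trace_alg_scheme" and p :: "('x, 'f) free_tr \<Rightarrow> 'b"
  assumes Q: "trace_algebra Q" and p: "p \<in> trace_hom free_trace_algebra Q"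
    and surj: "range p = carrier Q" and ker: "\<And>x. p x = \<zero>\<^bsub>Q\<^esub> \<longleftrightarrow> x \<in> I"
    and I: "trace_ideal I free_trace_algebra"
  shows "prime_trace_algebra Q \<longleftrightarrow> free_prime I"
proof -
  interpret Q: ring Q by (rule trace_algebra_ring[OF Q])
  interpret TQ: trace_algebra Q by (rule Q)
  note P = trace_homD[OF p, simplified]
  have p0: "p 0 = \<zero>\<^bsub>Q\<^esub>" using ker I by (simp add: trace_ideal_free)
  have one: "1 \<in> I \<longleftrightarrow> carrier Q = {\<zero>\<^bsub>Q\<^esub>}"
  proof
    assume "1 \<in> I"
    then have "\<one>\<^bsub>Q\<^esub> = \<zero>\<^bsub>Q\<^esub>" using ker P(4) by metis
    then show "carrier Q = {\<zero>\<^bsub>Q\<^esub>}" by (rule Q.one_zeroD)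
  next
    assume "carrier Q = {\<zero>\<^bsub>Q\<^esub>}"
    then have "p 1 = \<zero>\<^bsub>Q\<^esub>" using P(1) by blast
    then show "1 \<in> I" using ker by simp
  qed
  have img: "trace_ideal (p ` J) Q" if J: "trace_ideal J free_trace_algebra" for J
    unfolding trace_ideal_def
  proof
    note Jf = J[unfolded trace_ideal_free]
    show "ideal (p ` J) Q"
    proof (rule Q.idealI_closed)
      show "\<zero>\<^bsub>Q\<^esub> \<in> p ` J" using p0 Jf by (metis imageI)
    next
      fix a b assume "a \<in> p ` J" "b \<in> p ` J"
      then show "a \<oplus>\<^bsub>Q\<^esub> b \<in> p ` J" using Jf by (auto simp: P(2)[symmetric])
    next
      fix a x assume a: "a \<in> p ` J" and x: "x \<in> carrier Q"
      obtain j where "j \<in> J" "a = p j" using a by blast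
      moreover obtain r where "x = p r" using x surj by blast
      ultimately show "x \<otimes>\<^bsub>Q\<^esub> a \<in> p ` J" "a \<otimes>\<^bsub>Q\<^esub> x \<in> p ` J"
        using Jf by (auto simp: P(3)[symmetric])
    qed (use surj in auto)
    show "trc Q ` p ` J \<subseteq> p ` J"
      using Jf by (auto simp: P(6)[symmetric])
  qed
  have pre: "trace_ideal {x. p x \<in> A} free_trace_algebra" if A: "trace_ideal A Q" for A
  proof -
    interpret A: ideal A Q using A by (simp add: trace_ideal_def)
    have t: "trc Q a \<in> A" if "a \<in> A" for a using A that by (auto simp: trace_ideal_def)
    show ?thesis
      unfolding trace_ideal_free
      using P(1) p0 A.zero_closed A.a_closed A.I_l_closed A.I_r_closed t
      by (auto simp: P(2,3,6))
  qed
  show ?thesis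
  proof
    assume L: "prime_trace_algebra Q"
    show "free_prime I"
      unfolding free_prime_def
    proof (intro conjI allI impI)
      show "1 \<notin> I" using L one by (simp add: prime_trace_algebra_def)
      fix J K
      assume "trace_ideal J free_trace_algebra \<and> trace_ideal K free_trace_algebra \<and> (\<forall>a\<in>J. \<forall>b\<in>K. a * b \<in> I)"
      then have J: "trace_ideal J free_trace_algebra" and K: "trace_ideal K free_trace_algebra"
        and JK: "\<And>a b. a \<in> J \<Longrightarrow> b \<in> K \<Longrightarrow> a * b \<in> I" by auto
      have "x = \<zero>\<^bsub>Q\<^esub>" if "x \<in> (p ` J) \<cdot>\<^bsub>Q\<^esub> (p ` K)" for x
        using that
      proof (induction x rule: ideal_prod.induct)
        case (prod i j)
        then show ?case using JK ker by (auto simp: P(3)[symmetric])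
      qed simp
      moreover have "\<zero>\<^bsub>Q\<^esub> \<in> (p ` J) \<cdot>\<^bsub>Q\<^esub> (p ` K)"
      proof -
        have "p 0 \<in> p ` J" "p 0 \<in> p ` K" using J K by (auto simp: trace_ideal_free)
        from ideal_prod.prod[OF this, of Q] show ?thesis by (simp add: p0)
      qed
      ultimately have "(p ` J) \<cdot>\<^bsub>Q\<^esub> (p ` K) = {\<zero>\<^bsub>Q\<^esub>}" by blast
      then have "p ` J = {\<zero>\<^bsub>Q\<^esub>} \<or> p ` K = {\<zero>\<^bsub>Q\<^esub>}"
        using L img[OF J] img[OF K] unfolding prime_trace_algebra_def by blast
      then show "J \<subseteq> I \<or> K \<subseteq> I" using ker by blast
    qed fact
  next
    assume L: "free_prime I"
    show "prime_trace_algebra Q"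
      unfolding prime_trace_algebra_def
    proof (intro conjI allI impI)
      show "carrier Q \<noteq> {\<zero>\<^bsub>Q\<^esub>}" using L one by (simp add: free_prime_def)
      fix A B
      assume "trace_ideal A Q \<and> trace_ideal B Q \<and> A \<cdot>\<^bsub>Q\<^esub> B = {\<zero>\<^bsub>Q\<^esub>}"
      then have A: "trace_ideal A Q" and B: "trace_ideal B Q" and AB: "A \<cdot>\<^bsub>Q\<^esub> B = {\<zero>\<^bsub>Q\<^esub>}" by auto
      have "a * b \<in> I" if "p a \<in> A" "p b \<in> B" for a b
        using ideal_prod.prod[of "p a" A "p b" B Q] that AB ker[of "a * b"] by (simp add: P(3))
      then have "{x. p x \<in> A} \<subseteq> I \<or> {x. p x \<in> B} \<subseteq> I"
        using L pre[OF A] pre[OF B] unfolding free_prime_def by blast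
      moreover have "A = {\<zero>\<^bsub>Q\<^esub>}" if "trace_ideal A Q" "{x. p x \<in> A} \<subseteq> I" for A
      proof -
        interpret A: ideal A Q using that by (simp add: trace_ideal_def)
        have "a = \<zero>\<^bsub>Q\<^esub>" if a: "a \<in> A" for a
        proof -
          obtain x where "a = p x" using surj A.Icarr[OF a] by blast
          with a \<open>{x. p x \<in> A} \<subseteq> I\<close> ker show ?thesis by blast
        qed
        then show ?thesis using A.zero_closed by blast
      qed
      ultimately show "A = {\<zero>\<^bsub>Q\<^esub>} \<or> B = {\<zero>\<^bsub>Q\<^esub>}" using A B by blast
    qed fact
  qed
qed

lemma T_ideal_Inter:
  fixes \<I> :: "('x, 'f::field) free_tr set set"
  assumes "\<And>I. I \<in> \<I> \<Longrightarrow> T_ideal I free_trace_algebra"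
  shows "T_ideal (\<Inter>\<I>) free_trace_algebra"
  using assms unfolding T_ideal_def trace_ideal_free by fastforce

lemma T_ideal_gen_free: "T_ideal (T_ideal_gen free_trace_algebra G) free_trace_algebra"
  unfolding T_ideal_gen_def by (rule T_ideal_Inter) simp

lemma T_ideal_gen_superset: "G \<subseteq> T_ideal_gen R G"
  by (auto simp: T_ideal_gen_def)

lemma T_ideal_identities:
  fixes A :: "('f::field, 'b, 'n) trace_alg_scheme"
  assumes A: "trace_algebra A"
  shows "T_ideal (trace_identities (free_trace_algebra :: ('f, ('x, 'f) free_tr) trace_alg) A) free_trace_algebra"
proof -
  interpret a: ring A by (rule trace_algebra_ring[OF A])
  interpret A: trace_algebra A by fact
  have z: "h 0 = \<zero>\<^bsub>A\<^esub>" if "h \<in> trace_hom (free_trace_algebra :: ('f, ('x, 'f) free_tr) trace_alg) A" for h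
    using trace_hom_zero[OF that trace_algebra_ring[OF trace_algebra_free] A.is_ring] by simp
  have tz: "trc A \<zero>\<^bsub>A\<^esub> = \<zero>\<^bsub>A\<^esub>"
    using A.trc_add[of "\<zero>\<^bsub>A\<^esub>" "\<zero>\<^bsub>A\<^esub>"] A.trc_closed[of "\<zero>\<^bsub>A\<^esub>"]
    by (metis a.zero_closed a.add.r_cancel_one' a.r_zero)
  show ?thesis
    unfolding T_ideal_def trace_ideal_free trace_identities_def
  proof (intro conjI ballI allI)
    fix g :: "('x, 'f) free_tr \<Rightarrow> ('x, 'f) free_tr"
    assume g: "g \<in> trace_hom free_trace_algebra free_trace_algebra"
    show "g ` {f \<in> carrier free_trace_algebra. \<forall>h\<in>trace_hom free_trace_algebra A. h f = \<zero>\<^bsub>A\<^esub>}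
       \<subseteq> {f \<in> carrier free_trace_algebra. \<forall>h\<in>trace_hom free_trace_algebra A. h f = \<zero>\<^bsub>A\<^esub>}"
      using trace_hom_comp[OF g] by fastforce
  qed (auto simp: z tz trace_homD[simplified] trace_homD(2,3,6)[where R = free_trace_algebra, simplified])
qed


text \<open>The coefficients are carried over by Newton's recursion, which involves only operations
  preserved by \<open>g\<close>, so the exponential series never has to be mapped.\<close>

lemma free_hom_CH:
  fixes g :: "('x, 'f::field_char_0) free_tr \<Rightarrow> ('x, 'f) free_tr"
  assumes g: "g \<in> trace_hom free_trace_algebra free_trace_algebra"
  shows "g (CH n x) = CH n (g x)"
proof -
  note G = trace_homD[OF g, simplified]
  have g0: "g 0 = 0"
    using trace_hom_zero[OF g] trace_algebra_ring[OF trace_algebra_free] by simp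
  have sm: "g (sum f A) = (\<Sum>a\<in>A. g (f a))" for f and A :: "nat set"
    by (induction A rule: infinite_finite_induct) (simp_all add: g0 G(2))
  have pw: "g (x ^ k) = g x ^ k" for k
    by (induction k) (simp_all add: G(3,4))
  have sc: "g (scal c) = scal c" for c
    using trace_homD(5)[OF g, of 1 c] G(4) by simp
  have cs: "g (csig k x) = csig k (g x)" for k
  proof (induction k rule: less_induct)
    case (less k)
    show ?case
    proof (cases k)
      case 0
      then show ?thesis by (simp add: G(4))
    next
      case (Suc k')
      have m: "- y = scal (- 1) * y" for y :: "('x, 'f) free_tr" by (simp add: scal_uminus)
      have "scal (of_nat (Suc k')) * g (csig (Suc k') x) = g (scal (of_nat (Suc k')) * csig (Suc k') x)"
        by (simp only: G(3) sc)
      also have "\<dots> = scal (- 1) * (\<Sum>j\<le>k'. free_trc (g x ^ Suc j) * g (csig (k' - j) x))"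
        unfolding scal_of_nat csig_newton m by (simp only: G(3,6) sc sm pw)
      also have "\<dots> = scal (- 1) * (\<Sum>j\<le>k'. free_trc (g x ^ Suc j) * csig (k' - j) (g x))"
        using less Suc by simp
      also have "\<dots> = scal (of_nat (Suc k')) * csig (Suc k') (g x)"
        unfolding scal_of_nat csig_newton m by (rule refl)
      finally have "scal (1 / of_nat (Suc k')) * (scal (of_nat (Suc k')) * g (csig (Suc k') x))
          = scal (1 / of_nat (Suc k')) * (scal (of_nat (Suc k')) * csig (Suc k') (g x))"
        by (simp only:)
      then show ?thesis
        unfolding Suc by (simp add: mult.assoc[symmetric] scal_mult[symmetric] del: of_nat_Suc)
    qed
  qed
  show ?thesis unfolding CH_alt by (simp only: sm G(3) cs pw)
qed

lemma T_ideal_CH: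
  fixes I :: "('x, 'f::field_char_0) free_tr set"
  assumes I: "T_ideal I free_trace_algebra" and CH: "CH n (Defs.var x) \<in> I"
  shows "CH n p \<in> I"
proof -
  interpret trace_algebra "free_trace_algebra :: ('f, ('x, 'f) free_tr) trace_alg"
    by (rule trace_algebra_free)
  let ?g = "free_eval (\<lambda>_. p)"
  have g: "?g \<in> trace_hom free_trace_algebra free_trace_algebra"
    by (rule free_eval_hom) simp
  have "?g (CH n (Defs.var x)) = CH n p"
    unfolding free_hom_CH[OF g] by (subst free_eval_var) simp_all
  then show ?thesis using I CH g unfolding T_ideal_def by (metis image_subset_iff)
qed

text \<open>\<open>I'\<close> is the preimage of \<open>I\<close> in the free algebra with trace, so
  that the rest of the proof can avoid quotient sets. The last clause concerns algebras in which
  both defining relations hold; every homomorphism from the free algebra to such an \<open>A\<close>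
  factors through \<open>free_CH_algebra n\<close>.\<close>

lemma T_ideal_preimage:
  fixes I :: "(nat, 'f::field_char_0) free_tr set set"
  assumes I: "T_ideal I (free_CH_algebra n)"
  obtains I' :: "(nat, 'f) free_tr set" where
    "T_ideal I' free_trace_algebra" "CH n (Defs.var 0) \<in> I'" "free_trc 1 - of_nat n \<in> I'"
    "prime_trace_ideal I (free_CH_algebra n) \<longleftrightarrow> free_prime I'"
    "\<And>A :: ('f, 'f mat list) trace_alg. trace_algebra A \<Longrightarrow>
      (\<And>h. h \<in> trace_hom (free_trace_algebra :: ('f, (nat, 'f) free_tr) trace_alg) A \<Longrightarrow>
        h (CH n (Defs.var 0)) = \<zero>\<^bsub>A\<^esub> \<and> h (free_trc 1 - of_nat n) = \<zero>\<^bsub>A\<^esub>) \<Longrightarrow>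
      I = trace_identities (free_CH_algebra n) A \<longleftrightarrow> I' = trace_identities free_trace_algebra A"
proof -
  let ?F = "free_trace_algebra :: ('f, (nat, 'f) free_tr) trace_alg"
  let ?G = "{CH n (Defs.var 0), free_trc 1 - of_nat n} :: (nat, 'f) free_tr set"
  define J where "J = T_ideal_gen ?F ?G"
  define S where "S = trace_quot ?F J"
  have S: "free_CH_algebra n = S" by (simp add: S_def J_def free_CH_algebra_def)
  have F: "trace_algebra ?F" by (rule trace_algebra_free)
  have TJ: "T_ideal J ?F" unfolding J_def by (rule T_ideal_gen_free)
  then have tJ: "trace_ideal J ?F" by (simp add: T_ideal_def)
  define p where "p x = J +>\<^bsub>?F\<^esub> x" for x
  have p: "p \<in> trace_hom ?F S" and psurj: "range p = carrier S" and pker: "\<And>x. p x = \<zero>\<^bsub>S\<^esub> \<longleftrightarrow> x \<in> J"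
    and TS: "trace_algebra S"
    using trace_quot_hom[OF F tJ] trace_quot_surj[OF F tJ] trace_quot_kernel[OF F tJ] trace_algebra_quot[OF F tJ]
    unfolding p_def[abs_def] S_def by simp_all
  have tI: "trace_ideal I S" using I by (simp add: T_ideal_def S)
  define Q where "Q = trace_quot S I"
  define q where "q y = I +>\<^bsub>S\<^esub> y" for y
  have q: "q \<in> trace_hom S Q" and qsurj: "q ` carrier S = carrier Q"
    and qker: "\<And>y. y \<in> carrier S \<Longrightarrow> q y = \<zero>\<^bsub>Q\<^esub> \<longleftrightarrow> y \<in> I" and TQ: "trace_algebra Q"
    using trace_quot_hom[OF TS tI] trace_quot_surj[OF TS tI] trace_quot_kernel[OF TS tI] trace_algebra_quot[OF TS tI]
    unfolding q_def[abs_def] Q_def by simp_all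
  define I' where "I' = {x. p x \<in> I}"
  note P = trace_homD[OF p, simplified]
  have Icar: "I \<subseteq> carrier S"
    using tI additive_subgroup.a_subset[OF ideal.axioms(1)] by (auto simp: trace_ideal_def)
  have Iimg: "I = p ` I'"
  proof
    show "I \<subseteq> p ` I'"
    proof
      fix y assume y: "y \<in> I"
      then obtain x where "y = p x" using Icar psurj by blast
      with y show "y \<in> p ` I'" by (auto simp: I'_def)
    qed
  qed (auto simp: I'_def)
  have tI': "trace_ideal I' ?F"
  proof -
    interpret s: ideal I S using tI by (simp add: trace_ideal_def)
    have t: "trc S a \<in> I" if "a \<in> I" for a using tI that by (auto simp: trace_ideal_def)
    have p0: "p 0 = \<zero>\<^bsub>S\<^esub>" using pker[of 0] tJ by (simp add: trace_ideal_free)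
    show ?thesis
      unfolding trace_ideal_free I'_def
      using P(1) p0 s.zero_closed s.a_closed s.I_l_closed s.I_r_closed t
      by (auto simp: P(2,3,6))
  qed
  have JI': "J \<subseteq> I'"
  proof
    fix x assume "x \<in> J"
    then have "p x = \<zero>\<^bsub>S\<^esub>" using pker by simp
    then show "x \<in> I'"
      using tI additive_subgroup.zero_closed[OF ideal.axioms(1)] by (auto simp: I'_def trace_ideal_def)
  qed
  have GJ: "?G \<subseteq> J" unfolding J_def by (rule T_ideal_gen_superset)
  show ?thesis
  proof (rule that[of I'])
    show "CH n (Defs.var 0) \<in> I'" "free_trc 1 - of_nat n \<in> I'" using GJ JI' by auto
    show "T_ideal I' ?F"
      unfolding T_ideal_def
    proof (intro conjI ballI tI')
      fix g assume g: "g \<in> trace_hom ?F ?F"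
      \<comment> \<open>An endomorphism of the free algebra maps the T-ideal \<open>J\<close> into
        itself and so descends to \<open>S\<close>, where the stability of \<open>I\<close> is
        known.\<close>
      have pg: "p \<circ> g \<in> trace_hom ?F S" by (rule trace_hom_comp[OF g p])
      obtain k where k: "k \<in> trace_hom S S" "\<And>x. k (p x) = (p \<circ> g) x"
      proof (rule trace_hom_factor[OF F TS TS p _ pg])
        show "p ` carrier ?F = carrier S" using psurj by simp
        fix x assume "p x = \<zero>\<^bsub>S\<^esub>"
        then have "g x \<in> J" using TJ g pker unfolding T_ideal_def by blast
        then show "(p \<circ> g) x = \<zero>\<^bsub>S\<^esub>" using pker by simp
      qed (use that in auto)
      have "k ` I \<subseteq> I" using I k(1) by (simp add: T_ideal_def S)
      then show "g ` I' \<subseteq> I'" using k(2) by (auto simp: I'_def)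
    qed
    have "prime_trace_algebra Q \<longleftrightarrow> free_prime I'"
    proof (rule prime_trace_algebra_iff[OF TQ _ _ _ tI'])
      show "q \<circ> p \<in> trace_hom ?F Q" by (rule trace_hom_comp[OF p q])
      show "range (q \<circ> p) = carrier Q" using psurj qsurj by (metis image_comp)
      show "(q \<circ> p) x = \<zero>\<^bsub>Q\<^esub> \<longleftrightarrow> x \<in> I'" for x using qker P(1) by (simp add: I'_def)
    qed
    then show "prime_trace_ideal I (free_CH_algebra n) \<longleftrightarrow> free_prime I'"
      using tI by (simp add: prime_trace_ideal_def S Q_def)
  next
    fix A :: "('f, 'f mat list) trace_alg"
    assume A: "trace_algebra A" and h0: "\<And>h. h \<in> trace_hom ?F A \<Longrightarrow>
        h (CH n (Defs.var 0)) = \<zero>\<^bsub>A\<^esub> \<and> h (free_trc 1 - of_nat n) = \<zero>\<^bsub>A\<^esub>"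
    \<comment> \<open>The identities of \<open>A\<close> form a T-ideal containing the two
      generators, hence all of \<open>J\<close>.\<close>
    have "?G \<subseteq> trace_identities ?F A" by (simp add: trace_identities_def h0)
    then have JA: "J \<subseteq> trace_identities ?F A"
      unfolding J_def T_ideal_gen_def using T_ideal_identities[OF A] by blast
    have mem: "p x \<in> trace_identities S A \<longleftrightarrow> x \<in> trace_identities ?F A" for x
    proof
      assume x: "p x \<in> trace_identities S A"
      have "g x = \<zero>\<^bsub>A\<^esub>" if g: "g \<in> trace_hom ?F A" for g
      proof -
        obtain k where k: "k \<in> trace_hom S A" "\<And>x. k (p x) = g x"
        proof (rule trace_hom_factor[OF F TS A p _ g])
          show "p ` carrier ?F = carrier S" using psurj by simp
          fix x assume "p x = \<zero>\<^bsub>S\<^esub>"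
          then have "x \<in> trace_identities ?F A" using JA pker by blast
          then show "g x = \<zero>\<^bsub>A\<^esub>" using g by (simp add: trace_identities_def)
        qed (use that in auto)
        have "k (p x) = \<zero>\<^bsub>A\<^esub>" using x k(1) unfolding trace_identities_def by blast
        then show ?thesis using k(2) by simp
      qed
      then show "x \<in> trace_identities ?F A" by (simp add: trace_identities_def)
    next
      assume x: "x \<in> trace_identities ?F A"
      have "k (p x) = \<zero>\<^bsub>A\<^esub>" if "k \<in> trace_hom S A" for k
      proof -
        have "\<forall>h\<in>trace_hom ?F A. h x = \<zero>\<^bsub>A\<^esub>" using x by (simp add: trace_identities_def)
        from bspec[OF this trace_hom_comp[OF p that]] show ?thesis by simp
      qed
      then show "p x \<in> trace_identities S A" using P(1)[of x] unfolding trace_identities_def by blast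
    qed
    have "trace_identities S A \<subseteq> carrier S" by (auto simp: trace_identities_def)
    have img: "trace_identities S A = p ` trace_identities ?F A"
    proof
      show "trace_identities S A \<subseteq> p ` trace_identities ?F A"
      proof
        fix y assume y: "y \<in> trace_identities S A"
        then obtain x where "y = p x" using psurj \<open>trace_identities S A \<subseteq> carrier S\<close> by blast
        then show "y \<in> p ` trace_identities ?F A" using y mem[of x] by simp
      qed
      show "p ` trace_identities ?F A \<subseteq> trace_identities S A" using mem by blast
    qed
    show "I = trace_identities (free_CH_algebra n) A \<longleftrightarrow> I' = trace_identities ?F A"
    proof
      assume "I = trace_identities (free_CH_algebra n) A"
      then show "I' = trace_identities ?F A" using mem by (auto simp: I'_def S)
    next
      assume "I' = trace_identities ?F A"
      then show "I = trace_identities (free_CH_algebra n) A" unfolding S img Iimg by simp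
    qed
  qed
qed

section \<open>Identities of tuples of matrices form prime ideals\<close>

text \<open>Supplies a fresh variable for any given element, and reduces infinitely many variables
  to a finite induction in \<open>density\<close>.\<close>

lemma (in trace_algebra) free_eval_finite_support:
  fixes f :: "('x, 'f) free_tr"
  obtains V where "finite V" "\<And>s s'. (\<And>x. s x \<in> carrier R) \<Longrightarrow> (\<And>x. s' x \<in> carrier R) \<Longrightarrow>
    (\<And>x. x \<in> V \<Longrightarrow> s x = s' x) \<Longrightarrow> free_eval s f = free_eval s' f"
proof -
  define D where "D f V \<longleftrightarrow> (\<forall>s s'. (\<forall>x. s x \<in> carrier R) \<longrightarrow> (\<forall>x. s' x \<in> carrier R) \<longrightarrow>
    (\<forall>x\<in>V. s x = s' x) \<longrightarrow> free_eval s f = free_eval s' f)" for f :: "('x, 'f) free_tr" and V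
  have DD: "free_eval s f = free_eval s' f"
    if "D f V" "\<And>x. s x \<in> carrier R" "\<And>x. s' x \<in> carrier R" "\<And>x. x \<in> V \<Longrightarrow> s x = s' x" for f V s s'
    using that unfolding D_def by blast
  have "\<exists>V. finite V \<and> D f V"
  proof (induction f rule: free_tr_generate)
    case (scal c)
    show ?case by (rule exI[of _ "{}"]) (simp add: D_def free_eval_scal)
  next
    case (var x)
    show ?case by (rule exI[of _ "{x}"]) (simp add: D_def)
  next
    case (add p q)
    then obtain V W where VW: "finite V" "D p V" "finite W" "D q W" by blast
    have "D (p + q) (V \<union> W)"
      unfolding D_def
    proof (intro allI impI)
      fix s s' :: "'x \<Rightarrow> 'a"
      assume s: "\<forall>x. s x \<in> carrier R" and s': "\<forall>x. s' x \<in> carrier R" and e: "\<forall>x\<in>V \<union> W. s x = s' x"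
      have "free_eval s p = free_eval s' p" by (rule DD[OF VW(2)]) (use s s' e in auto)
      moreover have "free_eval s q = free_eval s' q" by (rule DD[OF VW(4)]) (use s s' e in auto)
      ultimately show "free_eval s (p + q) = free_eval s' (p + q)"
        using free_eval_add[of s p q] free_eval_add[of s' p q] s s' by simp
    qed
    with VW show ?case by blast
  next
    case (mult p q)
    then obtain V W where VW: "finite V" "D p V" "finite W" "D q W" by blast
    have "D (p * q) (V \<union> W)"
      unfolding D_def
    proof (intro allI impI)
      fix s s' :: "'x \<Rightarrow> 'a"
      assume s: "\<forall>x. s x \<in> carrier R" and s': "\<forall>x. s' x \<in> carrier R" and e: "\<forall>x\<in>V \<union> W. s x = s' x"
      have "free_eval s p = free_eval s' p" by (rule DD[OF VW(2)]) (use s s' e in auto)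
      moreover have "free_eval s q = free_eval s' q" by (rule DD[OF VW(4)]) (use s s' e in auto)
      ultimately show "free_eval s (p * q) = free_eval s' (p * q)"
        using free_eval_mult[of s p q] free_eval_mult[of s' p q] s s' by simp
    qed
    with VW show ?case by blast
  next
    case (trc p)
    then obtain V where V: "finite V" "D p V" by blast
    have "D (free_trc p) V"
      unfolding D_def
    proof (intro allI impI)
      fix s s' :: "'x \<Rightarrow> 'a"
      assume s: "\<forall>x. s x \<in> carrier R" and s': "\<forall>x. s' x \<in> carrier R" and e: "\<forall>x\<in>V. s x = s' x"
      have "free_eval s p = free_eval s' p" by (rule DD[OF V(2)]) (use s s' e in auto)
      then show "free_eval s (free_trc p) = free_eval s' (free_trc p)"
        using free_eval_trc[of s p] free_eval_trc[of s' p] s s' by simp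
    qed
    with V show ?case by blast
  qed
  then obtain V where V: "finite V" "D f V" by blast
  show ?thesis by (rule that[OF V(1)], rule DD[OF V(2)])
qed

lemma trace_identitiesD: "f \<in> trace_identities S A \<Longrightarrow> h \<in> trace_hom S A \<Longrightarrow> h f = \<zero>\<^bsub>A\<^esub>"
  unfolding trace_identities_def by blast

context
  fixes ms as :: "nat list" and B :: "('f::field_char_0, 'f mat list) trace_alg"
  assumes B: "B = block_algebra ms as"
    and ms_pos: "\<And>l. l < length ms \<Longrightarrow> 0 < ms ! l" and as_pos: "\<And>l. l < length ms \<Longrightarrow> 0 < as ! l"
begin

interpretation B: trace_algebra B
  unfolding B by (rule trace_algebra_block)

lemma mat_trace_zero: "mat_trace (0\<^sub>m m m :: 'f mat) = 0"
  by (simp add: mat_trace_def)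

lemma block_trace_nondegenerate:
  assumes rs: "rs \<in> carrier B" and nz: "rs \<noteq> \<zero>\<^bsub>B\<^esub>"
  obtains ys where "ys \<in> carrier B" "block_trace ms as (rs \<otimes>\<^bsub>B\<^esub> ys) \<noteq> 0"
proof -
  have len: "length rs = length ms" using rs by (simp add: B block_carrier)
  have "\<exists>l i j. l < length ms \<and> i < ms ! l \<and> j < ms ! l \<and> rs ! l $$ (i, j) \<noteq> 0"
  proof (rule ccontr)
    assume n: "\<not> ?thesis"
    have "rs = \<zero>\<^bsub>B\<^esub>"
      unfolding B
    proof (rule block_eqI)
      fix l assume l: "l < length ms"
      have "rs ! l \<in> carrier_mat (ms ! l) (ms ! l)" using rs l by (simp add: B block_carrier)
      then have "rs ! l = 0\<^sub>m (ms ! l) (ms ! l)" using n l by (intro eq_matI) auto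
      then show "rs ! l = \<zero>\<^bsub>block_algebra ms as\<^esub> ! l" using l by simp
    qed (simp_all add: len)
    with nz show False by simp
  qed
  then obtain l i j where l: "l < length ms" and ij: "i < ms ! l" "j < ms ! l" and e: "rs ! l $$ (i, j) \<noteq> 0"
    by blast
  \<comment> \<open>The matrix unit at (j, i): the trace of a product with it reads off the entry
    (i, j).\<close>
  define E where "E = mat (ms ! l) (ms ! l) (\<lambda>(a, b). if a = j \<and> b = i then 1 else 0 :: 'f)"
  define ys where "ys = (map (\<lambda>m. 0\<^sub>m m m) ms)[l := E]"
  have ysl: "ys ! k = (if k = l then E else 0\<^sub>m (ms ! k) (ms ! k))" if "k < length ms" for k
    using that by (simp add: ys_def)
  have ys: "ys \<in> carrier B"
    by (auto simp: B block_carrier ysl) (simp_all add: ys_def E_def)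
  have ly: "length ys = length ms" by (simp add: ys_def)
  have car: "rs ! k \<in> carrier_mat (ms ! k) (ms ! k)" if "k < length ms" for k
    using rs that by (simp add: B block_carrier)
  have "mat_trace (rs ! l * E) = (\<Sum>a<ms ! l. \<Sum>b<ms ! l. rs ! l $$ (a, b) * E $$ (b, a))"
    by (rule mat_trace_mult_alt[OF car[OF l]]) (simp add: E_def)
  also have "\<dots> = (\<Sum>a<ms ! l. \<Sum>b<ms ! l. if a = i then (if b = j then rs ! l $$ (a, b) else 0) else 0)"
    by (intro sum.cong refl) (auto simp: E_def)
  also have "\<dots> = (\<Sum>a<ms ! l. if a = i then (\<Sum>b<ms ! l. if b = j then rs ! l $$ (a, b) else 0) else 0)"
    by (intro sum.cong refl) auto
  also have "\<dots> = rs ! l $$ (i, j)" using ij by simp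
  finally have t: "mat_trace (rs ! l * E) = rs ! l $$ (i, j)" .
  have "block_trace ms as (rs \<otimes>\<^bsub>B\<^esub> ys) = (\<Sum>k<length ms. if k = l then of_nat (as ! l) * rs ! l $$ (i, j) else 0)"
    unfolding block_trace_def
  proof (rule sum.cong, rule refl)
    fix k assume k: "k \<in> {..<length ms}"
    have "rs ! k * 0\<^sub>m (ms ! k) (ms ! k) = 0\<^sub>m (ms ! k) (ms ! k)"
      using right_mult_zero_mat[OF car[of k]] k by simp
    then show "of_nat (as ! k) * mat_trace ((rs \<otimes>\<^bsub>B\<^esub> ys) ! k) = (if k = l then of_nat (as ! l) * rs ! l $$ (i, j) else 0)"
      using k len ly t by (auto simp: B ysl mat_trace_zero)
  qed
  also have "\<dots> = of_nat (as ! l) * rs ! l $$ (i, j)" using l by simp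
  also have "\<dots> \<noteq> 0" using e as_pos[OF l] by simp
  finally show ?thesis using that ys by blast
qed

text \<open>Values are polynomial in all matrix entries of the arguments. Restricting them to the
  line through two points leaves one variable, where a polynomial function that vanishes everywhere
  comes from the zero polynomial.\<close>

lemma block_path_polynomial:
  fixes s0 s1 :: "'x \<Rightarrow> 'f mat list"
  assumes s0: "\<And>x. s0 x \<in> carrier B" and s1: "\<And>x. s1 x \<in> carrier B"
    and l: "l < length ms" and ij: "i < ms ! l" "j < ms ! l"
  shows "\<exists>P. \<forall>t. B.free_eval (\<lambda>x. (1 - t) \<odot>\<^bsub>B\<^esub> s0 x \<oplus>\<^bsub>B\<^esub> t \<odot>\<^bsub>B\<^esub> s1 x) f ! l $$ (i, j) = poly P t"
proof -
  let ?s = "\<lambda>t x. (1 - t) \<odot>\<^bsub>B\<^esub> s0 x \<oplus>\<^bsub>B\<^esub> t \<odot>\<^bsub>B\<^esub> s1 x"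
  let ?e = "\<lambda>t. B.free_eval (?s t)"
  have s: "?s t x \<in> carrier B" for t x
    using s0[of x] s1[of x] by (auto simp: B block_carrier)
  have h: "?e t \<in> trace_hom free_trace_algebra (block_algebra ms as)" for t
    using B.free_eval_hom[of "?s t", OF s] unfolding B .
  note nth = hom_block_nth[OF h]
  have "\<forall>l i j. l < length ms \<longrightarrow> i < ms ! l \<longrightarrow> j < ms ! l \<longrightarrow> (\<exists>P. \<forall>t. ?e t f ! l $$ (i, j) = poly P t)"
  proof (induction f rule: free_tr_generate)
    case (scal c)
    show ?case
    proof (intro allI impI)
      fix l i j assume "l < length ms" "i < ms ! l" "j < ms ! l"
      then show "\<exists>P. \<forall>t. ?e t (scal c) ! l $$ (i, j) = poly P t"
        by (intro exI[of _ "[:if i = j then c else 0:]"]) (auto simp: nth)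
    qed
  next
    case (var x)
    show ?case
    proof (intro allI impI)
      fix l i j assume l: "l < length ms" "i < ms ! l" "j < ms ! l"
      have "?e t (Defs.var x) = ?s t x" for t by (rule B.free_eval_var) (rule s)
      moreover have "?s t x ! l $$ (i, j) = (1 - t) * s0 x ! l $$ (i, j) + t * s1 x ! l $$ (i, j)" for t
      proof -
        have c: "s0 x ! l \<in> carrier_mat (ms ! l) (ms ! l)" "s1 x ! l \<in> carrier_mat (ms ! l) (ms ! l)"
          "length (s0 x) = length ms" "length (s1 x) = length ms"
          using l s0[of x] s1[of x] by (auto simp: B block_carrier)
        then show ?thesis using l carrier_matD[OF c(1)] carrier_matD[OF c(2)] by (simp add: B)
      qed
      ultimately show "\<exists>P. \<forall>t. ?e t (Defs.var x) ! l $$ (i, j) = poly P t"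
        by (intro exI[of _ "[:s0 x ! l $$ (i, j), s1 x ! l $$ (i, j) - s0 x ! l $$ (i, j):]"])
          (simp add: algebra_simps)
    qed
  next
    case (add p q)
    show ?case
    proof (intro allI impI)
      fix l i j assume l: "l < length ms" "i < ms ! l" "j < ms ! l"
      obtain P Q where "\<forall>t. ?e t p ! l $$ (i, j) = poly P t" "\<forall>t. ?e t q ! l $$ (i, j) = poly Q t"
        using add l by blast
      then show "\<exists>P. \<forall>t. ?e t (p + q) ! l $$ (i, j) = poly P t"
        using l carrier_matD[OF nth(2)[OF l(1)]] by (intro exI[of _ "P + Q"]) (simp add: nth[OF l(1)])
    qed
  next
    case (mult p q)
    show ?case
    proof (intro allI impI)
      fix l i j assume l: "l < length ms" "i < ms ! l" "j < ms ! l"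
      have "\<forall>k\<in>{..<ms ! l}. \<exists>P. \<forall>t. ?e t p ! l $$ (i, k) = poly P t"
        "\<forall>k\<in>{..<ms ! l}. \<exists>P. \<forall>t. ?e t q ! l $$ (k, j) = poly P t"
        using mult l by auto
      then obtain P Q where PQ: "\<And>k t. k < ms ! l \<Longrightarrow> ?e t p ! l $$ (i, k) = poly (P k) t"
        "\<And>k t. k < ms ! l \<Longrightarrow> ?e t q ! l $$ (k, j) = poly (Q k) t"
        unfolding bchoice_iff by auto
      have "?e t (p * q) ! l $$ (i, j) = (\<Sum>k<ms ! l. ?e t p ! l $$ (i, k) * ?e t q ! l $$ (k, j))" for t
        using l carrier_matD[OF nth(2)[OF l(1)]] by (simp add: nth[OF l(1)] scalar_prod_def atLeast0LessThan)
      then show "\<exists>P. \<forall>t. ?e t (p * q) ! l $$ (i, j) = poly P t"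
        by (intro exI[of _ "\<Sum>k<ms ! l. P k * Q k"]) (simp add: PQ poly_sum)
    qed
  next
    case (trc p)
    show ?case
    proof (intro allI impI)
      fix l i j assume l: "l < length ms" "i < ms ! l" "j < ms ! l"
      have "\<forall>k\<in>{..<length ms}. \<forall>a\<in>{..<ms ! k}. \<exists>P. \<forall>t. ?e t p ! k $$ (a, a) = poly P t"
        using trc by auto
      then obtain P where P: "\<And>k a t. k < length ms \<Longrightarrow> a < ms ! k \<Longrightarrow> ?e t p ! k $$ (a, a) = poly (P k a) t"
        unfolding bchoice_iff by auto
      have "block_trace ms as (?e t p) = poly (\<Sum>k<length ms. Polynomial.smult (of_nat (as ! k)) (\<Sum>a<ms ! k. P k a)) t" for t
        unfolding block_trace_def poly_sum
      proof (rule sum.cong, rule refl)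
        fix k assume "k \<in> {..<length ms}"
        then have k: "k < length ms" by simp
        show "of_nat (as ! k) * mat_trace (?e t p ! k) = poly (Polynomial.smult (of_nat (as ! k)) (\<Sum>a<ms ! k. P k a)) t"
          using P k by (simp add: mat_trace_alt[OF nth(2)[OF k]] poly_sum)
      qed
      then show "\<exists>P. \<forall>t. ?e t (free_trc p) ! l $$ (i, j) = poly P t"
        using l by (intro exI[of _ "if i = j then (\<Sum>k<length ms. Polynomial.smult (of_nat (as ! k)) (\<Sum>a<ms ! k. P k a)) else 0"])
          (auto simp: nth[OF l(1)])
    qed
  qed
  then show ?thesis using l ij by blast
qed

text \<open>Evaluations $h_0, h_1$ at which the traces of $f y$ and $g z$ do not vanish, for fresh $y, z$, are joined by a line,
  on which both traces are nonzero polynomials.\<close>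

lemma free_prime_block_identities:
  assumes ne: "ms \<noteq> []"
  shows "free_prime (trace_identities (free_trace_algebra :: ('f, (nat, 'f) free_tr) trace_alg) B)"
proof -
  let ?F = "free_trace_algebra :: ('f, (nat, 'f) free_tr) trace_alg"
  let ?I = "trace_identities ?F B"
  have l0: "0 < length ms" using ne by simp
  have I: "trace_ideal ?I ?F"
    using T_ideal_identities[OF B.trace_algebra_axioms, where ?'x = nat] by (simp add: T_ideal_def)
  have zc: "\<zero>\<^bsub>B\<^esub> \<in> carrier B" by (auto simp: B block_carrier)
  have hB: "h \<in> trace_hom ?F (block_algebra ms as)" if "h \<in> trace_hom ?F B" for h using that by (simp add: B)
  have one: "1 \<notin> ?I"
  proof
    assume "1 \<in> ?I"
    let ?h = "B.free_eval (\<lambda>_::nat. \<zero>\<^bsub>B\<^esub>)"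
    have h: "?h \<in> trace_hom ?F B" by (rule B.free_eval_hom) (rule zc)
    with \<open>1 \<in> ?I\<close> have "?h 1 = \<zero>\<^bsub>B\<^esub>" by (rule trace_identitiesD)
    then have "1\<^sub>m (ms ! 0) = (0\<^sub>m (ms ! 0) (ms ! 0) :: 'f mat)"
      using hom_block_nth(5)[OF hB[OF h] l0] l0 by (simp add: B)
    then have "1\<^sub>m (ms ! 0) $$ (0, 0) = (0\<^sub>m (ms ! 0) (ms ! 0) $$ (0, 0) :: 'f)" by simp
    then show False using ms_pos[OF l0] by simp
  qed
  have key: "\<exists>v s. (\<forall>x. s x \<in> carrier B) \<and> block_trace ms as (B.free_eval s (f * Defs.var v)) \<noteq> 0"
    if f: "f \<notin> ?I" for f
  proof -
    obtain h where h: "h \<in> trace_hom ?F B" and hf: "h f \<noteq> \<zero>\<^bsub>B\<^esub>"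
      using f by (auto simp: trace_identities_def)
    let ?s = "\<lambda>x. h (Defs.var x)"
    have s: "?s x \<in> carrier B" for x using trace_homD(1)[OF h] by simp
    obtain V where V: "finite V" "\<And>s s'. (\<And>x. s x \<in> carrier B) \<Longrightarrow> (\<And>x. s' x \<in> carrier B) \<Longrightarrow>
      (\<And>x. x \<in> V \<Longrightarrow> s x = s' x) \<Longrightarrow> B.free_eval s f = B.free_eval s' f"
      using B.free_eval_finite_support[of f] by blast
    \<comment> \<open>The value of \<open>f\<close> does not depend on \<open>v\<close>, so the
      tuple \<open>ys\<close> that detects it can be assigned to this variable.\<close>
    obtain v where v: "v \<notin> V" using V(1) ex_new_if_finite[OF infinite_UNIV_nat] by blast
    have hc: "h f \<in> carrier B" using trace_homD(1)[OF h] by simp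
    obtain ys where ys: "ys \<in> carrier B" "block_trace ms as (h f \<otimes>\<^bsub>B\<^esub> ys) \<noteq> 0"
      using block_trace_nondegenerate[OF hc hf] .
    define s' where "s' = ?s(v := ys)"
    have s': "s' x \<in> carrier B" for x using s ys by (simp add: s'_def)
    have "B.free_eval s' f = B.free_eval ?s f"
      by (rule V(2)[OF s' s]) (use v in \<open>auto simp: s'_def\<close>)
    also have "\<dots> = h f" using B.free_eval_unique[OF h] by metis
    finally have "B.free_eval s' (f * Defs.var v) = h f \<otimes>\<^bsub>B\<^esub> ys"
      using B.free_eval_mult[of s', OF s'] B.free_eval_var[of s', OF s'] by (simp add: s'_def)
    with ys s' show ?thesis by metis
  qed
  show ?thesis
    unfolding free_prime_def
  proof (intro conjI allI impI I one, rule ccontr)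
    fix J K
    assume JK: "trace_ideal J ?F \<and> trace_ideal K ?F \<and> (\<forall>a\<in>J. \<forall>b\<in>K. a * b \<in> ?I)"
      and "\<not> (J \<subseteq> ?I \<or> K \<subseteq> ?I)"
    then obtain f g where f: "f \<in> J" "f \<notin> ?I" and g: "g \<in> K" "g \<notin> ?I" by blast
    obtain v s0 where s0: "\<And>x. s0 x \<in> carrier B" and v: "block_trace ms as (B.free_eval s0 (f * Defs.var v)) \<noteq> 0"
      using key[OF f(2)] by blast
    obtain w s1 where s1: "\<And>x. s1 x \<in> carrier B" and w: "block_trace ms as (B.free_eval s1 (g * Defs.var w)) \<noteq> 0"
      using key[OF g(2)] by blast
    define a where "a = free_trc (f * Defs.var v)"
    define b where "b = free_trc (g * Defs.var w)"
    have "a \<in> J" "b \<in> K" using JK f g by (auto simp: a_def b_def trace_ideal_free)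
    then have ab: "a * b \<in> ?I" using JK by blast
    let ?s = "\<lambda>t x. (1 - t) \<odot>\<^bsub>B\<^esub> s0 x \<oplus>\<^bsub>B\<^esub> t \<odot>\<^bsub>B\<^esub> s1 x"
    let ?e = "\<lambda>t. B.free_eval (?s t)"
    have s: "?s t x \<in> carrier B" for t x
      using s0[of x] s1[of x] by (auto simp: B block_carrier)
    have e: "?e t \<in> trace_hom ?F B" for t
      by (rule B.free_eval_hom) (rule s)
    note nth = hom_block_nth[OF hB[OF e] l0]
    have z0: "0 < ms ! 0" by (rule ms_pos[OF l0])
    \<comment> \<open>Traces are scalar multiples of the unit tuple, so this single entry carries
      the whole value.\<close>
    obtain P where P: "\<And>t. ?e t a ! 0 $$ (0, 0) = poly P t"
      using block_path_polynomial[where ?s0.0 = s0 and ?s1.0 = s1 and f = a, OF s0 s1 l0 z0 z0] by blast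
    obtain Q where Q: "\<And>t. ?e t b ! 0 $$ (0, 0) = poly Q t"
      using block_path_polynomial[where ?s0.0 = s0 and ?s1.0 = s1 and f = b, OF s0 s1 l0 z0 z0] by blast
    have Pa: "poly P t = block_trace ms as (?e t (f * Defs.var v))" for t
      using z0 by (simp add: P[symmetric] a_def nth)
    have Qb: "poly Q t = block_trace ms as (?e t (g * Defs.var w))" for t
      using z0 by (simp add: Q[symmetric] b_def nth)
    have m0: "0 \<cdot>\<^sub>m A + B' = B'" "B' + 0 \<cdot>\<^sub>m A = B'" if "A \<in> carrier_mat m m" "B' \<in> carrier_mat m m" for A B' :: "'f mat" and m
      using that by (auto intro!: eq_matI)
    have "?s 0 x = s0 x" for x
      using s0[of x] s1[of x] by (auto simp: B block_carrier mat_one_smult m0 intro!: nth_equalityI)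
    then have "?s 0 = s0" by (rule ext)
    then have P0: "poly P 0 \<noteq> 0" using v unfolding Pa by simp
    have "?s 1 x = s1 x" for x
      using s0[of x] s1[of x] by (auto simp: B block_carrier mat_one_smult m0 intro!: nth_equalityI)
    then have "?s 1 = s1" by (rule ext)
    then have Q1: "poly Q 1 \<noteq> 0" using w unfolding Qb by simp
    have "poly (P * Q) t = 0" for t
    proof -
      have "?e t (a * b) = \<zero>\<^bsub>B\<^esub>" using ab e by (rule trace_identitiesD)
      then have "(?e t a ! 0 * ?e t b ! 0) $$ (0, 0) = 0"
        unfolding nth(4)[symmetric] using l0 z0 by (simp add: B)
      moreover have "(?e t a ! 0 * ?e t b ! 0) $$ (0, 0) = poly P t * poly Q t"
      proof -
        have "?e t a ! 0 = poly P t \<cdot>\<^sub>m 1\<^sub>m (ms ! 0)" "?e t b ! 0 = poly Q t \<cdot>\<^sub>m 1\<^sub>m (ms ! 0)"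
          unfolding Pa Qb by (simp_all add: a_def b_def nth)
        then show ?thesis using z0 by (simp add: mult_smult_assoc_mat[OF one_carrier_mat smult_carrier_mat[OF one_carrier_mat]]
            left_mult_one_mat)
      qed
      ultimately show ?thesis by simp
    qed
    then have "P * Q = 0" using poly_all_0_iff_0 by blast
    then show False using P0 Q1 by auto
  qed
qed

end

section \<open>Cayley-Hamilton algebras with nondegenerate trace over an algebraically closed field\<close>

text \<open>Two fields are kept apart: \<open>con\<close> and \<open>tau\<close> describe an algebra
  over K with a K-valued trace, while \<open>R\<close> below is the same algebra as a trace algebra
  over F, because the free algebra and its homomorphisms have scalars in F.\<close>

locale nondegenerate_trace =
  fixes emb :: "'f::field_char_0 \<Rightarrow> 'k::alg_closed_field"
    and con :: "'k \<Rightarrow> 'b::ring_1" and tau :: "'b \<Rightarrow> 'k"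
  assumes emb_1: "emb 1 = 1" and emb_add: "emb (a + b) = emb a + emb b"
    and emb_mult: "emb (a * b) = emb a * emb b"
    and con_1: "con 1 = 1" and con_add: "con (x + y) = con x + con y"
    and con_mult: "con (x * y) = con x * con y" and con_central: "con x * u = u * con x"
    and tau_add: "tau (u + v) = tau u + tau v" and tau_con: "tau (con x * u) = x * tau u"
    and tau_commute: "tau (u * v) = tau (v * u)"
    and tau_nondegenerate: "(\<And>v. tau (u * v) = 0) \<Longrightarrow> u = 0"
begin

lemma emb_0: "emb 0 = 0"
  by (metis add.right_neutral add_left_cancel emb_add)

lemma emb_uminus: "emb (- a) = - emb a"
  by (metis emb_0 emb_add add.right_inverse eq_neg_iff_add_eq_0 add.commute)

lemma emb_eq_0: "emb a = 0 \<longleftrightarrow> a = 0"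
proof
  assume "emb a = 0"
  then have "emb (a * inverse a) = 0" by (simp add: emb_mult)
  then show "a = 0" using emb_1 by (metis right_inverse zero_neq_one)
qed (simp add: emb_0)

lemma inj_emb: "inj emb"
proof (rule injI)
  fix a b assume "emb a = emb b"
  then have "emb (a - b) = 0" using emb_add[of a "- b"] by (simp add: emb_uminus)
  then show "a = b" by (simp add: emb_eq_0)
qed

lemma emb_of_nat: "emb (of_nat m) = of_nat m"
  by (induction m) (simp_all add: emb_0 emb_1 emb_add)

text \<open>The class of K only says that it is algebraically closed; characteristic 0 is inherited
  from F through \<open>emb\<close>.\<close>

lemma of_nat_eq_0: "of_nat m = (0 :: 'k) \<longleftrightarrow> m = 0"
  unfolding emb_of_nat[symmetric] emb_eq_0 by simp

lemma of_nat_inject: "of_nat l = (of_nat m :: 'k) \<longleftrightarrow> l = m"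
  using inj_emb unfolding emb_of_nat[symmetric] inj_eq[OF inj_emb] by simp

lemma emb_sum: "emb (sum g A) = (\<Sum>a\<in>A. emb (g a))"
  by (induction A rule: infinite_finite_induct) (simp_all add: emb_0 emb_add)

lemma con_0: "con 0 = 0"
  by (metis add.right_neutral add_left_cancel con_add)

lemma con_uminus: "con (- a) = - con a"
  by (metis con_0 con_add add.right_inverse eq_neg_iff_add_eq_0 add.commute)

lemma con_eq_0: "con a = 0 \<longleftrightarrow> a = 0"
proof
  assume "con a = 0"
  then have "con (a * inverse a) = 0" by (simp add: con_mult)
  then show "a = 0" using con_1 by (metis right_inverse zero_neq_one)
qed (simp add: con_0)

lemma con_diff: "con (a - b) = con a - con b"
  using con_add[of a "- b"] by (simp add: con_uminus)

lemma con_inject: "con a = con b \<longleftrightarrow> a = b"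
  using con_eq_0[of "a - b"] by (simp add: con_diff)

lemma con_sum: "con (sum g A) = (\<Sum>a\<in>A. con (g a))"
  by (induction A rule: infinite_finite_induct) (simp_all add: con_0 con_add)

lemma con_of_nat: "con (of_nat m) = of_nat m"
  by (induction m) (simp_all add: con_0 con_1 con_add)

lemma con_left: "u * (con x * v) = con x * (u * v)"
  by (simp only: mult.assoc[symmetric] con_central[of x u])

lemma tau_0: "tau 0 = 0"
  using tau_con[of 0 0] by simp

lemma tau_sum: "tau (sum g A) = (\<Sum>a\<in>A. tau (g a))"
  by (induction A rule: infinite_finite_induct) (simp_all add: tau_0 tau_add)

definition R :: "('f, 'b) trace_alg" where
  "R = \<lparr>carrier = UNIV, mult = (*), one = 1, zero = 0, add = (+),
     module.smult = (\<lambda>a u. con (emb a) * u), trc = (\<lambda>u. con (tau u))\<rparr>"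

lemma R_simps [simp]:
  "carrier R = UNIV" "mult R = (*)" "one R = 1" "zero R = 0" "add R = (+)"
  "module.smult R = (\<lambda>a u. con (emb a) * u)" "trc R = (\<lambda>u. con (tau u))"
  by (simp_all add: R_def)

lemma trace_algebra_R: "trace_algebra R"
proof -
  have r: "ring R"
    by unfold_locales (auto simp: algebra_simps Units_def intro: exI[of _ "- _"])
  interpret r: ring R by fact
  have m: "module class_ring R"
    by (rule moduleI, rule class_cring.cring_axioms, rule r.is_abelian_group)
      (simp_all add: emb_add emb_mult emb_1 con_add con_mult con_1 algebra_simps)
  interpret m: module class_ring R by fact
  show ?thesis
  proof unfold_locales
    fix a b
    show "trc R a \<otimes>\<^bsub>R\<^esub> b = b \<otimes>\<^bsub>R\<^esub> trc R a" by simp (rule con_central)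
    show "trc R (a \<otimes>\<^bsub>R\<^esub> b) = trc R (b \<otimes>\<^bsub>R\<^esub> a)" using tau_commute[of a b] by simp
  next
    fix x :: 'f and a b
    show "a \<otimes>\<^bsub>R\<^esub> (x \<odot>\<^bsub>R\<^esub> b) = x \<odot>\<^bsub>R\<^esub> (a \<otimes>\<^bsub>R\<^esub> b)" using con_left[of a "emb x" b] by simp
  qed (simp_all add: mult.assoc tau_add tau_con con_add con_mult)
qed

sublocale R: trace_algebra R
  by (rule trace_algebra_R)

abbreviation ev :: "(nat \<Rightarrow> 'b) \<Rightarrow> (nat, 'f) free_tr \<Rightarrow> 'b" where
  "ev s \<equiv> R.free_eval s"

lemma ev_simps:
  "ev s (p + q) = ev s p + ev s q" "ev s (p * q) = ev s p * ev s q"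
  "ev s (free_trc p) = con (tau (ev s p))" "ev s (scal a) = con (emb a)"
  "ev s (Defs.var v) = s v"
  using R.free_eval_add[of s p q] R.free_eval_mult[of s p q] R.free_eval_trc[of s p]
    R.free_eval_scal[of s a] R.free_eval_var[of s v] by simp_all

lemma ev_hom: "ev s \<in> trace_hom free_trace_algebra R"
  by (rule R.free_eval_hom) simp

lemma hom_ev: "h \<in> trace_hom free_trace_algebra R \<Longrightarrow> h = ev (\<lambda>v. h (Defs.var v))"
  by (rule R.free_eval_unique)

lemma ev_0: "ev s 0 = 0"
  using ev_simps(4)[of s 0] by (simp add: emb_0 con_0)

lemma ev_sum: "ev s (sum g A) = (\<Sum>a\<in>A. ev s (g a))"
  by (induction A rule: infinite_finite_induct) (simp_all add: ev_0 ev_simps)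

lemma ev_1: "ev s 1 = 1"
  using ev_simps(4)[of s 1] by (simp add: emb_1 con_1)

lemma ev_power: "ev s (p ^ k) = ev s p ^ k"
  by (induction k) (simp_all add: ev_1 ev_simps)

subsection \<open>Density\<close>

text \<open>Polynomial functions of a scalar with values in the algebra, in Horner form, so that
  closure under sums, products and traces goes by induction on the number of coefficients.\<close>

inductive polyfun :: "('k \<Rightarrow> 'b) \<Rightarrow> bool" where
  zero: "polyfun (\<lambda>k. 0)"
| step: "polyfun g \<Longrightarrow> polyfun (\<lambda>k. u + con k * g k)"

lemma polyfun_const: "polyfun (\<lambda>k. u)"
  using polyfun.step[OF polyfun.zero, of u] by simp

lemma polyfun_add: "polyfun g \<Longrightarrow> polyfun h \<Longrightarrow> polyfun (\<lambda>k. g k + h k)"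
proof (induction g arbitrary: h rule: polyfun.induct)
  case (step g u)
  from step.prems show ?case
  proof (cases rule: polyfun.cases)
    case zero
    then show ?thesis using polyfun.step[OF step.hyps] by simp
  next
    case (step g' u')
    have "polyfun (\<lambda>k. (u + u') + con k * (g k + g' k))"
      by (rule polyfun.step) (rule \<open>\<And>h. polyfun h \<Longrightarrow> polyfun (\<lambda>k. g k + h k)\<close>, fact)
    then show ?thesis unfolding step(1) by (simp add: algebra_simps)
  qed
qed simp

lemma polyfun_mult_left: "polyfun g \<Longrightarrow> polyfun (\<lambda>k. v * g k)"
proof (induction g rule: polyfun.induct)
  case (step g u)
  have "polyfun (\<lambda>k. v * u + con k * (v * g k))" by (rule polyfun.step) fact
  then show ?case by (simp add: distrib_left con_left)
qed (simp add: polyfun.zero)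

lemma polyfun_mult: "polyfun g \<Longrightarrow> polyfun h \<Longrightarrow> polyfun (\<lambda>k. g k * h k)"
proof (induction g rule: polyfun.induct)
  case (step g u)
  have "polyfun (\<lambda>k. u * h k + (0 + con k * (g k * h k)))"
    by (rule polyfun_add[OF polyfun_mult_left polyfun.step]) (use step in auto)
  then show ?case by (simp add: distrib_right mult.assoc)
qed (simp add: polyfun.zero)

lemma polyfun_trc: "polyfun g \<Longrightarrow> polyfun (\<lambda>k. con (tau (g k)))"
proof (induction g rule: polyfun.induct)
  case (step g u)
  have "polyfun (\<lambda>k. con (tau u) + con k * con (tau (g k)))" by (rule polyfun.step) fact
  then show ?case by (simp add: tau_add tau_con con_add con_mult)
qed (simp add: tau_0 con_0 polyfun.zero)

lemma polyfun_ev: "(\<And>v. polyfun (\<lambda>k. S k v)) \<Longrightarrow> polyfun (\<lambda>k. ev (S k) f)"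
  by (induction f rule: free_tr_generate)
    (simp_all add: ev_simps polyfun_const polyfun_add polyfun_mult polyfun_trc)

lemma polyfun_tau: "polyfun g \<Longrightarrow> \<exists>P. \<forall>k. tau (g k * v) = poly P k"
proof (induction g rule: polyfun.induct)
  case zero
  show ?case by (rule exI[of _ 0]) (simp add: tau_0)
next
  case (step g u)
  then obtain P where "\<forall>k. tau (g k * v) = poly P k" by blast
  then show ?case
    by (intro exI[of _ "pCons (tau (u * v)) P"]) (simp add: distrib_right tau_add mult.assoc tau_con)
qed

text \<open>The functions tau(g k * v) are ordinary polynomials with the infinitely many roots
  \<open>emb a\<close>, hence 0, and nondegeneracy passes from them to \<open>g\<close>.\<close>

lemma polyfun_eq_0:
  assumes g: "polyfun g" and z: "\<And>a. g (emb a) = 0"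
  shows "g k = 0"
proof (rule tau_nondegenerate)
  fix v
  obtain P where P: "\<And>k. tau (g k * v) = poly P k" using polyfun_tau[OF g] by blast
  have "infinite (range emb)"
    using inj_emb infinite_UNIV_char_0 by (simp add: finite_image_iff)
  moreover have "range emb \<subseteq> {k. poly P k = 0}"
    using z by (auto simp: P[symmetric] tau_0)
  ultimately have "infinite {k. poly P k = 0}" using infinite_super by blast
  then have "P = 0" using poly_roots_finite by blast
  then show "tau (g k * v) = 0" by (simp add: P)
qed

inductive_set kspan :: "'b set \<Rightarrow> 'b set" for V where
  zero: "0 \<in> kspan V"
| step: "u \<in> kspan V \<Longrightarrow> w \<in> V \<Longrightarrow> u + con k * w \<in> kspan V"

lemma kspan_add: "u \<in> kspan V \<Longrightarrow> v \<in> kspan V \<Longrightarrow> v + u \<in> kspan V"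
  by (induction u rule: kspan.induct) (auto simp: add.assoc[symmetric] intro: kspan.step)

lemma kspan_scale: "u \<in> kspan V \<Longrightarrow> con k * u \<in> kspan V"
proof (induction u rule: kspan.induct)
  case (step u w k')
  have "con k * u + con (k * k') * w \<in> kspan V" using step by (intro kspan.step)
  then show ?case by (simp add: distrib_left con_mult mult.assoc)
qed (simp add: kspan.zero)

lemma kspan_base: "w \<in> V \<Longrightarrow> w \<in> kspan V"
  using kspan.step[OF kspan.zero, of w V 1] by (simp add: con_1)

lemma kspan_sum: "(\<And>a. a \<in> A \<Longrightarrow> g a \<in> kspan V) \<Longrightarrow> sum g A \<in> kspan V"
  by (induction A rule: infinite_finite_induct) (auto intro: kspan.zero kspan_add)

text \<open>As a function of one scalar coefficient the value is a \<open>polyfun\<close>, and at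
  scalars from F the term with this coefficient belongs to \<open>V\<close>, where the earlier case
  applies. Variables are released from \<open>V\<close> to its span one at a time, and within one
  variable one generator at a time.\<close>

lemma density:
  assumes V0: "0 \<in> V" and Vadd: "\<And>u a w. u \<in> V \<Longrightarrow> w \<in> V \<Longrightarrow> u + con (emb a) * w \<in> V"
    and van: "\<And>s. (\<And>v. s v \<in> V) \<Longrightarrow> ev s f = 0"
    and s: "\<And>v. s v \<in> kspan V"
  shows "ev s f = 0"
proof -
  obtain X' where X': "finite X'" "\<And>s s'. (\<And>x. s x \<in> carrier R) \<Longrightarrow> (\<And>x. s' x \<in> carrier R) \<Longrightarrow>
    (\<And>x. x \<in> X' \<Longrightarrow> s x = s' x) \<Longrightarrow> ev s f = ev s' f"
    using R.free_eval_finite_support[of f] by blast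
  have "\<forall>s. (\<forall>v\<in>Y. s v \<in> kspan V) \<longrightarrow> (\<forall>v. v \<notin> Y \<longrightarrow> s v \<in> V) \<longrightarrow> ev s f = 0" if "finite Y" for Y
    using that
  proof (induction Y rule: finite_induct)
    case empty
    show ?case using van by blast
  next
    case (insert v0 Y)
    show ?case
    proof (intro allI impI)
      fix s :: "nat \<Rightarrow> 'b"
      assume sY: "\<forall>v\<in>insert v0 Y. s v \<in> kspan V" and sV: "\<forall>v. v \<notin> insert v0 Y \<longrightarrow> s v \<in> V"
      \<comment> \<open>The summand \<open>u\<close> from \<open>V\<close> is kept general: it
        absorbs the multiple of \<open>w\<close> when the new coefficient comes from F.\<close>
      have "\<forall>u\<in>V. ev (s(v0 := u + x)) f = 0" if "x \<in> kspan V" for x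
        using that
      proof (induction x rule: kspan.induct)
        case zero
        show ?case
        proof
          fix u assume "u \<in> V"
          then have "\<forall>v\<in>Y. (s(v0 := u + 0)) v \<in> kspan V" "\<forall>v. v \<notin> Y \<longrightarrow> (s(v0 := u + 0)) v \<in> V"
            using sY sV by (auto intro: kspan_base)
          then show "ev (s(v0 := u + 0)) f = 0" using insert.IH by blast
        qed
      next
        case (step x w k)
        show ?case
        proof
          fix u assume u: "u \<in> V"
          have "polyfun (\<lambda>k. (s(v0 := u + (x + con k * w))) v)" for v
            using polyfun.step[OF polyfun_const, of "u + x" w]
            by (cases "v = v0") (simp_all add: polyfun_const add.assoc)
          then have "polyfun (\<lambda>k. ev (s(v0 := u + (x + con k * w))) f)" by (rule polyfun_ev)
          then show "ev (s(v0 := u + (x + con k * w))) f = 0"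
          proof (rule polyfun_eq_0)
            fix a
            have "u + (x + con (emb a) * w) = (u + con (emb a) * w) + x" by (simp add: algebra_simps)
            moreover have "ev (s(v0 := (u + con (emb a) * w) + x)) f = 0"
              using step.IH Vadd[OF u step.hyps(2)] by blast
            ultimately show "ev (s(v0 := u + (x + con (emb a) * w))) f = 0"
              by (simp only:)
          qed
        qed
      qed
      from this[of "s v0"] V0 sY show "ev s f = 0" by (metis add_0 fun_upd_triv insertI1)
    qed
  qed
  \<comment> \<open>Outside \<open>X'\<close>, where the value of \<open>f\<close> does not depend
    on the point, the variables are sent to 0, an element of \<open>V\<close>; so only finitely many
    leave \<open>V\<close>.\<close>
  from this[OF X'(1)] have "ev (\<lambda>v. if v \<in> X' then s v else 0) f = 0"
    using s V0 by simp
  moreover have "ev s f = ev (\<lambda>v. if v \<in> X' then s v else 0) f"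
    by (rule X'(2)) simp_all
  ultimately show ?thesis by simp
qed

end

subsection \<open>Nilpotent and idempotent elements\<close>

locale cayley_hamilton_trace = nondegenerate_trace emb con tau
  for emb :: "'f::field_char_0 \<Rightarrow> 'k::alg_closed_field" and con :: "'k \<Rightarrow> 'b::ring_1" and tau +
  fixes n :: nat
  assumes n_pos: "n \<ge> 1" and CH_vanishes: "ev s (CH n (Defs.var 0)) = 0"
begin

text \<open>The coefficients of the Cayley-Hamilton polynomial of \<open>x\<close>, brought from the
  algebra into K. The last equation comes from the trace of that polynomial times \<open>x\<close>:
  it is the right-hand side of Newton's identity for index n + 1, so this coefficient vanishes. The
  computations of traces below rest on it.\<close>

lemma newton_coefficients:
  obtains \<kappa> :: "nat \<Rightarrow> 'k" where "\<kappa> 0 = 1"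
    "\<And>k. of_nat (Suc k) * \<kappa> (Suc k) = - (\<Sum>j\<le>k. tau (x ^ Suc j) * \<kappa> (k - j))"
    "(\<Sum>i\<le>n. con (\<kappa> i) * x ^ (n - i)) = 0" "\<kappa> (Suc n) = 0"
proof -
  define s :: "nat \<Rightarrow> 'b" where "s = (\<lambda>_. x)"
  let ?c = "\<lambda>k. ev s (csig k (Defs.var 0))"
  have sx: "s 0 = x" by (simp add: s_def)
  have N: "of_nat (Suc k) * ?c (Suc k) = - (\<Sum>j\<le>k. con (tau (x ^ Suc j)) * ?c (k - j))" for k
  proof -
    have "con (emb (of_nat (Suc k))) * ?c (Suc k) = ev s (of_nat (Suc k) * csig (Suc k) (Defs.var 0))"
      by (simp only: ev_simps scal_of_nat[symmetric])
    also have "\<dots> = ev s (scal (- 1) * (\<Sum>j\<le>k. free_trc (Defs.var 0 ^ Suc j) * csig (k - j) (Defs.var 0)))"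
      unfolding csig_newton by (simp add: scal_uminus)
    also have "\<dots> = - (\<Sum>j\<le>k. con (tau (x ^ Suc j)) * ?c (k - j))"
      by (simp add: ev_simps ev_sum ev_power sx emb_uminus emb_1 con_uminus con_1 del: power_Suc)
    finally show ?thesis by (simp only: emb_of_nat con_of_nat)
  qed
  have "\<exists>a. ?c k = con a" for k
  proof (induction k rule: less_induct)
    case (less k)
    show ?case
    proof (cases k)
      case 0
      then show ?thesis by (intro exI[of _ 1]) (simp add: ev_1 con_1)
    next
      case (Suc k')
      have "\<forall>j\<in>{..k'}. \<exists>a. ?c (k' - j) = con a" using less Suc by auto
      then obtain a where a: "\<And>j. j \<le> k' \<Longrightarrow> ?c (k' - j) = con (a j)"
        unfolding bchoice_iff by auto
      have "con (of_nat (Suc k')) * ?c (Suc k') = con (- (\<Sum>j\<le>k'. tau (x ^ Suc j) * a j))"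
        unfolding con_of_nat N by (simp add: con_uminus con_sum con_mult a del: power_Suc)
      then have "con (inverse (of_nat (Suc k'))) * (con (of_nat (Suc k')) * ?c (Suc k'))
         = con (inverse (of_nat (Suc k')) * - (\<Sum>j\<le>k'. tau (x ^ Suc j) * a j))"
        by (simp only: con_mult)
      moreover have "inverse (of_nat (Suc k')) * of_nat (Suc k') = (1::'k)"
        using of_nat_eq_0[of "Suc k'"] by (simp del: of_nat_Suc)
      ultimately have "?c (Suc k') = con (inverse (of_nat (Suc k')) * - (\<Sum>j\<le>k'. tau (x ^ Suc j) * a j))"
        by (simp only: mult.assoc[symmetric] con_mult[symmetric]) (simp add: con_1)
      then show ?thesis using Suc by blast
    qed
  qed
  then obtain \<kappa> where \<kappa>: "\<And>k. ?c k = con (\<kappa> k)" by metis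
  have 0: "\<kappa> 0 = 1" using \<kappa>[of 0] by (simp add: ev_1 con_1[symmetric] con_inject)
  have 1: "of_nat (Suc k) * \<kappa> (Suc k) = - (\<Sum>j\<le>k. tau (x ^ Suc j) * \<kappa> (k - j))" for k
  proof -
    have "con (of_nat (Suc k) * \<kappa> (Suc k)) = con (- (\<Sum>j\<le>k. tau (x ^ Suc j) * \<kappa> (k - j)))"
      using N[of k] by (simp only: \<kappa> con_mult con_of_nat con_uminus con_sum)
    then show ?thesis by (simp only: con_inject)
  qed
  have 2: "(\<Sum>i\<le>n. con (\<kappa> i) * x ^ (n - i)) = 0"
    using CH_vanishes[of s] unfolding CH_alt by (simp add: ev_sum ev_simps ev_power \<kappa> sx)
  have "0 = tau ((\<Sum>i\<le>n. con (\<kappa> i) * x ^ (n - i)) * x)" by (simp add: 2 tau_0)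
  also have "\<dots> = (\<Sum>i\<le>n. \<kappa> i * tau (x ^ Suc (n - i)))"
    by (simp only: sum_distrib_right tau_sum mult.assoc tau_con power_Suc2)
  also have "\<dots> = (\<Sum>j\<le>n. tau (x ^ Suc j) * \<kappa> (n - j))"
    by (rule sum.reindex_bij_witness[of _ "\<lambda>i. n - i" "\<lambda>i. n - i"]) auto
  finally have "of_nat (Suc n) * \<kappa> (Suc n) = 0" using 1[of n] by simp
  then have "\<kappa> (Suc n) = 0" using of_nat_eq_0[of "Suc n"] by simp
  from that[OF 0 1 2 this] show ?thesis .
qed

text \<open>Induction on the exponent: the higher powers of \<open>x\<close> have trace 0 already,
  so Newton's identities shrink to a recursion with factor - tau x. It leads from 1 at index 0 to 0
  at index n + 1 only if this factor is 0.\<close>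

lemma tau_nilpotent: "x ^ N = 0 \<Longrightarrow> tau x = 0"
proof (induction N arbitrary: x rule: less_induct)
  case (less N)
  show ?case
  proof (cases "N < 2")
    case True
    then have "N = 0 \<or> N = 1" by auto
    then show ?thesis using less.prems by (auto simp: tau_0)
  next
    case False
    have T: "tau (x ^ Suc j) = 0" if "j > 0" for j
    proof (rule less.IH[of "N - 1"])
      show "N - 1 < N" using False by simp
      \<comment> \<open>Proper powers of \<open>x\<close> die at least one exponent earlier, since
        2(N - 1) >= N for N >= 2.\<close>
      have "Suc j * (N - 1) \<ge> 2 * (N - 1)" using that by (intro mult_right_mono) auto
      then have "N \<le> Suc j * (N - 1)" using False by linarith
      then obtain d where d: "Suc j * (N - 1) = N + d" by (auto simp only: le_iff_add)
      show "(x ^ Suc j) ^ (N - 1) = 0"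
        unfolding power_mult[symmetric] d power_add less.prems by simp
    qed
    obtain \<kappa> :: "nat \<Rightarrow> 'k" where \<kappa>: "\<kappa> 0 = 1"
      "\<And>k. of_nat (Suc k) * \<kappa> (Suc k) = - (\<Sum>j\<le>k. tau (x ^ Suc j) * \<kappa> (k - j))"
      "(\<Sum>i\<le>n. con (\<kappa> i) * x ^ (n - i)) = 0" "\<kappa> (Suc n) = 0"
      by (rule newton_coefficients[of x]) (rule that, assumption+)
    have s: "of_nat (Suc k) * \<kappa> (Suc k) = - tau x * \<kappa> k" for k
    proof -
      have "(\<Sum>j\<le>k. tau (x ^ Suc j) * \<kappa> (k - j)) = (\<Sum>j\<in>{0}. tau (x ^ Suc j) * \<kappa> (k - j))"
        by (rule sum.mono_neutral_right) (auto simp: T[unfolded power_Suc2] power_Suc2 simp del: power_Suc)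
      then show ?thesis unfolding \<kappa>(2) by simp
    qed
    have "\<kappa> k = 0 \<Longrightarrow> tau x = 0" for k
    proof (induction k)
      case (Suc k)
      then show ?case using s[of k] by auto
    qed (use \<kappa>(1) in simp)
    then show ?thesis using \<kappa>(4) by blast
  qed
qed

lemma idempotent_power: "e * e = e \<Longrightarrow> e ^ Suc j = (e :: 'b)"
  by (induction j) simp_all

text \<open>All positive powers of \<open>e\<close> have the same trace, so differences of
  successive Newton identities give a two-term recursion with factors k - tau e. It leads from 1 to
  0, so some factor vanishes. If the trace is 0, all coefficients after the first vanish, and the
  Cayley-Hamilton identity says e^n = 0.\<close>

lemma tau_idempotent:
  assumes e: "e * e = e"
  obtains m where "tau e = of_nat m" "e \<noteq> 0 \<Longrightarrow> m > 0"
proof -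
  note pw = idempotent_power[OF e]
  obtain \<kappa> :: "nat \<Rightarrow> 'k" where \<kappa>: "\<kappa> 0 = 1"
    "\<And>k. of_nat (Suc k) * \<kappa> (Suc k) = - (\<Sum>j\<le>k. tau (e ^ Suc j) * \<kappa> (k - j))"
    "(\<Sum>i\<le>n. con (\<kappa> i) * e ^ (n - i)) = 0" "\<kappa> (Suc n) = 0"
    by (rule newton_coefficients[of e]) (rule that, assumption+)
  have s1: "of_nat (Suc k) * \<kappa> (Suc k) = - tau e * (\<Sum>j\<le>k. \<kappa> j)" for k
  proof -
    have "(\<Sum>j\<le>k. \<kappa> (k - j)) = (\<Sum>j\<le>k. \<kappa> j)"
      by (rule sum.reindex_bij_witness[of _ "\<lambda>i. k - i" "\<lambda>i. k - i"]) auto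
    then show ?thesis unfolding \<kappa>(2) pw by (simp add: sum_distrib_left[symmetric])
  qed
  have s: "of_nat (Suc k) * \<kappa> (Suc k) = (of_nat k - tau e) * \<kappa> k" for k
  proof (cases k)
    case 0
    then show ?thesis using s1[of 0] by simp
  next
    case (Suc k')
    have "of_nat (Suc k) * \<kappa> (Suc k) = - tau e * (\<Sum>j\<le>k'. \<kappa> j) - tau e * \<kappa> k"
    proof -
      have "(\<Sum>j\<le>k. \<kappa> j) = (\<Sum>j\<le>k'. \<kappa> j) + \<kappa> k" by (simp add: Suc)
      then show ?thesis unfolding s1[of k] by (simp only: distrib_left) simp
    qed
    also have "- tau e * (\<Sum>j\<le>k'. \<kappa> j) = of_nat k * \<kappa> k" unfolding Suc s1[of k'] ..
    finally show ?thesis by (simp add: left_diff_distrib)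
  qed
  have "\<kappa> k = 0 \<Longrightarrow> \<exists>m. tau e = of_nat m" for k
  proof (induction k)
    case (Suc k)
    then have "(of_nat k - tau e) * \<kappa> k = 0" using s[of k] by simp
    then have "\<kappa> k = 0 \<or> tau e = of_nat k" by auto
    then show ?case using Suc.IH by blast
  qed (use \<kappa>(1) in simp)
  then obtain m where m: "tau e = of_nat m" using \<kappa>(4) by blast
  have "e = 0" if "m = 0"
  proof -
    have "tau e = 0" using m that by simp
    then have "of_nat (Suc k) * \<kappa> (Suc k) = 0" for k unfolding s1 by simp
    then have z: "\<kappa> (Suc k) = 0" for k
      using of_nat_eq_0[of "Suc k"] by (metis mult_eq_0_iff nat.distinct(1))
    have "(\<Sum>i\<le>n. con (\<kappa> i) * e ^ (n - i)) = (\<Sum>i\<in>{0}. con (\<kappa> i) * e ^ (n - i))"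
    proof (rule sum.mono_neutral_right)
      show "\<forall>i\<in>{..n} - {0}. con (\<kappa> i) * e ^ (n - i) = 0"
      proof
        fix i assume "i \<in> {..n} - {0}"
        then obtain i' where "i = Suc i'" by (cases i) auto
        then show "con (\<kappa> i) * e ^ (n - i) = 0" by (simp add: z con_0)
      qed
    qed auto
    then have "e ^ n = 0" using \<kappa>(1,3) by (simp add: con_1)
    then show "e = 0" using n_pos pw[of "n - 1"] by simp
  qed
  with m that show ?thesis by blast
qed

end

context cayley_hamilton_trace
begin

subsection \<open>Indecomposable idempotents\<close>

text \<open>Evaluation of K[X] at an element of the noncommutative algebra. Since only powers of a
  single element and central scalars occur, it is multiplicative.\<close>

definition pval :: "'b \<Rightarrow> 'k poly \<Rightarrow> 'b" where
  "pval x p = fold_coeffs (\<lambda>a y. con a + x * y) p 0"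

lemma pval_0: "pval x 0 = 0"
  by (simp add: pval_def)

lemma pval_pCons: "pval x (pCons a p) = con a + x * pval x p"
proof (cases "p = 0")
  case True
  then show ?thesis by (cases "a = 0") (simp_all add: pval_def con_0)
qed (simp add: pval_def)

lemma pval_add: "pval x (p + q) = pval x p + pval x q"
  by (induction p q rule: poly_induct2) (simp_all add: pval_0 pval_pCons con_add algebra_simps)

lemma pval_smult: "pval x (Polynomial.smult a p) = con a * pval x p"
  by (induction p) (simp_all add: pval_0 pval_pCons con_mult distrib_left con_left)

lemma pval_mult: "pval x (p * q) = pval x p * pval x q"
  by (induction p) (simp_all add: pval_0 pval_pCons pval_add pval_smult con_0 distrib_right mult.assoc)

lemma pval_1: "pval x 1 = 1"
  by (simp add: one_pCons pval_pCons pval_0 con_1)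

lemma pval_power: "pval x (p ^ k) = pval x p ^ k"
  by (induction k) (simp_all add: pval_1 pval_mult)

lemma pval_sum: "pval x (sum g A) = (\<Sum>a\<in>A. pval x (g a))"
  by (induction A rule: infinite_finite_induct) (simp_all add: pval_0 pval_add)

lemma pval_monom: "pval x (Polynomial.monom a k) = con a * x ^ k"
  by (induction k) (simp_all add: monom_0 monom_Suc pval_pCons pval_0 con_0 con_left)

lemma pval_linear: "pval x [:- l, 1:] = x - con l"
  by (simp add: pval_pCons pval_0 con_1 con_uminus)

lemma pval_idempotent_commute:
  assumes "e * x = x * e"
  shows "e * pval x p = pval x p * e"
proof (induction p)
  case (pCons a p)
  have "e * (x * pval x p) = x * (e * pval x p)"
    by (simp only: mult.assoc[symmetric] assms)
  then show ?case using pCons con_central[of a e] by (simp add: pval_pCons algebra_simps)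
qed (simp add: pval_0)

text \<open>X - l divides q - q(l), and q(l) is a nonzero scalar, so X - l is invertible modulo
  \<open>q\<close>, hence so are its powers.\<close>

lemma bezout_linear_power:
  fixes q :: "'k poly"
  assumes "poly q l \<noteq> 0"
  shows "\<exists>u v. u * [:- l, 1:] ^ a + v * q = 1"
proof (induction a)
  case 0
  show ?case by (rule exI[of _ 1], rule exI[of _ 0]) simp
next
  case (Suc a)
  then obtain u v where uv: "u * [:- l, 1:] ^ a = 1 - v * q" by (metis add_diff_cancel_right')
  have "[:- l, 1:] dvd q - [:poly q l:]" by (simp add: poly_eq_0_iff_dvd[symmetric])
  then obtain r where "q - [:poly q l:] = [:- l, 1:] * r" by (rule dvdE)
  then have r: "[:- l, 1:] * r = q - [:poly q l:]" by simp
  define i where "i = [:inverse (poly q l):]"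
  have "i * [:poly q l:] = 1" using assms by (simp add: i_def one_pCons)
  then have w: "(- i * r) * [:- l, 1:] = 1 - i * q"
    using arg_cong[OF r, of "\<lambda>z. - i * z"] by (simp add: algebra_simps)
  have "(u * (- i * r)) * [:- l, 1:] ^ Suc a = (u * [:- l, 1:] ^ a) * ((- i * r) * [:- l, 1:])"
    by (simp add: algebra_simps del: mult_pCons_left mult_pCons_right)
  also have "\<dots> = 1 - (v + i - v * q * i) * q"
    unfolding uv w by (simp add: algebra_simps)
  finally have "(u * (- i * r)) * [:- l, 1:] ^ Suc a + (v + i - v * q * i) * q = 1"
    by simp
  then show ?case by blast
qed

text \<open>Usually called a primitive idempotent.\<close>

definition indecomposable :: "'b \<Rightarrow> bool" where
  "indecomposable e \<longleftrightarrow> e * e = e \<and> e \<noteq> 0 \<and>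
    (\<forall>f g. f * f = f \<and> g * g = g \<and> f * g = 0 \<and> g * f = 0 \<and> f + g = e \<longrightarrow> f = 0 \<or> g = 0)"

text \<open>A coprime factorization of a polynomial annihilating $x$ would split $e$ by Bezout's identity.\<close>

lemma indecomposable_nilpotent:
  assumes e: "indecomposable e" and ex: "e * x = x" "x * e = x"
  obtains l N where "(x - con l * e) ^ N = 0"
proof -
  have ee: "e * e = e" and e0: "e \<noteq> 0" using e by (auto simp: indecomposable_def)
  have comm: "e * pval x p = pval x p * e" for p
    by (rule pval_idempotent_commute) (simp add: ex)
  \<comment> \<open>The factors equal to X - l are separated from the rest \<open>q\<close>.
    Bezout's identity splits \<open>e\<close>, and indecomposability leaves one side: either a power
    of X - l kills \<open>e\<close>, or \<open>q\<close> does, which has fewer factors.\<close>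
  have main: "\<exists>l N. pval x ([:- l, 1:] ^ N) * e = 0"
    if "pval x (\<Prod>l\<leftarrow>ls. [:- l, 1:]) * e = 0" for ls
    using that
  proof (induction ls rule: length_induct)
    case (1 ls)
    show ?case
    proof (cases ls)
      case Nil
      then show ?thesis using "1.prems" e0 by (simp add: pval_1)
    next
      case (Cons l ls')
      define a where "a = length (filter (\<lambda>k. k = l) ls)"
      define q where "q = (\<Prod>k\<leftarrow>filter (\<lambda>k. k \<noteq> l) ls. [:- k, 1:])"
      have pq: "(\<Prod>k\<leftarrow>ls. [:- k, 1:]) = [:- l, 1:] ^ a * q"
        unfolding a_def q_def
        by (induction ls) (auto simp: algebra_simps simp del: mult_pCons_left mult_pCons_right)
      have ql: "poly q l \<noteq> 0"
        unfolding q_def by (induction ls) (auto simp: poly_prod_list)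
      then obtain u v where uv: "u * [:- l, 1:] ^ a + v * q = 1"
        using bezout_linear_power by blast
      have zero: "pval x (w * ([:- l, 1:] ^ a * q)) * e = 0" for w
        using "1.prems" unfolding pq by (simp add: pval_mult mult.assoc)
      define f where "f = pval x (u * [:- l, 1:] ^ a) * e"
      define g where "g = pval x (v * q) * e"
      have fg: "f + g = e"
        unfolding f_def g_def distrib_right[symmetric] pval_add[symmetric] uv by (simp add: pval_1)
      have prod: "(pval x p * e) * (pval x p' * e) = pval x (p * p') * e" for p p'
      proof -
        have "(pval x p * e) * (pval x p' * e) = pval x p * (e * pval x p') * e" by (simp only: mult.assoc)
        also have "\<dots> = pval x p * pval x p' * (e * e)" unfolding comm by (simp only: mult.assoc)
        finally show ?thesis by (simp only: ee pval_mult)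
      qed
      have fg0: "f * g = 0" "g * f = 0"
        unfolding f_def g_def prod
        using zero[of "u * v"] by (simp_all only: ac_simps)
      have idm: "f * f = f" "g * g = g"
      proof -
        have "f * (f + g) = f" "g * (f + g) = g"
          unfolding fg by (simp_all add: f_def g_def mult.assoc ee)
        then show "f * f = f" "g * g = g" by (simp_all add: distrib_left fg0)
      qed
      have "f = 0 \<or> g = 0" using e idm fg0 fg unfolding indecomposable_def by blast
      then show ?thesis
      proof
        assume "f = 0"
        have "pval x ([:- l, 1:] ^ a) * e = pval x ([:- l, 1:] ^ a) * (f + g)" by (simp add: fg)
        also have "\<dots> = pval x (v * ([:- l, 1:] ^ a * q)) * e"
          unfolding \<open>f = 0\<close> g_def by (simp only: add_0 mult.assoc[symmetric] pval_mult[symmetric]) (simp only: ac_simps)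
        finally show ?thesis using zero by metis
      next
        assume "g = 0"
        have "pval x q * e = pval x q * (f + g)" by (simp add: fg)
        also have "\<dots> = pval x (u * ([:- l, 1:] ^ a * q)) * e"
          unfolding \<open>g = 0\<close> f_def by (simp only: add_0_right mult.assoc[symmetric] pval_mult[symmetric]) (simp only: ac_simps)
        finally have "pval x q * e = 0" using zero by metis
        moreover have "length (filter (\<lambda>k. k \<noteq> l) ls) < length ls"
          by (rule length_filter_less[of l]) (simp_all add: Cons)
        ultimately show ?thesis using "1.IH" unfolding q_def by blast
      qed
    qed
  qed
  obtain \<kappa> :: "nat \<Rightarrow> 'k" where \<kappa>: "\<kappa> 0 = 1"
    "\<And>k. of_nat (Suc k) * \<kappa> (Suc k) = - (\<Sum>j\<le>k. tau (x ^ Suc j) * \<kappa> (k - j))"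
    "(\<Sum>i\<le>n. con (\<kappa> i) * x ^ (n - i)) = 0" "\<kappa> (Suc n) = 0"
    by (rule newton_coefficients[of x]) (rule that, assumption+)
  \<comment> \<open>The Cayley-Hamilton polynomial of \<open>x\<close>; its coefficient of X^n is
    \<open>\<kappa> 0\<close>, that is 1, so it is not 0.\<close>
  define P where "P = (\<Sum>i\<le>n. Polynomial.monom (\<kappa> i) (n - i))"
  have Px: "pval x P = 0" using \<kappa>(3) by (simp add: P_def pval_sum pval_monom)
  have "poly.coeff P n = (\<Sum>i\<le>n. if i = 0 then \<kappa> i else 0)"
    unfolding P_def coeff_sum by (rule sum.cong) auto
  then have "P \<noteq> 0" using \<kappa>(1) by auto
  from alg_closed_imp_factorization[OF this]
  obtain A where A: "P = Polynomial.smult (poly.coeff P (Polynomial.degree P)) (\<Prod>x\<in>#A. [:-x, 1:])" by blast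
  obtain ls where ls: "mset ls = A" using ex_mset by blast
  have "(\<Prod>x\<in>#A. [:-x, 1:]) = (\<Prod>l\<leftarrow>ls. [:- l, 1:])"
    by (simp flip: ls prod_mset_prod_list)
  then have "con (poly.coeff P (Polynomial.degree P)) * pval x (\<Prod>l\<leftarrow>ls. [:- l, 1:]) = 0"
    using Px A by (metis pval_smult)
  then have "con (inverse (poly.coeff P (Polynomial.degree P)) * poly.coeff P (Polynomial.degree P)) * pval x (\<Prod>l\<leftarrow>ls. [:- l, 1:]) = 0"
    by (simp add: con_mult mult.assoc)
  then have "pval x (\<Prod>l\<leftarrow>ls. [:- l, 1:]) * e = 0"
    using \<open>P \<noteq> 0\<close> by (simp add: con_1)
  then obtain l N where lN: "pval x ([:- l, 1:] ^ N) * e = 0" using main by blast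
  have "(x - con l * e) ^ N * e = (x - con l) ^ N * e"
  proof (induction N)
    case (Suc N)
    have c: "con l * e * (x - con l) ^ k * e = con l * (x - con l) ^ k * e" for k
    proof -
      have "e * (x - con l) ^ k = (x - con l) ^ k * e"
        using comm[of "[:- l, 1:] ^ k"] by (simp only: pval_power pval_linear)
      then have "e * (x - con l) ^ k * e = (x - con l) ^ k * e" by (simp add: mult.assoc ee)
      then show ?thesis by (simp add: mult.assoc)
    qed
    have "(x - con l * e) ^ Suc N * e = (x - con l * e) * ((x - con l) ^ N * e)"
      using Suc by (simp add: mult.assoc)
    also have "\<dots> = (x - con l) ^ Suc N * e"
      using c[of N] by (simp add: mult.assoc left_diff_distrib)
    finally show ?case .
  qed simp
  then have z: "(x - con l * e) ^ N * e = 0" using lN by (simp add: pval_power pval_linear)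
  \<comment> \<open>One more factor supplies the \<open>e\<close> with which the N-th power is known
    to vanish.\<close>
  have "(x - con l * e) ^ Suc N = (x - con l * e) ^ N * (e * (x - con l * e))"
    by (simp only: power_Suc2 right_diff_distrib ex con_left ee)
  also have "\<dots> = 0" using z by (simp add: mult.assoc[symmetric])
  finally show ?thesis using that by blast
qed

text \<open>By \<open>indecomposable_nilpotent\<close>, e x e is a multiple of \<open>e\<close> plus
  a nilpotent \<open>y\<close>. If \<open>y\<close> were not 0, its last nonzero power
  \<open>z\<close> would satisfy z y = 0 and thereby force every e (y w) e to be nilpotent; all
  tau(y w) would vanish, against nondegeneracy.\<close>

lemma indecomposable_scalar:
  assumes e: "indecomposable e"
  obtains a where "e * x * e = con a * e"
proof -
  have ee: "e * e = e" and e0: "e \<noteq> 0" using e by (auto simp: indecomposable_def)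
  have E: "e * (e * x * e) = e * x * e" "(e * x * e) * e = e * x * e" for x
    by (simp_all add: mult.assoc ee) (simp add: mult.assoc[symmetric] ee)
  obtain a N where aN: "(e * x * e - con a * e) ^ N = 0"
    using indecomposable_nilpotent[OF e E[of x]] by blast
  define y where "y = e * x * e - con a * e"
  have ey: "e * y = y" "y * e = y"
    using E[of x] by (simp_all add: y_def right_diff_distrib left_diff_distrib con_left mult.assoc ee)
  have "y = 0"
  proof (rule ccontr)
    assume y0: "y \<noteq> 0"
    define M where "M = (LEAST M. y ^ M = 0)"
    have yM: "y ^ M = 0" unfolding M_def by (rule LeastI[of _ N]) (use aN in \<open>simp add: y_def\<close>)
    have "M \<noteq> 0" using yM by (cases M) auto
    moreover have "M \<noteq> 1" using yM y0 by auto
    ultimately obtain m where m: "M = Suc (Suc m)" by (metis One_nat_def nat.exhaust)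
    define z where "z = y ^ Suc m"
    have z0: "z \<noteq> 0" unfolding z_def using not_less_Least[of "Suc m" "\<lambda>M. y ^ M = 0"] m M_def by auto
    have zy: "z * y = 0" using yM unfolding m z_def by (simp only: power_Suc2)
    have ze: "z * e = z" unfolding z_def power_Suc2 mult.assoc ey ..
    have "y = 0"
    proof (rule tau_nondegenerate)
      fix w
      have t: "y * w = (y * (e * w))" by (simp add: mult.assoc[symmetric] ey)
      have "tau (y * w) = tau (e * (y * w))" by (simp add: mult.assoc[symmetric] ey)
      also have "\<dots> = tau (y * w * e)" by (rule tau_commute)
      also have "y * w * e = e * (y * w) * e" by (simp add: mult.assoc[symmetric] ey)
      finally have tw: "tau (y * w) = tau (e * (y * w) * e)" .
      let ?t = "e * (y * w) * e"
      obtain b K where bK: "(?t - con b * e) ^ K = 0"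
        using indecomposable_nilpotent[OF e E[of "y * w"]] by blast
      define r where "r = ?t - con b * e"
      have zt: "z * ?t = 0"
        using zy by (simp add: mult.assoc[symmetric] ze)
      \<comment> \<open>Since \<open>z\<close> annihilates \<open>?t\<close>, multiplication by
        \<open>r\<close> acts on \<open>z\<close> as the scalar - b. As \<open>r\<close> is
        nilpotent and \<open>z\<close> is not 0, b must be 0.\<close>
      have zr: "z * r ^ k = con ((- b) ^ k) * z" for k
      proof (induction k)
        case (Suc k)
        have "z * r ^ Suc k = (z * r) * r ^ k" by (simp add: mult.assoc)
        also have "z * r = con (- b) * z"
          unfolding r_def right_diff_distrib zt by (simp add: con_left ze con_uminus)
        also have "con (- b) * z * r ^ k = con (- b) * (con ((- b) ^ k) * z)"
          using Suc by (simp add: mult.assoc)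
        finally show ?case by (simp only: power_Suc con_mult mult.assoc)
      qed (simp add: con_1)
      have "con ((- b) ^ K) * z = 0" using zr[of K] bK by (simp add: r_def)
      then have "con (inverse ((- b) ^ K) * (- b) ^ K) * z = 0" by (simp add: con_mult mult.assoc)
      then have "(- b) ^ K = 0" using z0 by (metis con_1 left_inverse mult_1)
      then have "b = 0" by simp
      then have "?t ^ K = 0" using bK by (simp add: con_0)
      then have "tau ?t = 0" by (rule tau_nilpotent)
      then show "tau (y * w) = 0" unfolding tw .
    qed
    with y0 show False by simp
  qed
  then have "e * x * e = con a * e" by (simp add: y_def)
  then show ?thesis by (rule that)
qed

text \<open>Nonzero idempotents have positive integers as traces and the traces of the two parts add
  up, so induction on the trace takes the place of finite dimension.\<close>

lemma idempotent_decomposition: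
  assumes "e * e = e"
  shows "\<exists>E. finite E \<and> (\<forall>f\<in>E. indecomposable f) \<and> (\<forall>f\<in>E. \<forall>g\<in>E. f \<noteq> g \<longrightarrow> f * g = 0) \<and> \<Sum>E = e"
proof -
  obtain m where "tau e = of_nat m" using tau_idempotent[OF assms] by blast
  then show ?thesis using assms
  proof (induction m arbitrary: e rule: less_induct)
    case (less m)
    show ?case
    proof (cases "e = 0 \<or> indecomposable e")
      case True
      then show ?thesis
      proof
        assume "e = 0"
        then show ?thesis by (intro exI[of _ "{}"]) simp
      next
        assume "indecomposable e"
        then show ?thesis by (intro exI[of _ "{e}"]) simp
      qed
    next
      case False
      then obtain f g where f: "f * f = f" "f \<noteq> 0" and g: "g * g = g" "g \<noteq> 0"
        and fg: "f * g = 0" "g * f = 0" "f + g = e"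
        using less.prems unfolding indecomposable_def by blast
      obtain a where a: "tau f = of_nat a" "a > 0" using tau_idempotent[OF f(1)] f(2) by metis
      obtain b where b: "tau g = of_nat b" "b > 0" using tau_idempotent[OF g(1)] g(2) by metis
      have "of_nat (a + b) = (of_nat m :: 'k)"
        using less.prems(1) a(1) b(1) fg(3) tau_add[of f g] by simp
      then have "a + b = m" by (simp only: of_nat_inject)
      then have lt: "a < m" "b < m" using a b by auto
      obtain E where E: "finite E" "\<forall>f\<in>E. indecomposable f" "\<forall>f\<in>E. \<forall>g\<in>E. f \<noteq> g \<longrightarrow> f * g = 0" "\<Sum>E = f"
        using less.IH[OF lt(1) a(1) f(1)] by blast
      obtain G where G: "finite G" "\<forall>f\<in>G. indecomposable f" "\<forall>f\<in>G. \<forall>g\<in>G. f \<noteq> g \<longrightarrow> f * g = 0" "\<Sum>G = g"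
        using less.IH[OF lt(2) b(1) g(1)] by blast
      \<comment> \<open>Each summand is absorbed by the sum on both sides, so that f g = g f = 0
        passes to the summands of f and g.\<close>
      have unit: "x * \<Sum>A = x \<and> \<Sum>A * x = x"
        if "finite A" "\<forall>f\<in>A. indecomposable f" "\<forall>f\<in>A. \<forall>g\<in>A. f \<noteq> g \<longrightarrow> f * g = 0" "x \<in> A" for A x
      proof -
        have "x * \<Sum>A = (\<Sum>y\<in>A. if y = x then x else 0)"
          unfolding sum_distrib_left by (rule sum.cong) (use that in \<open>auto simp: indecomposable_def\<close>)
        moreover have "\<Sum>A * x = (\<Sum>y\<in>A. if y = x then x else 0)"
          unfolding sum_distrib_right by (rule sum.cong) (use that in \<open>auto simp: indecomposable_def\<close>)
        ultimately show ?thesis using that by simp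
      qed
      have cross: "x * y = 0" "y * x = 0" if "x \<in> E" "y \<in> G" for x y
      proof -
        have x: "x * f = x" "f * x = x" using unit[OF E(1-3) that(1)] E(4) by auto
        have y: "y * g = y" "g * y = y" using unit[OF G(1-3) that(2)] G(4) by auto
        have "x * y = (x * f) * (g * y)" by (simp only: x y)
        also have "\<dots> = x * (f * g) * y" by (simp only: mult.assoc)
        finally show "x * y = 0" by (simp add: fg)
        have "y * x = (y * g) * (f * x)" by (simp only: x y)
        also have "\<dots> = y * (g * f) * x" by (simp only: mult.assoc)
        finally show "y * x = 0" by (simp add: fg)
      qed
      have "E \<inter> G = {}"
      proof (rule ccontr)
        assume "E \<inter> G \<noteq> {}"
        then obtain x where "x \<in> E" "x \<in> G" by blast
        then show False using cross[of x x] E(2) by (auto simp: indecomposable_def)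
      qed
      then have "\<Sum>(E \<union> G) = e" using E G fg by (simp add: sum.union_disjoint)
      then show ?thesis
        using E G cross by (intro exI[of _ "E \<union> G"]) auto
    qed
  qed
qed

text \<open>Nondegeneracy gives \<open>y\<close> with tau(a y) nonzero. The product of
  \<open>a\<close> with f y e lies in e R e, so it is a multiple of \<open>e\<close>, and a nonzero
  one because of its trace; scaling gives a b = e. Then b a is a nonzero idempotent multiple of
  \<open>f\<close>, hence \<open>f\<close>.\<close>

lemma indecomposable_inverse:
  assumes e: "indecomposable e" and f: "indecomposable f" and a: "e * a * f = a" "a \<noteq> 0"
  obtains b where "f * b * e = b" "a * b = e" "b * a = f"
proof -
  have ee: "e * e = e" and ff: "f * f = f" using e f by (auto simp: indecomposable_def)
  have ea: "e * a = a" using a(1) ee by (metis mult.assoc)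
  have af: "a * f = a" using a(1) ff by (metis mult.assoc)
  obtain y where y: "tau (a * y) \<noteq> 0" using tau_nondegenerate[of a] a(2) by blast
  let ?b = "f * y * e"
  have ab: "a * ?b = e * (a * y) * e"
    by (simp add: mult.assoc[symmetric] af ea)
  obtain k where k: "e * (a * y) * e = con k * e" using indecomposable_scalar[OF e] by blast
  have "tau (a * ?b) = tau (e * (a * y * e))" unfolding ab by (simp only: mult.assoc)
  also have "\<dots> = tau (a * y * e * e)" by (rule tau_commute)
  also have "\<dots> = tau (a * y * e)" by (simp add: mult.assoc ee)
  also have "\<dots> = tau (e * (a * y))" by (rule tau_commute)
  also have "\<dots> = tau (a * y)" by (simp add: mult.assoc[symmetric] ea)
  finally have t: "tau (a * ?b) = tau (a * y)" .
  have k0: "k \<noteq> 0" using t y unfolding ab k by (auto simp: con_0 tau_0)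
  define b where "b = con (inverse k) * ?b"
  have fbe: "f * b * e = b"
    unfolding b_def by (simp add: con_left mult.assoc ee) (simp add: mult.assoc[symmetric] ff)
  have "a * b = con (inverse k) * (a * ?b)" unfolding b_def by (rule con_left)
  also have "\<dots> = con (inverse k * k) * e" unfolding ab k by (simp add: con_mult mult.assoc)
  finally have abe: "a * b = e" using k0 by (simp add: con_1)
  obtain l where l: "f * (b * a) * f = con l * f" using indecomposable_scalar[OF f] by blast
  have fb: "f * b = b" using fbe ff by (metis mult.assoc)
  have ba: "b * a = con l * f" using l by (simp add: mult.assoc af) (simp add: mult.assoc[symmetric] fb)
  have "(b * a) * (b * a) = b * (a * b) * a" by (simp only: mult.assoc)
  also have "\<dots> = b * a" unfolding abe by (simp add: mult.assoc ea)
  finally have "con (l * l) * f = con l * f"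
    unfolding ba by (simp add: con_left[of f] con_mult mult.assoc ff)
  have "b * a \<noteq> 0"
  proof
    assume "b * a = 0"
    then have "a * b * a = 0" by (simp add: mult.assoc)
    then show False using abe ea a(2) by simp
  qed
  then have l0: "l \<noteq> 0" by (auto simp: ba con_0)
  have "con (inverse l) * (con (l * l) * f) = con (inverse l) * (con l * f)"
    by (simp only: \<open>con (l * l) * f = con l * f\<close>)
  then have "con l * f = f" using l0 by (simp add: mult.assoc[symmetric] con_mult[symmetric] con_1)
  then have "b * a = f" by (simp add: ba)
  with fbe abe that show ?thesis by blast
qed

text \<open>Right multiplication by an inverse of \<open>a\<close> moves e R f into e R e, which
  consists of the multiples of \<open>e\<close>.\<close>

lemma indecomposable_corner:
  assumes e: "indecomposable e" and f: "indecomposable f" and a: "e * a * f = a" "a \<noteq> 0"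
  obtains k where "e * x * f = con k * a"
proof -
  have ee: "e * e = e" and ff: "f * f = f" using e f by (auto simp: indecomposable_def)
  obtain b where b: "f * b * e = b" "a * b = e" "b * a = f"
    using indecomposable_inverse[OF e f a] .
  have be: "b * e = b" using b(1) ee by (metis mult.assoc)
  have ea: "e * a = a" using a(1) ee by (metis mult.assoc)
  obtain k where k: "e * (x * (f * b)) * e = con k * e" using indecomposable_scalar[OF e] by blast
  have "e * x * f = e * x * (f * (b * a))" using b(3) ff by simp
  also have "\<dots> = e * (x * (f * b)) * (e * a)" by (simp only: mult.assoc ea)
  also have "\<dots> = con k * a" using k by (simp only: mult.assoc[symmetric]) (simp only: mult.assoc ea)
  finally show ?thesis by (rule that)
qed

end

context cayley_hamilton_trace
begin

subsection \<open>Matrix units\<close>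

text \<open>Rows and columns are indexed by the idempotents themselves. Two of them belong to one
  block if e R f is not 0, and \<open>rep\<close> picks one idempotent in each block. As tau(A e * B
  e) = tau(B e * A e), the trace of a diagonal unit depends on the block only.\<close>

lemma matrix_units:
  obtains E :: "'b set" and rep :: "'b \<Rightarrow> 'b" and U :: "'b \<Rightarrow> 'b \<Rightarrow> 'b" and w :: "'b \<Rightarrow> nat" where
    "finite E" "\<And>e. e \<in> E \<Longrightarrow> rep e \<in> E" 
    "\<And>e f. e \<in> E \<Longrightarrow> f \<in> E \<Longrightarrow> rep e = rep f \<Longrightarrow> U e f \<noteq> 0"
    "\<And>e f. e \<in> E \<Longrightarrow> f \<in> E \<Longrightarrow> rep e \<noteq> rep f \<Longrightarrow> U e f = 0"
    "\<And>e f g h. e \<in> E \<Longrightarrow> f \<in> E \<Longrightarrow> g \<in> E \<Longrightarrow> h \<in> E \<Longrightarrow> rep e = rep f \<Longrightarrow> rep g = rep h \<Longrightarrow>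
      U e f * U g h = (if f = g then U e h else 0)"
    "(\<Sum>e\<in>E. U e e) = 1"
    "\<And>x. \<exists>k. x = (\<Sum>e\<in>E. \<Sum>f\<in>E. con (k e f) * U e f)"
    "\<And>e f. e \<in> E \<Longrightarrow> f \<in> E \<Longrightarrow> rep e = rep f \<Longrightarrow> tau (U e f) = (if e = f then of_nat (w (rep e)) else 0)"
    "\<And>e. e \<in> E \<Longrightarrow> w e > 0"
proof -
  obtain E where fin: "finite E" and ind: "\<And>e. e \<in> E \<Longrightarrow> indecomposable e"
    and orth: "\<And>e f. e \<in> E \<Longrightarrow> f \<in> E \<Longrightarrow> e \<noteq> f \<Longrightarrow> e * f = 0" and one: "\<Sum>E = 1"
    using idempotent_decomposition[of 1] by auto
  have idem: "e * e = e" and nz: "e \<noteq> 0" if "e \<in> E" for e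
    using ind[OF that] by (auto simp: indecomposable_def)
  define rel where "rel e f \<longleftrightarrow> (\<exists>a. e * a * f = a \<and> a \<noteq> 0)" for e f :: 'b
  have rel_refl: "rel e e" if "e \<in> E" for e
    unfolding rel_def by (rule exI[of _ e]) (simp add: idem nz that)
  have rel_sym: "rel f e" if ef: "e \<in> E" "f \<in> E" "rel e f" for e f
  proof -
    obtain a where a: "e * a * f = a" "a \<noteq> 0" using ef(3) by (auto simp: rel_def)
    obtain b where b: "f * b * e = b" "a * b = e"
      using indecomposable_inverse[OF ind[OF ef(1)] ind[OF ef(2)] a] by metis
    have "b \<noteq> 0" using b(2) nz[OF ef(1)] by auto
    with b(1) show ?thesis by (auto simp: rel_def)
  qed
  have rel_trans: "rel e g" if E: "e \<in> E" "f \<in> E" "g \<in> E" "rel e f" "rel f g" for e f g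
  proof -
    obtain a where a: "e * a * f = a" "a \<noteq> 0" using E(4) by (auto simp: rel_def)
    obtain b where b: "f * b * g = b" "b \<noteq> 0" using E(5) by (auto simp: rel_def)
    obtain c where c: "b * c = f"
      using indecomposable_inverse[OF ind[OF E(2)] ind[OF E(3)] b] by metis
    have af: "a * f = a" using a(1) idem[OF E(2)] by (metis mult.assoc)
    have ea: "e * a = a" using a(1) idem[OF E(1)] by (metis mult.assoc)
    have bg: "b * g = b" using b(1) idem[OF E(3)] by (metis mult.assoc)
    have "a * b * c = a" using c af by (simp add: mult.assoc)
    then have "a * b \<noteq> 0" using a(2) by auto
    moreover have "e * (a * b) * g = a * b" by (simp add: mult.assoc bg) (simp add: mult.assoc[symmetric] ea)
    ultimately show ?thesis by (auto simp: rel_def)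
  qed
  define rep where "rep e = (SOME f. f \<in> E \<and> rel e f)" for e
  have rep: "rep e \<in> E" "rel e (rep e)" if "e \<in> E" for e
    using someI[of "\<lambda>f. f \<in> E \<and> rel e f" e] rel_refl[OF that] that by (auto simp: rep_def)
  have rep_eq: "rep e = rep f" if "e \<in> E" "f \<in> E" "rel e f" for e f
  proof -
    have "(g \<in> E \<and> rel e g) = (g \<in> E \<and> rel f g)" for g
      using that rel_sym rel_trans by blast
    then show ?thesis by (simp add: rep_def)
  qed
  have "\<exists>a b. e * a * rep e = a \<and> rep e * b * e = b \<and> a * b = e \<and> b * a = rep e" if e: "e \<in> E" for e
  proof -
    obtain a where a: "e * a * rep e = a" "a \<noteq> 0" using rep(2)[OF e] by (auto simp: rel_def)
    obtain b where "rep e * b * e = b" "a * b = e" "b * a = rep e"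
      using indecomposable_inverse[OF ind[OF e] ind[OF rep(1)[OF e]] a] .
    with a show ?thesis by blast
  qed
  then obtain A B where AB: "\<And>e. e \<in> E \<Longrightarrow> e * A e * rep e = A e" "\<And>e. e \<in> E \<Longrightarrow> rep e * B e * e = B e"
    "\<And>e. e \<in> E \<Longrightarrow> A e * B e = e" "\<And>e. e \<in> E \<Longrightarrow> B e * A e = rep e"
    by metis
  have eA: "e * A e = A e" "A e * rep e = A e" if "e \<in> E" for e
    using AB(1)[OF that] idem[OF that] idem[OF rep(1)[OF that]] by (metis mult.assoc)+
  have Be: "B e * e = B e" "rep e * B e = B e" if "e \<in> E" for e
    using AB(2)[OF that] idem[OF that] idem[OF rep(1)[OF that]] by (metis mult.assoc)+
  \<comment> \<open>\<open>A e\<close> and \<open>B e\<close> are mutually inverse between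
    \<open>e\<close> and \<open>rep e\<close>. Passing through the representative makes the units
    compose consistently, which arbitrary nonzero elements of the e R f would do only up to
    scalars.\<close>
  define U where "U e f = (if rep e = rep f then A e * B f else 0)" for e f
  have BA: "B f * A e = (if e = f then rep e else 0)" if "e \<in> E" "f \<in> E" for e f
  proof (cases "e = f")
    case False
    have "B f * A e = (B f * f) * (e * A e)" by (simp add: Be eA that)
    also have "\<dots> = B f * (f * e) * A e" by (simp only: mult.assoc)
    finally show ?thesis using orth[OF that(2,1)] False by simp
  qed (use AB(4) that in simp)
  have UU: "U e f * U g h = (if f = g then U e h else 0)"
    if "e \<in> E" "f \<in> E" "g \<in> E" "h \<in> E" "rep e = rep f" "rep g = rep h" for e f g h
  proof -
    have "U e f * U g h = A e * (B f * A g) * B h" using that by (simp add: U_def mult.assoc)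
    also have "\<dots> = (if f = g then A e * rep f * B h else 0)" using that by (auto simp: BA)
    also have "\<dots> = (if f = g then U e h else 0)"
    proof (cases "f = g")
      case True
      have "A e * rep f = A e" using eA(2)[OF that(1)] unfolding that(5) .
      moreover have "rep e = rep h" using that(5,6) True by (simp only:)
      ultimately show ?thesis unfolding U_def using True by simp
    qed simp
    finally show ?thesis .
  qed
  have Uee: "U e e = e" if "e \<in> E" for e using AB(3) that by (simp add: U_def)
  have Unz: "U e f \<noteq> 0" if "e \<in> E" "f \<in> E" "rep e = rep f" for e f
  proof -
    have "U e f * U f e = e"
      unfolding UU[OF that(1,2,2,1) that(3) that(3)[symmetric]] Uee[OF that(1)] by simp
    then show ?thesis using nz[OF that(1)] by auto
  qed
  have corner: "\<exists>k. e * x * f = con k * U e f" if ef: "e \<in> E" "f \<in> E" for e f x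
  proof (cases "rep e = rep f")
    case True
    have "e * U e f * f = e * A e * (B f * f)" using True by (simp add: U_def mult.assoc)
    also have "\<dots> = U e f" using True by (simp add: eA Be ef U_def)
    finally show ?thesis
      using indecomposable_corner[OF ind[OF ef(1)] ind[OF ef(2)] _ Unz[OF ef True]] by metis
  next
    case False
    have "e * (e * x * f) * f = e * x * f"
      by (simp add: mult.assoc idem ef) (simp add: mult.assoc[symmetric] idem ef)
    then have "e * x * f = 0" using False rep_eq[OF ef] by (metis rel_def)
    then show ?thesis by (intro exI[of _ 0]) (simp add: con_0)
  qed
  have span: "\<exists>k. x = (\<Sum>e\<in>E. \<Sum>f\<in>E. con (k e f) * U e f)" for x
  proof -
    define k where "k e f = (SOME k. e * x * f = con k * U e f)" for e f
    have k: "e * x * f = con (k e f) * U e f" if "e \<in> E" "f \<in> E" for e f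
      unfolding k_def by (rule someI_ex[OF corner[OF that]])
    have "x = \<Sum>E * x * \<Sum>E" by (simp add: one)
    also have "\<dots> = (\<Sum>e\<in>E. \<Sum>f\<in>E. e * x * f)"
      by (simp add: sum_distrib_left sum_distrib_right)
        (rule sum.swap)
    also have "\<dots> = (\<Sum>e\<in>E. \<Sum>f\<in>E. con (k e f) * U e f)"
    proof (rule sum.cong, rule refl)
      fix e assume e: "e \<in> E"
      show "(\<Sum>f\<in>E. e * x * f) = (\<Sum>f\<in>E. con (k e f) * U e f)"
        by (rule sum.cong[OF refl]) (rule k[OF e])
    qed
    finally show ?thesis by blast
  qed
  have "\<exists>m. tau e = of_nat m \<and> m > 0" if "e \<in> E" for e
    using tau_idempotent[OF idem[OF that]] nz[OF that] by metis
  then obtain w where w: "\<And>e. e \<in> E \<Longrightarrow> tau e = of_nat (w e)" "\<And>e. e \<in> E \<Longrightarrow> w e > 0" by metis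
  have tauU: "tau (U e f) = (if e = f then of_nat (w (rep e)) else 0)"
    if "e \<in> E" "f \<in> E" "rep e = rep f" for e f
    using that w(1)[OF rep(1)[OF that(1)]] tau_commute[of "A e" "B f"] BA[OF that(1,2)]
    by (auto simp: U_def tau_0)
  show ?thesis
  proof (rule that[of E rep U w])
    show "U e f = 0" if "rep e \<noteq> rep f" for e f using that by (simp add: U_def)
    show "(\<Sum>e\<in>E. U e e) = 1" using Uee one by simp
  qed (fact fin rep(1) Unz UU span tauU w(2))+
qed

text \<open>Matrices with entries in F are mapped, so the domain is one of the algebras of the
  theorem over F. The image is an F-form of the algebra, which reaches all of it only after
  extension of scalars to K.\<close>

lemma block_embedding:
  obtains ms as :: "nat list" and \<Phi> :: "'f mat list \<Rightarrow> 'b" where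
    "length ms = length as" "\<And>l. l < length ms \<Longrightarrow> 0 < ms ! l" "\<And>l. l < length ms \<Longrightarrow> 0 < as ! l"
    "\<Phi> \<in> trace_hom (block_algebra ms as) R"
    "\<And>rs. rs \<in> carrier (block_algebra ms as :: ('f, 'f mat list) trace_alg) \<Longrightarrow> \<Phi> rs = 0 \<Longrightarrow>
      rs = \<zero>\<^bsub>block_algebra ms as :: ('f, 'f mat list) trace_alg\<^esub>"
    "\<And>x. x \<in> kspan (\<Phi> ` carrier (block_algebra ms as))"
proof -
  obtain E :: "'b set" and rep :: "'b \<Rightarrow> 'b" and U :: "'b \<Rightarrow> 'b \<Rightarrow> 'b" and w :: "'b \<Rightarrow> nat" where
    fin: "finite E" and rep: "\<And>e. e \<in> E \<Longrightarrow> rep e \<in> E" and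
    Unz: "\<And>e f. e \<in> E \<Longrightarrow> f \<in> E \<Longrightarrow> rep e = rep f \<Longrightarrow> U e f \<noteq> 0" and
    Uz: "\<And>e f. e \<in> E \<Longrightarrow> f \<in> E \<Longrightarrow> rep e \<noteq> rep f \<Longrightarrow> U e f = 0" and
    UU: "\<And>e f g h. e \<in> E \<Longrightarrow> f \<in> E \<Longrightarrow> g \<in> E \<Longrightarrow> h \<in> E \<Longrightarrow> rep e = rep f \<Longrightarrow> rep g = rep h \<Longrightarrow>
      U e f * U g h = (if f = g then U e h else 0)" and
    Uone: "(\<Sum>e\<in>E. U e e) = 1" and
    span: "\<And>x. \<exists>k. x = (\<Sum>e\<in>E. \<Sum>f\<in>E. con (k e f) * U e f)" and
    tauU: "\<And>e f. e \<in> E \<Longrightarrow> f \<in> E \<Longrightarrow> rep e = rep f \<Longrightarrow> tau (U e f) = (if e = f then of_nat (w (rep e)) else 0)" and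
    w: "\<And>e. e \<in> E \<Longrightarrow> w e > 0"
    by (rule matrix_units) (rule that, assumption+)
  \<comment> \<open>Blocks are numbered by the list of their representatives; below,
    \<open>blk\<close> gives the number of the block of an idempotent and \<open>pos\<close> its
    place inside the block.\<close>
  obtain rl where rl: "set rl = rep ` E" "distinct rl"
    using finite_distinct_list[of "rep ` E"] fin by auto
  define ms where "ms = map (\<lambda>r. card {e\<in>E. rep e = r}) rl"
  define as where "as = map w rl"
  have len: "length ms = length rl" "length as = length rl" by (simp_all add: ms_def as_def)
  have "\<exists>l. l < length rl \<and> rl ! l = rep e" if "e \<in> E" for e
    using that rl(1) by (metis image_eqI in_set_conv_nth)
  then obtain blk where blk: "\<And>e. e \<in> E \<Longrightarrow> blk e < length rl" "\<And>e. e \<in> E \<Longrightarrow> rl ! blk e = rep e"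
    by metis
  have blk_eq: "blk e = blk f \<longleftrightarrow> rep e = rep f" if "e \<in> E" "f \<in> E" for e f
    using blk that rl(2) by (metis nth_eq_iff_index_eq)
  have cls: "{f\<in>E. blk f = l} = {f\<in>E. rep f = rl ! l}" if "l < length rl" for l
  proof -
    have "blk f = l \<longleftrightarrow> rep f = rl ! l" if "f \<in> E" for f
      using blk[OF that] \<open>l < length rl\<close> rl(2) by (metis nth_eq_iff_index_eq)
    then show ?thesis by blast
  qed
  have "\<exists>p. bij_betw p {f\<in>E. rep f = r} {0..<card {f\<in>E. rep f = r}}" for r
    by (rule ex_bij_betw_finite_nat) (simp add: fin)
  then obtain p where p: "\<And>r. bij_betw (p r) {f\<in>E. rep f = r} {0..<card {f\<in>E. rep f = r}}" by metis
  define pos where "pos e = p (rep e) e" for e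
  have bij: "bij_betw pos {f\<in>E. blk f = l} {..<ms ! l}" if l: "l < length rl" for l
  proof -
    have "bij_betw (p (rl ! l)) {f\<in>E. blk f = l} {..<ms ! l}"
      using p[of "rl ! l"] cls[OF l] l by (simp add: ms_def atLeast0LessThan)
    then show ?thesis
      by (rule bij_betw_cong[THEN iffD1, rotated]) (use cls[OF l] in \<open>auto simp: pos_def\<close>)
  qed
  have posm: "pos e < ms ! blk e" if "e \<in> E" for e
    using bij[OF blk(1)[OF that]] that by (auto simp: bij_betw_def)
  have pos_inj: "e = f" if "e \<in> E" "f \<in> E" "blk e = blk f" "pos e = pos f" for e f
    using bij[OF blk(1)[OF that(1)]] that by (auto simp: bij_betw_def inj_on_def)
  have pos_surj: "\<exists>e\<in>E. blk e = l \<and> pos e = i" if "l < length rl" "i < ms ! l" for l i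
  proof -
    have "i \<in> pos ` {f\<in>E. blk f = l}" using bij[OF that(1)] that(2) by (simp add: bij_betw_def)
    then show ?thesis by auto
  qed
  have asw: "as ! blk e = w (rep e)" if "e \<in> E" for e using blk that by (simp add: as_def)
  let ?B = "block_algebra ms as :: ('f, 'f mat list) trace_alg"
  let ?C = "\<lambda>e. {f\<in>E. blk f = blk e}"
  have sum_class: "(\<Sum>f\<in>?C e. g (pos f)) = (\<Sum>i<ms ! blk e. g i)" if "e \<in> E" for e and g :: "nat \<Rightarrow> 'f"
    by (rule sum.reindex_bij_betw[OF bij[OF blk(1)[OF that]]])
  define ent where "ent rs e f = emb (rs ! blk e $$ (pos e, pos f))" for rs e f
  define \<Phi> where "\<Phi> rs = (\<Sum>e\<in>E. \<Sum>f\<in>?C e. con (ent rs e f) * U e f)" for rs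
  have bc: "length rs = length rl" "rs ! l \<in> carrier_mat (ms ! l) (ms ! l)"
    if "rs \<in> carrier ?B" "l < length rl" for rs l
    using that by (auto simp: block_carrier len)
  have dims: "dim_row (rs ! blk e) = ms ! blk e" "dim_col (rs ! blk e) = ms ! blk e" "length rs = length rl"
    if "rs \<in> carrier ?B" "e \<in> E" for rs e
    using bc[OF that(1) blk(1)[OF that(2)]] by auto
  have ent_add: "ent (map2 (+) rs ss) e f = ent rs e f + ent ss e f"
    if "rs \<in> carrier ?B" "ss \<in> carrier ?B" "e \<in> E" "f \<in> ?C e" for rs ss e f
    using dims[OF that(1,3)] dims[OF that(2,3)] blk(1)[OF that(3)] posm[OF that(3)] posm[of f] that(4)
    by (simp add: ent_def emb_add)
  have ent_smult: "ent (map ((\<cdot>\<^sub>m) a) rs) e f = emb a * ent rs e f"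
    if "rs \<in> carrier ?B" "e \<in> E" "f \<in> ?C e" for rs a e f
    using dims[OF that(1,2)] blk(1)[OF that(2)] posm[OF that(2)] posm[of f] that(3)
    by (simp add: ent_def emb_mult)
  have ent_one: "ent (map 1\<^sub>m ms) e f = (if e = f then 1 else 0)" if "e \<in> E" "f \<in> ?C e" for e f
    using blk(1)[OF that(1)] posm[OF that(1)] posm[of f] that pos_inj[of e f]
    by (auto simp: ent_def len emb_1 emb_0)
  have ent_mult: "ent (map2 (*) rs ss) e h = (\<Sum>f\<in>?C e. ent rs e f * ent ss f h)"
    if "rs \<in> carrier ?B" "ss \<in> carrier ?B" "e \<in> E" "h \<in> ?C e" for rs ss e h
  proof -
    have "map2 (*) rs ss ! blk e $$ (pos e, pos h)
        = (\<Sum>i<ms ! blk e. rs ! blk e $$ (pos e, i) * ss ! blk e $$ (i, pos h))"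
      using dims[OF that(1,3)] dims[OF that(2,3)] blk(1)[OF that(3)] posm[OF that(3)] posm[of h] that(4)
      by (simp add: scalar_prod_def atLeast0LessThan)
    also have "\<dots> = (\<Sum>f\<in>?C e. rs ! blk e $$ (pos e, pos f) * ss ! blk e $$ (pos f, pos h))"
      using sum_class[OF that(3), of "\<lambda>i. rs ! blk e $$ (pos e, i) * ss ! blk e $$ (i, pos h)"] by simp
    finally show ?thesis
      unfolding ent_def by (simp add: emb_sum emb_mult)
  qed
  have tau_\<Phi>: "tau (\<Phi> rs) = emb (block_trace ms as rs)" if rs: "rs \<in> carrier ?B" for rs
  proof -
    have "tau (\<Phi> rs) = (\<Sum>e\<in>E. \<Sum>f\<in>?C e. ent rs e f * (if e = f then of_nat (w (rep e)) else 0))"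
      unfolding \<Phi>_def tau_sum tau_con
      by (intro sum.cong refl) (auto simp: tauU blk_eq)
    also have "\<dots> = (\<Sum>e\<in>E. ent rs e e * of_nat (as ! blk e))"
    proof (rule sum.cong, rule refl)
      fix e assume e: "e \<in> E"
      have "(\<Sum>f\<in>?C e. ent rs e f * (if e = f then of_nat (w (rep e)) else 0))
          = (\<Sum>f\<in>?C e. if f = e then ent rs e e * of_nat (w (rep e)) else 0)"
        by (rule sum.cong) auto
      then show "(\<Sum>f\<in>?C e. ent rs e f * (if e = f then of_nat (w (rep e)) else 0)) = ent rs e e * of_nat (as ! blk e)"
        using fin e by (simp add: asw)
    qed
    also have "\<dots> = (\<Sum>l<length rl. \<Sum>e\<in>{f\<in>E. blk f = l}. ent rs e e * of_nat (as ! blk e))"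
      by (rule sum.group[symmetric]) (use fin blk(1) in auto)
    also have "\<dots> = (\<Sum>l<length rl. emb (of_nat (as ! l) * mat_trace (rs ! l)))"
    proof (rule sum.cong, rule refl)
      fix l assume "l \<in> {..<length rl}"
      then have l: "l < length rl" by simp
      have "(\<Sum>e\<in>{f\<in>E. blk f = l}. ent rs e e * of_nat (as ! blk e))
          = (\<Sum>e\<in>{f\<in>E. blk f = l}. emb (rs ! l $$ (pos e, pos e) * of_nat (as ! l)))"
        by (rule sum.cong) (auto simp: ent_def emb_mult emb_of_nat)
      also have "\<dots> = (\<Sum>i<ms ! l. emb (rs ! l $$ (i, i) * of_nat (as ! l)))"
        by (rule sum.reindex_bij_betw[OF bij[OF l]])
      also have "\<dots> = emb (of_nat (as ! l) * mat_trace (rs ! l))"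
        by (simp add: mat_trace_alt[OF bc(2)[OF rs l]] emb_sum sum_distrib_left mult.commute)
      finally show "(\<Sum>e\<in>{f\<in>E. blk f = l}. ent rs e e * of_nat (as ! blk e)) = emb (of_nat (as ! l) * mat_trace (rs ! l))" .
    qed
    also have "\<dots> = emb (block_trace ms as rs)" by (simp add: block_trace_def emb_sum len)
    finally show ?thesis .
  qed
  have \<Phi>_add: "\<Phi> (map2 (+) rs ss) = \<Phi> rs + \<Phi> ss" if "rs \<in> carrier ?B" "ss \<in> carrier ?B" for rs ss
    unfolding \<Phi>_def sum.distrib[symmetric]
    by (intro sum.cong refl) (simp add: ent_add[OF that] con_add distrib_right)
  have \<Phi>_smult: "\<Phi> (map ((\<cdot>\<^sub>m) a) rs) = con (emb a) * \<Phi> rs" if "rs \<in> carrier ?B" for a rs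
    unfolding \<Phi>_def sum_distrib_left
    by (intro sum.cong refl) (simp add: ent_smult[OF that] con_mult mult.assoc)
  have \<Phi>_one: "\<Phi> (map 1\<^sub>m ms) = 1"
  proof -
    have "\<Phi> (map 1\<^sub>m ms) = (\<Sum>e\<in>E. \<Sum>f\<in>?C e. if f = e then U e e else 0)"
      unfolding \<Phi>_def by (intro sum.cong refl) (auto simp: ent_one con_1 con_0)
    also have "\<dots> = (\<Sum>e\<in>E. U e e)" by (rule sum.cong) (simp_all add: fin)
    finally show ?thesis using Uone by simp
  qed
  have \<Phi>_mult: "\<Phi> (map2 (*) rs ss) = \<Phi> rs * \<Phi> ss" if rs: "rs \<in> carrier ?B" and ss: "ss \<in> carrier ?B" for rs ss
  proof -
    have "\<Phi> rs * \<Phi> ss = (\<Sum>e\<in>E. \<Sum>f\<in>?C e. \<Sum>g\<in>E. \<Sum>h\<in>?C g. (con (ent rs e f) * U e f) * (con (ent ss g h) * U g h))"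
      unfolding \<Phi>_def by (simp only: sum_distrib_right) (simp only: sum_distrib_left)
    also have "\<dots> = (\<Sum>e\<in>E. \<Sum>f\<in>?C e. \<Sum>h\<in>?C e. con (ent rs e f * ent ss f h) * U e h)"
    proof (rule sum.cong, rule refl, rule sum.cong, rule refl)
      fix e f assume e: "e \<in> E" and f: "f \<in> ?C e"
      then have fE: "f \<in> E" and ef: "rep e = rep f" using blk_eq[of e f] by auto
      have "(\<Sum>g\<in>E. \<Sum>h\<in>?C g. (con (ent rs e f) * U e f) * (con (ent ss g h) * U g h))
          = (\<Sum>g\<in>E. if g = f then (\<Sum>h\<in>?C f. con (ent rs e f * ent ss f h) * U e h) else 0)"
      proof (rule sum.cong, rule refl)
        fix g assume g: "g \<in> E"
        have "(con (ent rs e f) * U e f) * (con (ent ss g h) * U g h)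
            = (if g = f then con (ent rs e f * ent ss f h) * U e h else 0)" if "h \<in> ?C g" for h
        proof -
          have "(con (ent rs e f) * U e f) * (con (ent ss g h) * U g h)
              = con (ent rs e f) * (con (ent ss g h) * (U e f * U g h))"
            by (simp only: mult.assoc con_left[of "U e f"])
          also have "U e f * U g h = (if f = g then U e h else 0)"
            using UU[OF e fE g] that ef g by (auto simp: blk_eq)
          finally show ?thesis by (simp add: con_mult mult.assoc)
        qed
        then show "(\<Sum>h\<in>?C g. (con (ent rs e f) * U e f) * (con (ent ss g h) * U g h))
            = (if g = f then (\<Sum>h\<in>?C f. con (ent rs e f * ent ss f h) * U e h) else 0)"
          by simp
      qed
      also have "\<dots> = (\<Sum>h\<in>?C f. con (ent rs e f * ent ss f h) * U e h)" using fin fE by simp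
      also have "\<dots> = (\<Sum>h\<in>?C e. con (ent rs e f * ent ss f h) * U e h)"
        by (rule sum.cong) (use f in auto)
      finally show "(\<Sum>g\<in>E. \<Sum>h\<in>?C g. (con (ent rs e f) * U e f) * (con (ent ss g h) * U g h))
          = (\<Sum>h\<in>?C e. con (ent rs e f * ent ss f h) * U e h)" .
    qed
    also have "\<dots> = (\<Sum>e\<in>E. \<Sum>h\<in>?C e. \<Sum>f\<in>?C e. con (ent rs e f * ent ss f h) * U e h)"
      by (intro sum.cong refl sum.swap)
    also have "\<dots> = \<Phi> (map2 (*) rs ss)"
      unfolding \<Phi>_def
      by (intro sum.cong refl) (simp add: ent_mult[OF rs ss] con_sum sum_distrib_right)
    finally show ?thesis by simp
  qed
  have one_car: "map 1\<^sub>m ms \<in> carrier ?B" by (auto simp: block_carrier)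
  have hom: "\<Phi> \<in> trace_hom ?B R"
  proof (rule trace_homI)
    fix rs assume rs: "rs \<in> carrier ?B"
    show "\<Phi> (trc ?B rs) = trc R (\<Phi> rs)"
      using \<Phi>_smult[OF one_car, of "block_trace ms as rs"] by (simp add: \<Phi>_one tau_\<Phi>[OF rs])
  qed (simp_all add: \<Phi>_add \<Phi>_mult \<Phi>_smult \<Phi>_one)
  have inj: "rs = \<zero>\<^bsub>?B\<^esub>" if rs: "rs \<in> carrier ?B" and z: "\<Phi> rs = 0" for rs
  proof (rule block_eqI)
    show "length rs = length ms" using rs by (simp add: block_carrier)
    fix l assume l: "l < length ms"
    then have l': "l < length rl" by (simp add: len)
    have "rs ! l = 0\<^sub>m (ms ! l) (ms ! l)"
    proof (rule eq_matI)
      fix i j assume "i < dim_row (0\<^sub>m (ms ! l) (ms ! l) :: 'f mat)" "j < dim_col (0\<^sub>m (ms ! l) (ms ! l) :: 'f mat)"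
      then have ij: "i < ms ! l" "j < ms ! l" by simp_all
      obtain e where e: "e \<in> E" "blk e = l" "pos e = i" using pos_surj[OF l' ij(1)] by blast
      obtain f where f: "f \<in> E" "blk f = l" "pos f = j" using pos_surj[OF l' ij(2)] by blast
      have ef: "rep e = rep f" using e f blk_eq by metis
      \<comment> \<open>Cutting out with diagonal units leaves the single entry that belongs to
        \<open>e\<close> and \<open>f\<close>.\<close>
      have "U e e * \<Phi> rs * U f f = (\<Sum>g\<in>E. \<Sum>h\<in>?C g. con (ent rs g h) * (U e e * U g h * U f f))"
        unfolding \<Phi>_def sum_distrib_left sum_distrib_right
        by (simp only: mult.assoc con_left[of "U e e"])
      also have "\<dots> = (\<Sum>g\<in>E. \<Sum>h\<in>?C g. if g = e then (if h = f then con (ent rs e f) * U e f else 0) else 0)"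
      proof (intro sum.cong refl)
        fix g h assume g: "g \<in> E" and h: "h \<in> ?C g"
        then have hE: "h \<in> E" and gh: "rep g = rep h" using blk_eq[of g h] by auto
        have "U e e * U g h = (if e = g then U e h else 0)" using UU[OF e(1) e(1) g hE] gh by simp
        moreover have "e = g \<Longrightarrow> U e h * U f f = (if h = f then U e f else 0)"
          using UU[OF e(1) hE f(1) f(1)] gh by simp
        ultimately show "con (ent rs g h) * (U e e * U g h * U f f)
            = (if g = e then (if h = f then con (ent rs e f) * U e f else 0) else 0)" by auto
      qed
      also have "\<dots> = (\<Sum>g\<in>E. if g = e then (\<Sum>h\<in>?C e. if h = f then con (ent rs e f) * U e f else 0) else 0)"
        by (intro sum.cong refl) auto
      also have "\<dots> = con (ent rs e f) * U e f"
        using fin e f by simp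
      finally have c: "con (ent rs e f) * U e f = 0" using z by simp
      have "ent rs e f = 0"
      proof (rule ccontr)
        assume "ent rs e f \<noteq> 0"
        then have "U e f = con (inverse (ent rs e f)) * (con (ent rs e f) * U e f)"
          by (simp add: mult.assoc[symmetric] con_mult[symmetric] con_1)
        then show False using c Unz[OF e(1) f(1) ef] by simp
      qed
      then show "rs ! l $$ (i, j) = 0\<^sub>m (ms ! l) (ms ! l) $$ (i, j)"
        using e f ij by (simp add: ent_def emb_eq_0)
    qed (use bc(2)[OF rs l'] in auto)
    then show "rs ! l = \<zero>\<^bsub>?B\<^esub> ! l" using l by simp
  qed simp
  have unit: "U e f \<in> \<Phi> ` carrier ?B" if e: "e \<in> E" and f: "f \<in> E" and ef: "blk e = blk f" for e f
  proof -
    define rs :: "'f mat list" where "rs = map (\<lambda>l. mat (ms ! l) (ms ! l) (\<lambda>(i, j).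
        if l = blk e \<and> i = pos e \<and> j = pos f then 1 else 0)) [0..<length rl]"
    have rs: "rs \<in> carrier ?B" by (auto simp: block_carrier rs_def len)
    have "ent rs g h = (if g = e \<and> h = f then 1 else 0)" if g: "g \<in> E" and h: "h \<in> ?C g" for g h
    proof -
      have "rs ! blk g $$ (pos g, pos h) = (if blk g = blk e \<and> pos g = pos e \<and> pos h = pos f then 1 else 0)"
        using blk(1)[OF g] posm[OF g] posm[of h] h by (simp add: rs_def)
      also have "(blk g = blk e \<and> pos g = pos e \<and> pos h = pos f) \<longleftrightarrow> g = e \<and> h = f"
        using pos_inj[OF g e] pos_inj[of h f] h f ef by auto
      finally show ?thesis by (simp add: ent_def emb_0 emb_1)
    qed
    then have "\<Phi> rs = (\<Sum>g\<in>E. \<Sum>h\<in>?C g. if g = e then (if h = f then U e f else 0) else 0)"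
      unfolding \<Phi>_def by (intro sum.cong refl) (auto simp: con_0 con_1)
    also have "\<dots> = (\<Sum>g\<in>E. if g = e then (\<Sum>h\<in>?C e. if h = f then U e f else 0) else 0)"
      by (intro sum.cong refl) auto
    also have "\<dots> = U e f" using fin e f ef by simp
    finally show ?thesis using rs by (metis imageI)
  qed
  have kspan: "x \<in> kspan (\<Phi> ` carrier ?B)" for x
  proof -
    obtain k where k: "x = (\<Sum>e\<in>E. \<Sum>f\<in>E. con (k e f) * U e f)" using span by blast
    have "con (k e f) * U e f \<in> kspan (\<Phi> ` carrier ?B)" if "e \<in> E" "f \<in> E" for e f
    proof (cases "rep e = rep f")
      case True
      then show ?thesis using unit[OF that] blk_eq[OF that] by (intro kspan_scale kspan_base) simp
    next
      case False
      then show ?thesis using Uz[OF that] by (simp add: kspan.zero)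
    qed
    then show ?thesis unfolding k by (intro kspan_sum)
  qed
  show ?thesis
  proof (rule that[of ms as \<Phi>])
    show "length ms = length as" by (simp add: len)
    fix l assume "l < length ms"
    then have l: "l < length rl" by (simp add: len)
    then obtain e where e: "e \<in> E" "rl ! l = rep e" using rl(1) by (metis imageE nth_mem)
    then have "card {f\<in>E. rep f = rl ! l} > 0" using fin by (auto simp: card_gt_0_iff)
    then show "0 < ms ! l" using l by (simp add: ms_def)
    show "0 < as ! l" using l e w[OF rep[OF e(1)]] by (simp add: as_def)
  qed (fact hom inj kspan)+
qed

end

subsection \<open>Trace identities of a Cayley-Hamilton algebra\<close>

text \<open>A point with all its values in the image of \<open>psi\<close> lifts to an endomorphism
  of the free algebra, which keeps \<open>f\<close> in the T-ideal; \<open>density\<close> extends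
  the vanishing to all points.\<close>

lemma (in nondegenerate_trace) ideal_vanishes:
  assumes I: "T_ideal I free_trace_algebra" and psi: "psi \<in> trace_hom free_trace_algebra R"
    and ker: "\<And>p. psi p = 0 \<longleftrightarrow> p \<in> I" and span: "\<And>x. x \<in> kspan (range psi)" and f: "f \<in> I"
  shows "ev s f = 0"
proof (rule density[where V = "range psi"])
  note P = trace_homD[OF psi, simplified]
  have "psi 0 = 0" using ker I by (simp add: T_ideal_def trace_ideal_free)
  then show "0 \<in> range psi" by (metis rangeI)
  fix u a w assume "u \<in> range psi" "w \<in> range psi"
  then obtain p q where "u = psi p" "w = psi q" by blast
  then have "u + con (emb a) * w = psi (p + scal a * q)" using P(2,5) by simp
  then show "u + con (emb a) * w \<in> range psi" by simp
next
  interpret F: trace_algebra "free_trace_algebra :: ('f, (nat, 'f) free_tr) trace_alg"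
    by (rule trace_algebra_free)
  fix s :: "nat \<Rightarrow> 'b" assume "\<And>v. s v \<in> range psi"
  then have "\<forall>v. \<exists>p. s v = psi p" by blast
  then obtain q where q: "\<And>v. s v = psi (q v)" by metis
  have e: "F.free_eval q \<in> trace_hom free_trace_algebra free_trace_algebra"
    by (rule F.free_eval_hom) simp
  have "psi \<circ> F.free_eval q = ev (\<lambda>v. (psi \<circ> F.free_eval q) (Defs.var v))"
    by (rule hom_ev[OF trace_hom_comp[OF e psi]])
  also have "(\<lambda>v. (psi \<circ> F.free_eval q) (Defs.var v)) = s"
    using F.free_eval_var[of q] by (simp add: q fun_eq_iff)
  finally have "ev s f = psi (F.free_eval q f)" by (metis comp_apply)
  moreover have "F.free_eval q f \<in> I" using I e f unfolding T_ideal_def by blast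
  ultimately show "ev s f = 0" using ker by simp
qed (rule span)

text \<open>Elements of \<open>I\<close> vanish at all points of \<open>R\<close>, hence on the
  blocks by injectivity of \<Phi>. Identities of the blocks vanish on the image of \<Phi>, hence by
  \<open>density\<close> at all points of \<open>R\<close>, in particular under \<open>psi\<close>.
  The sum of the m_l a_l is found as tau 1, which the relation tr(1) = n evaluates to n.\<close>

lemma (in cayley_hamilton_trace) identities_of_blocks:
  fixes I :: "(nat, 'f) free_tr set" and psi :: "(nat, 'f) free_tr \<Rightarrow> 'b"
  assumes I: "T_ideal I free_trace_algebra" and psi: "psi \<in> trace_hom free_trace_algebra R"
    and ker: "\<And>p. psi p = 0 \<longleftrightarrow> p \<in> I" and span: "\<And>x. x \<in> kspan (range psi)"
    and one: "free_trc 1 - of_nat n \<in> I"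
  obtains ms as where "length ms = length as" "\<And>l. l < length ms \<Longrightarrow> 0 < ms ! l"
    "\<And>l. l < length ms \<Longrightarrow> 0 < as ! l" "(\<Sum>l<length ms. ms ! l * as ! l) = n"
    "I = trace_identities free_trace_algebra (block_algebra ms as)"
proof -
  obtain ms as :: "nat list" and \<Phi> :: "'f mat list \<Rightarrow> 'b" where
    len: "length ms = length as" and ms: "\<And>l. l < length ms \<Longrightarrow> 0 < ms ! l" and as: "\<And>l. l < length ms \<Longrightarrow> 0 < as ! l"
    and \<Phi>: "\<Phi> \<in> trace_hom (block_algebra ms as) R"
    and inj: "\<And>rs. rs \<in> carrier (block_algebra ms as :: ('f, 'f mat list) trace_alg) \<Longrightarrow> \<Phi> rs = 0 \<Longrightarrow>
      rs = \<zero>\<^bsub>block_algebra ms as :: ('f, 'f mat list) trace_alg\<^esub>"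
    and kspan: "\<And>x. x \<in> kspan (\<Phi> ` carrier (block_algebra ms as))"
    by (rule block_embedding) (rule that, assumption+)
  let ?B = "block_algebra ms as :: ('f, 'f mat list) trace_alg"
  let ?F = "free_trace_algebra :: ('f, (nat, 'f) free_tr) trace_alg"
  interpret B: trace_algebra ?B by (rule trace_algebra_block)
  note P = trace_homD[OF \<Phi>]
  have \<Phi>0: "\<Phi> \<zero>\<^bsub>?B\<^esub> = 0"
    using trace_hom_zero[OF \<Phi> ring_block R.is_ring] by simp
  have "(\<Sum>l<length ms. ms ! l * as ! l) = n"
  proof -
    have "psi (free_trc 1 - of_nat n) = 0" using ker one by simp
    moreover have "free_trc 1 - of_nat n = free_trc (1 :: (nat, 'f) free_tr) + scal (- of_nat n)"
      by (simp add: scal_uminus scal_of_nat)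
    moreover have "psi = ev (\<lambda>v. psi (Defs.var v))" by (rule hom_ev[OF psi])
    ultimately have "con (tau 1) + con (emb (- of_nat n)) = 0" using ev_simps ev_1 by metis
    then have "con (tau 1 + - of_nat n) = 0" by (simp only: con_add emb_uminus emb_of_nat)
    then have "tau 1 + - of_nat n = 0" by (simp only: con_eq_0)
    then have t1: "tau 1 = of_nat n" by simp
    have o: "\<one>\<^bsub>?B\<^esub> \<in> carrier ?B" by (auto simp: block_carrier)
    have "con (tau 1) = \<Phi> (trc ?B \<one>\<^bsub>?B\<^esub>)" using P(6)[OF o] P(4) by simp
    also have "\<dots> = \<Phi> (block_trace ms as \<one>\<^bsub>?B\<^esub> \<odot>\<^bsub>?B\<^esub> \<one>\<^bsub>?B\<^esub>)" by simp
    also have "\<dots> = con (emb (block_trace ms as \<one>\<^bsub>?B\<^esub>))"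
      unfolding P(5)[OF o] P(4) by simp
    finally have "of_nat n = emb (block_trace ms as (map 1\<^sub>m ms))" by (simp add: con_inject t1)
    also have "block_trace ms as (map 1\<^sub>m ms) = (of_nat (\<Sum>l<length ms. ms ! l * as ! l) :: 'f)"
      by (simp add: block_trace_def mat_trace_one mult.commute)
    finally have "of_nat n = (of_nat (\<Sum>l<length ms. ms ! l * as ! l) :: 'k)" by (simp only: emb_of_nat)
    then show ?thesis by (simp only: of_nat_inject)
  qed
  moreover have "I = trace_identities ?F ?B"
  proof (intro equalityI subsetI)
    fix f assume f: "f \<in> I"
    have "h f = \<zero>\<^bsub>?B\<^esub>" if h: "h \<in> trace_hom ?F ?B" for h
    proof (rule inj)
      show "h f \<in> carrier ?B" by (rule trace_homD(1)[OF h]) simp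
      have "\<Phi> \<circ> h = ev (\<lambda>v. (\<Phi> \<circ> h) (Defs.var v))"
        by (rule hom_ev[OF trace_hom_comp[OF h \<Phi>]])
      then have "(\<Phi> \<circ> h) f = 0" using ideal_vanishes[OF I psi ker span f] by metis
      then show "\<Phi> (h f) = 0" by simp
    qed
    then show "f \<in> trace_identities ?F ?B" by (simp add: trace_identities_def)
  next
    fix f assume f: "f \<in> trace_identities ?F ?B"
    have "ev s f = 0" for s
    proof (rule density[where V = "\<Phi> ` carrier ?B"])
      have "\<zero>\<^bsub>?B\<^esub> \<in> carrier ?B" by (auto simp: block_carrier)
      then show "0 \<in> \<Phi> ` carrier ?B" using \<Phi>0 by (metis imageI)
      fix u a w assume "u \<in> \<Phi> ` carrier ?B" "w \<in> \<Phi> ` carrier ?B"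
      then obtain r r' where r: "r \<in> carrier ?B" "u = \<Phi> r" and r': "r' \<in> carrier ?B" "w = \<Phi> r'" by blast
      have ar: "a \<odot>\<^bsub>?B\<^esub> r' \<in> carrier ?B" using r'(1) by (auto simp: block_carrier)
      have s: "r \<oplus>\<^bsub>?B\<^esub> (a \<odot>\<^bsub>?B\<^esub> r') \<in> carrier ?B" using r(1) ar by (auto simp: block_carrier)
      have "u + con (emb a) * w = \<Phi> (r \<oplus>\<^bsub>?B\<^esub> (a \<odot>\<^bsub>?B\<^esub> r'))"
        unfolding P(2)[OF r(1) ar] P(5)[OF r'(1)] by (simp add: r r')
      then show "u + con (emb a) * w \<in> \<Phi> ` carrier ?B" using s by blast
    next
      fix s :: "nat \<Rightarrow> 'b" assume "\<And>v. s v \<in> \<Phi> ` carrier ?B"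
      then have "\<forall>v. \<exists>r. r \<in> carrier ?B \<and> s v = \<Phi> r" by blast
      then obtain r where r: "\<And>v. r v \<in> carrier ?B" "\<And>v. s v = \<Phi> (r v)" by metis
      have h: "B.free_eval r \<in> trace_hom ?F ?B" by (rule B.free_eval_hom) (rule r)
      have "\<Phi> \<circ> B.free_eval r = ev (\<lambda>v. (\<Phi> \<circ> B.free_eval r) (Defs.var v))"
        by (rule hom_ev[OF trace_hom_comp[OF h \<Phi>]])
      also have "(\<lambda>v. (\<Phi> \<circ> B.free_eval r) (Defs.var v)) = s"
        using B.free_eval_var[of r] r by (simp add: fun_eq_iff)
      finally have "ev s f = \<Phi> (B.free_eval r f)" by (metis comp_apply)
      also have "B.free_eval r f = \<zero>\<^bsub>?B\<^esub>" using f h by (rule trace_identitiesD)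
      finally show "ev s f = 0" by (simp only: \<Phi>0)
    qed (rule kspan)
    then have "psi f = 0" using hom_ev[OF psi] by metis
    then show "f \<in> I" using ker by simp
  qed
  ultimately show ?thesis using that len ms as by blast
qed

section \<open>The residue field of a prime ideal\<close>

text \<open>Trace polynomials without words get a commutative ring of their own, because a field of
  fractions is to be formed from a quotient of it.\<close>

definition pure :: "(('x cyc \<Rightarrow>\<^sub>0 nat) \<Rightarrow>\<^sub>0 'f) \<Rightarrow> ('x, 'f::field) free_tr" where
  "pure z = pprod (add_monoid class_ring) (\<lambda>T c. fterm T 0 c) z"

lemma pure_add: "pure (y + z) = pure y + pure z"
proof -
  let ?M = "add_monoid (class_ring :: ('a, 'b) free_tr ring)"
  interpret A: comm_monoid ?M
    by (rule comm_monoidI) (auto simp: add.assoc add.commute)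
  have "pprod ?M (\<lambda>T c. fterm T 0 c) (y + z) = pprod ?M (\<lambda>T c. fterm T 0 c) y \<otimes>\<^bsub>?M\<^esub> pprod ?M (\<lambda>T c. fterm T 0 c) z"
    by (rule A.pprod_add) (auto simp: single_add)
  then show ?thesis by (simp add: pure_def)
qed

lemma pure_single: "pure (Poly_Mapping.single T c) = fterm T 0 c"
proof -
  let ?M = "add_monoid (class_ring :: ('a, 'b) free_tr ring)"
  interpret A: comm_monoid ?M
    by (rule comm_monoidI) (auto simp: add.assoc add.commute)
  show ?thesis unfolding pure_def by (rule A.pprod_single) auto
qed

lemma pure_0: "pure 0 = 0"
  using pure_add[of 0 0] by simp

lemma pure_uminus: "pure (- z) = - pure z"
  using pure_add[of z "- z"] by (simp add: pure_0 eq_neg_iff_add_eq_0 add.commute)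

lemma pure_diff: "pure (y - z) = pure y - pure z"
  using pure_add[of y "- z"] by (simp add: pure_uminus)

lemma pure_mult: "pure (y * z) = pure y * pure z"
proof (induction y rule: poly_mapping_additive_induct)
  case (single S a)
  show ?case
    by (induction z rule: poly_mapping_additive_induct)
      (simp_all add: pure_0 pure_single mult_single pure_add distrib_left)
qed (simp_all add: pure_0 pure_add distrib_right)

lemma pure_1: "pure 1 = 1"
  using pure_single[of 0 1] by simp

lemma free_trc_pure: "\<exists>z. free_trc p = pure z"
proof (induction p rule: free_tr_induct)
  case (fterm T w c)
  show ?case by (rule exI[of _ "Poly_Mapping.single (T + Poly_Mapping.single (abs_cyc w) 1) c"]) (simp add: pure_single)
next
  case (add p q)
  then show ?case by (metis free_trc_add pure_add)
qed

lemma free_trc_pure_mult: "free_trc (pure z * p) = pure z * free_trc p"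
proof (induction z rule: poly_mapping_additive_induct)
  case (single T c)
  show ?case
    by (induction p rule: free_tr_induct)
      (simp_all add: pure_single fterm_mult free_trc_add distrib_left add.assoc)
qed (simp_all add: pure_0 pure_add distrib_right free_trc_add)

text \<open>The degree and the ideal form one pair, so that a single choice below fixes
  both.\<close>

definition good_ideal :: "nat \<times> (nat, 'f::field_char_0) free_tr set \<Rightarrow> bool" where
  "good_ideal = (\<lambda>(n, I). n \<ge> 1 \<and> T_ideal I free_trace_algebra \<and> CH n (Defs.var 0) \<in> I \<and>
     free_trc 1 - of_nat n \<in> I \<and> free_prime I)"

definition block_ideal :: "nat \<times> (nat, 'f::field_char_0) free_tr set \<Rightarrow> bool" where
  "block_ideal = (\<lambda>(n, I). \<exists>ms as. length ms = length as \<and> (\<forall>m\<in>set ms. 0 < m) \<and> (\<forall>a\<in>set as. 0 < a) \<and>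
     (\<Sum>j<length ms. ms ! j * as ! j) = n \<and> I = trace_identities free_trace_algebra (block_algebra ms as))"

lemma good_block_ideal:
  assumes "n \<ge> 1" "block_ideal (n, I)"
  shows "good_ideal (n, I)"
proof -
  obtain ms as where len: "length ms = length as" and ms: "\<forall>m\<in>set ms. 0 < m" and as: "\<forall>a\<in>set as. 0 < a"
    and n: "(\<Sum>j<length ms. ms ! j * as ! j) = n"
    and I: "I = trace_identities free_trace_algebra (block_algebra ms as)"
    using assms(2) by (auto simp: block_ideal_def)
  have ms': "0 < ms ! l" if "l < length ms" for l using ms that by simp
  have as': "0 < as ! l" if "l < length ms" for l using as that len by simp
  have "ms \<noteq> []" using n assms(1) by auto
  have "free_prime I"
    unfolding I by (rule free_prime_block_identities[OF refl ms' as' \<open>ms \<noteq> []\<close>])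
  moreover have "T_ideal I free_trace_algebra"
    unfolding I by (rule T_ideal_identities) (rule trace_algebra_block)
  moreover have "CH n (Defs.var 0) \<in> I" "free_trc 1 - of_nat n \<in> I"
    unfolding I trace_identities_def using hom_block_CH[OF as' n] hom_block_trace_one[OF as' n] by auto
  ultimately show ?thesis using assms(1) by (simp add: good_ideal_def)
qed

text \<open>Types cannot depend on a given ideal. So the residue field is built for a fixed choice, which is a
  counterexample to the theorem if there is one.\<close>

definition chosen :: "nat \<times> (nat, 'f::field_char_0) free_tr set" where
  "chosen = (SOME x. good_ideal x \<and> (block_ideal x \<longrightarrow> (\<forall>y::nat \<times> (nat, 'f) free_tr set. good_ideal y \<longrightarrow> block_ideal y)))"

text \<open>Once \<open>block_ideal\<close> is shown for this one pair it follows for every good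
  pair, so the construction of a single field is enough.\<close>

lemma chosen:
  "good_ideal (chosen :: nat \<times> (nat, 'f::field_char_0) free_tr set)"
  "block_ideal (chosen :: nat \<times> (nat, 'f) free_tr set) \<Longrightarrow> good_ideal (y :: nat \<times> (nat, 'f) free_tr set) \<Longrightarrow> block_ideal y"
proof -
  let ?P = "\<lambda>x :: nat \<times> (nat, 'f) free_tr set. good_ideal x \<and>
    (block_ideal x \<longrightarrow> (\<forall>y::nat \<times> (nat, 'f) free_tr set. good_ideal y \<longrightarrow> block_ideal y))"
  have "\<exists>x. ?P x"
  proof (cases "\<exists>y::nat \<times> (nat, 'f) free_tr set. good_ideal y \<and> \<not> block_ideal y")
    case False
    \<comment> \<open>If there is no counterexample, \<open>chosen\<close> still has to be a good
      pair; the identities of F(1;1), which is F itself, provide one.\<close>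
    let ?I = "trace_identities free_trace_algebra (block_algebra [1] [1]) :: (nat, 'f) free_tr set"
    have "block_ideal (1, ?I)"
      unfolding block_ideal_def by (auto intro!: exI[of _ "[1]"])
    then have "good_ideal (1, ?I)" by (rule good_block_ideal[rotated]) simp
    with False show ?thesis by blast
  qed blast
  then have "?P chosen" unfolding chosen_def by (rule someI_ex)
  then show "good_ideal (chosen :: nat \<times> (nat, 'f) free_tr set)"
    "block_ideal (chosen :: nat \<times> (nat, 'f) free_tr set) \<Longrightarrow> good_ideal y \<Longrightarrow> block_ideal y" by blast+
qed

abbreviation deg0 :: "'f::field_char_0 itself \<Rightarrow> nat" where
  "deg0 t \<equiv> fst (chosen :: nat \<times> (nat, 'f) free_tr set)"

abbreviation ideal0 :: "(nat, 'f::field_char_0) free_tr set" where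
  "ideal0 \<equiv> snd chosen"

lemma ideal0:
  "deg0 TYPE('f::field_char_0) \<ge> 1" "T_ideal (ideal0 :: (nat, 'f) free_tr set) free_trace_algebra"
  "CH (deg0 TYPE('f)) (Defs.var 0) \<in> (ideal0 :: (nat, 'f) free_tr set)"
  "free_trc 1 - of_nat (deg0 TYPE('f)) \<in> (ideal0 :: (nat, 'f) free_tr set)"
  "free_prime (ideal0 :: (nat, 'f) free_tr set)"
  using chosen(1)[where 'f = 'f] by (simp_all add: good_ideal_def case_prod_beta)

lemma ideal0_ideal:
  fixes a b :: "(nat, 'f::field_char_0) free_tr"
  shows "0 \<in> (ideal0 :: (nat, 'f) free_tr set)" "a \<in> ideal0 \<Longrightarrow> b \<in> ideal0 \<Longrightarrow> a + b \<in> ideal0"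
    "a \<in> ideal0 \<Longrightarrow> a * b \<in> ideal0" "a \<in> ideal0 \<Longrightarrow> b * a \<in> ideal0" "a \<in> ideal0 \<Longrightarrow> free_trc a \<in> ideal0"
    "a \<in> ideal0 \<Longrightarrow> - a \<in> ideal0" "1 \<notin> (ideal0 :: (nat, 'f) free_tr set)"
proof -
  have I: "trace_ideal (ideal0 :: (nat, 'f) free_tr set) free_trace_algebra"
    using ideal0(2)[where 'f = 'f] by (simp add: T_ideal_def)
  note If = I[unfolded trace_ideal_free]
  show "0 \<in> (ideal0 :: (nat, 'f) free_tr set)" "a \<in> ideal0 \<Longrightarrow> b \<in> ideal0 \<Longrightarrow> a + b \<in> ideal0"
    "a \<in> ideal0 \<Longrightarrow> a * b \<in> ideal0" "a \<in> ideal0 \<Longrightarrow> b * a \<in> ideal0" "a \<in> ideal0 \<Longrightarrow> free_trc a \<in> ideal0"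
    using If by auto
  show "- a \<in> ideal0" if "a \<in> ideal0"
  proof -
    have "(- 1) * a \<in> ideal0" using If that by blast
    then show ?thesis by simp
  qed
  show "1 \<notin> (ideal0 :: (nat, 'f) free_tr set)" using ideal0(5)[where 'f = 'f] by (simp add: free_prime_def)
qed

section \<open>The domain of traces modulo the chosen ideal, and its field\<close>

definition pure_eq :: "((nat cyc \<Rightarrow>\<^sub>0 nat) \<Rightarrow>\<^sub>0 'f::field_char_0) \<Rightarrow> ((nat cyc \<Rightarrow>\<^sub>0 nat) \<Rightarrow>\<^sub>0 'f) \<Rightarrow> bool" where
  "pure_eq y z \<longleftrightarrow> pure (y - z) \<in> ideal0"

lemma pure_eq_refl: "pure_eq z z"
  by (simp add: pure_eq_def pure_0 ideal0_ideal)

text \<open>\<open>free_prime_trc\<close> speaks of values of the trace map. A pure element is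
  recovered from its trace, which modulo the ideal is n times the element because tr(1) = n, and n
  is invertible.\<close>

lemma pure_eq_prime:
  fixes y z :: "(nat cyc \<Rightarrow>\<^sub>0 nat) \<Rightarrow>\<^sub>0 'f::field_char_0"
  assumes "pure_eq (y * z) 0"
  shows "pure_eq y 0 \<or> pure_eq z 0"
proof -
  let ?n = "of_nat (deg0 TYPE('f)) :: (nat, 'f) free_tr"
  have n0: "deg0 TYPE('f) \<noteq> 0" using ideal0(1)[where 'f = 'f] by simp
  have t: "free_trc (pure u) - pure u * ?n \<in> ideal0" for u
    using ideal0_ideal(4)[OF ideal0(4), of "pure u"] free_trc_pure_mult[of u 1] by (simp add: right_diff_distrib)
  have inv: "pure u \<in> ideal0" if "free_trc (pure u) \<in> ideal0" for u :: "(nat cyc \<Rightarrow>\<^sub>0 nat) \<Rightarrow>\<^sub>0 'f"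
  proof -
    have "free_trc (pure u) + - (free_trc (pure u) - pure u * ?n) \<in> ideal0"
      by (intro ideal0_ideal that t)
    then have "pure u * ?n \<in> ideal0" by simp
    then have "pure u * ?n * scal (1 / of_nat (deg0 TYPE('f))) \<in> ideal0" by (rule ideal0_ideal)
    then show ?thesis using n0 by (simp add: mult.assoc scal_of_nat[symmetric] scal_mult[symmetric])
  qed
  have "free_trc (pure y) * free_trc (pure z) = pure (y * z) * (free_trc 1 * free_trc 1)"
  proof -
    have "free_trc (pure y) * free_trc (pure z) = pure y * (free_trc 1 * pure z) * free_trc 1"
      using free_trc_pure_mult[of y 1] free_trc_pure_mult[of z 1] by (simp add: mult.assoc)
    then show ?thesis unfolding free_trc_central[of 1 "pure z"] by (simp add: pure_mult mult.assoc)
  qed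
  then have "free_trc (pure y) * free_trc (pure z) \<in> ideal0"
    using assms ideal0_ideal(3) by (simp add: pure_eq_def)
  then have "free_trc (pure y) \<in> ideal0 \<or> free_trc (pure z) \<in> ideal0"
    by (rule free_prime_trc[OF ideal0(5)])
  then show ?thesis using inv by (auto simp: pure_eq_def)
qed

quotient_type (overloaded) 'f residue_ring = "(nat cyc \<Rightarrow>\<^sub>0 nat) \<Rightarrow>\<^sub>0 'f::field_char_0" / pure_eq
proof (rule equivpI)
  show "reflp (pure_eq :: _ \<Rightarrow> ((nat cyc \<Rightarrow>\<^sub>0 nat) \<Rightarrow>\<^sub>0 'f) \<Rightarrow> _)" by (rule reflpI) (rule pure_eq_refl)
  show "symp (pure_eq :: _ \<Rightarrow> ((nat cyc \<Rightarrow>\<^sub>0 nat) \<Rightarrow>\<^sub>0 'f) \<Rightarrow> _)"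
  proof (rule sympI)
    fix x y :: "(nat cyc \<Rightarrow>\<^sub>0 nat) \<Rightarrow>\<^sub>0 'f"
    assume "pure_eq x y"
    then have "- pure (x - y) \<in> ideal0" unfolding pure_eq_def by (rule ideal0_ideal)
    then show "pure_eq y x" by (simp add: pure_eq_def pure_diff)
  qed
  show "transp (pure_eq :: _ \<Rightarrow> ((nat cyc \<Rightarrow>\<^sub>0 nat) \<Rightarrow>\<^sub>0 'f) \<Rightarrow> _)"
  proof (rule transpI)
    fix x y z :: "(nat cyc \<Rightarrow>\<^sub>0 nat) \<Rightarrow>\<^sub>0 'f"
    assume "pure_eq x y" "pure_eq y z"
    then have "pure (x - y) + pure (y - z) \<in> ideal0" unfolding pure_eq_def by (rule ideal0_ideal)
    then show "pure_eq x z" by (simp add: pure_eq_def pure_diff)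
  qed
qed

instantiation residue_ring :: (field_char_0) idom
begin

lift_definition zero_residue_ring :: "'a residue_ring" is 0 .
lift_definition one_residue_ring :: "'a residue_ring" is 1 .
lift_definition plus_residue_ring :: "'a residue_ring \<Rightarrow> 'a residue_ring \<Rightarrow> 'a residue_ring" is "(+)"
proof -
  fix a b c d :: "(nat cyc \<Rightarrow>\<^sub>0 nat) \<Rightarrow>\<^sub>0 'a"
  assume "pure_eq a b" "pure_eq c d"
  then have "pure (a - b) + pure (c - d) \<in> ideal0" unfolding pure_eq_def by (rule ideal0_ideal)
  then show "pure_eq (a + c) (b + d)" by (simp add: pure_eq_def pure_diff pure_add algebra_simps)
qed
lift_definition uminus_residue_ring :: "'a residue_ring \<Rightarrow> 'a residue_ring" is uminus
proof -
  fix a b :: "(nat cyc \<Rightarrow>\<^sub>0 nat) \<Rightarrow>\<^sub>0 'a"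
  assume "pure_eq a b"
  then have "- pure (a - b) \<in> ideal0" unfolding pure_eq_def by (rule ideal0_ideal)
  then show "pure_eq (- a) (- b)" by (simp add: pure_eq_def pure_diff pure_uminus)
qed
lift_definition minus_residue_ring :: "'a residue_ring \<Rightarrow> 'a residue_ring \<Rightarrow> 'a residue_ring" is "(-)"
proof -
  fix a b c d :: "(nat cyc \<Rightarrow>\<^sub>0 nat) \<Rightarrow>\<^sub>0 'a"
  assume "pure_eq a b" "pure_eq c d"
  then have "pure (a - b) + - pure (c - d) \<in> ideal0" unfolding pure_eq_def by (intro ideal0_ideal)
  then show "pure_eq (a - c) (b - d)" by (simp add: pure_eq_def pure_diff pure_add algebra_simps)
qed
lift_definition times_residue_ring :: "'a residue_ring \<Rightarrow> 'a residue_ring \<Rightarrow> 'a residue_ring" is "(*)"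
proof -
  fix a b c d :: "(nat cyc \<Rightarrow>\<^sub>0 nat) \<Rightarrow>\<^sub>0 'a"
  assume "pure_eq a b" "pure_eq c d"
  then have "pure (a - b) * pure c + pure b * pure (c - d) \<in> ideal0"
    unfolding pure_eq_def by (intro ideal0_ideal)
  then show "pure_eq (a * c) (b * d)" by (simp add: pure_eq_def pure_diff pure_mult algebra_simps)
qed

instance
proof
  fix a b c :: "'a residue_ring"
  show "a * b * c = a * (b * c)" by transfer (simp add: mult.assoc pure_eq_refl)
  show "a * b = b * a" by transfer (simp add: mult.commute pure_eq_refl)
  show "1 * a = a" by transfer (simp add: pure_eq_refl)
  show "a + b + c = a + (b + c)" by transfer (simp add: add.assoc pure_eq_refl)
  show "a + b = b + a" by transfer (simp add: add.commute pure_eq_refl)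
  show "0 + a = a" by transfer (simp add: pure_eq_refl)
  show "- a + a = 0" by transfer (simp add: pure_eq_refl)
  show "a - b = a + - b" by transfer (simp add: pure_eq_refl)
  show "(a + b) * c = a * c + b * c" by transfer (simp add: distrib_right pure_eq_refl)
  show "a * (b + c) = a * b + a * c" by transfer (simp add: distrib_left pure_eq_refl)
  show "0 * a = 0" "a * 0 = 0" by (transfer, simp add: pure_eq_refl)+
  show "(0 :: 'a residue_ring) \<noteq> 1"
  proof transfer
    show "\<not> pure_eq 0 (1 :: (nat cyc \<Rightarrow>\<^sub>0 nat) \<Rightarrow>\<^sub>0 'a)"
      using ideal0_ideal(6)[of "- 1 :: (nat, 'a) free_tr"] ideal0_ideal(7)[where 'f = 'a]
      by (auto simp: pure_eq_def pure_uminus pure_1)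
  qed
  show "a \<noteq> 0 \<Longrightarrow> b \<noteq> 0 \<Longrightarrow> a * b \<noteq> 0"
    by transfer (use pure_eq_prime in blast)
qed

end

type_synonym 'f residue_field = "'f residue_ring fract alg_closure"

definition residue :: "((nat cyc \<Rightarrow>\<^sub>0 nat) \<Rightarrow>\<^sub>0 'f::field_char_0) \<Rightarrow> 'f residue_field" where
  "residue z = to_ac (Fract (abs_residue_ring z) 1)"

lemma residue_add: "residue (y + z) = residue y + residue z"
  unfolding residue_def plus_residue_ring.abs_eq[symmetric] to_ac_add[symmetric] by simp

lemma residue_mult: "residue (y * z) = residue y * residue z"
  unfolding residue_def times_residue_ring.abs_eq[symmetric] to_ac_mult[symmetric] by simp

lemma residue_1: "residue 1 = 1"
  by (simp add: residue_def one_residue_ring.abs_eq[symmetric] One_fract_def[symmetric])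

lemma residue_eq_0: "residue z = 0 \<longleftrightarrow> pure z \<in> ideal0"
proof -
  have "residue z = 0 \<longleftrightarrow> abs_residue_ring z = 0"
    by (simp add: residue_def eq_fract Zero_fract_def)
  also have "\<dots> \<longleftrightarrow> pure z \<in> ideal0"
    unfolding zero_residue_ring.abs_eq residue_ring.abs_eq_iff pure_eq_def by simp
  finally show ?thesis .
qed


lemma residue_of_nat: "residue (of_nat m :: (nat cyc \<Rightarrow>\<^sub>0 nat) \<Rightarrow>\<^sub>0 'f::field_char_0) = of_nat m"
proof (induction m)
  case 0
  show ?case using residue_eq_0[of 0] by (simp add: pure_0 ideal0_ideal)
qed (simp add: residue_add residue_1)

lemma residue_const_eq_0: "residue (Poly_Mapping.single 0 c) = 0 \<longleftrightarrow> c = (0 :: 'f::field_char_0)"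
proof
  assume z: "residue (Poly_Mapping.single 0 c) = 0"
  show "c = 0"
  proof (rule ccontr)
    assume "c \<noteq> 0"
    have "residue (Poly_Mapping.single 0 c * Poly_Mapping.single 0 (inverse c)) = 0"
      unfolding residue_mult z by simp
    then show False using \<open>c \<noteq> 0\<close> by (simp add: mult_single residue_1)
  qed
qed (simp add: residue_eq_0 pure_0 ideal0_ideal)

section \<open>The free algebra over the residue field modulo the radical of its trace form\<close>

definition word_residue :: "nat word \<Rightarrow> 'f::field_char_0 residue_field" where
  "word_residue w = residue (Poly_Mapping.single (Poly_Mapping.single (abs_cyc w) 1) 1)"

lemma word_residue_commute: "word_residue (v + w) = word_residue (w + v)"
  by (simp add: word_residue_def abs_cyc_commute)

lemma word_residue_0: "(word_residue 0 :: 'f::field_char_0 residue_field) = of_nat (deg0 TYPE('f))"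
proof -
  let ?t = "Poly_Mapping.single (Poly_Mapping.single (abs_cyc 0) 1) 1 :: (nat cyc \<Rightarrow>\<^sub>0 nat) \<Rightarrow>\<^sub>0 'f"
  have "pure ?t = free_trc 1"
    unfolding pure_single using free_trc_fterm[of 0 "0 :: nat word" "1 :: 'f"] by simp
  moreover have "pure (of_nat m) = (of_nat m :: (nat, 'f) free_tr)" for m
    by (induction m) (simp_all add: pure_0 pure_1 pure_add)
  ultimately have "pure (?t - of_nat (deg0 TYPE('f))) \<in> ideal0"
    using ideal0(4)[where 'f = 'f] by (simp add: pure_diff)
  then have "residue (?t - of_nat (deg0 TYPE('f))) = 0" by (simp only: residue_eq_0)
  moreover have "residue ?t = residue (?t - of_nat (deg0 TYPE('f))) + residue (of_nat (deg0 TYPE('f)))"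
    by (simp flip: residue_add)
  ultimately show ?thesis by (simp add: word_residue_def residue_of_nat)
qed

text \<open>The trace of the free algebra after extension of scalars: every tr(w) is replaced by its
  class in K, and the result is made linear over K.\<close>

definition form0 :: "(nat word \<Rightarrow>\<^sub>0 'f::field_char_0 residue_field) \<Rightarrow> 'f residue_field" where
  "form0 b = pprod (add_monoid class_ring) (\<lambda>w k. k * word_residue w) b"

lemma form0_add: "form0 (a + b) = form0 a + form0 b"
proof -
  let ?M = "add_monoid (class_ring :: 'a residue_field ring)"
  interpret A: comm_monoid ?M
    by (rule comm_monoidI) (auto simp: add.assoc add.commute)
  have "pprod ?M (\<lambda>w k. k * word_residue w) (a + b)
      = pprod ?M (\<lambda>w k. k * word_residue w) a \<otimes>\<^bsub>?M\<^esub> pprod ?M (\<lambda>w k. k * word_residue w) b"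
    by (rule A.pprod_add) (auto simp: distrib_right)
  then show ?thesis by (simp add: form0_def)
qed

lemma form0_single: "form0 (Poly_Mapping.single w k) = k * word_residue w"
proof -
  let ?M = "add_monoid (class_ring :: 'a residue_field ring)"
  interpret A: comm_monoid ?M
    by (rule comm_monoidI) (auto simp: add.assoc add.commute)
  show ?thesis unfolding form0_def by (rule A.pprod_single) auto
qed

lemma form0_0: "form0 0 = 0"
  using form0_add[of 0 0] by (simp only: add_0_left add_cancel_right_right)

lemma form0_uminus: "form0 (- a) = - form0 a"
  using form0_add[of a "- a"] by (simp add: form0_0 eq_neg_iff_add_eq_0 add.commute)

lemma form0_commute: "form0 (a * b) = form0 (b * a)"
proof (induction a rule: poly_mapping_additive_induct)
  case (single v x)
  show ?case
  proof (induction b rule: poly_mapping_additive_induct)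
    case (single w y)
    show ?case by (simp add: mult_single form0_single word_residue_commute[of v w] mult.commute)
  qed (simp_all add: form0_0 form0_add distrib_left distrib_right)
qed (simp_all add: form0_0 form0_add distrib_left distrib_right)

lemma form0_scale: "form0 (Poly_Mapping.single 0 x * a) = x * form0 a"
  by (induction a rule: poly_mapping_additive_induct)
    (simp_all add: form0_0 form0_add form0_single mult_single distrib_left)

text \<open>Congruence modulo the radical of the form, so that the form on the quotient is
  nondegenerate by construction. Commutativity under the trace makes the radical two-sided, as the
  product on the quotient requires.\<close>

definition form_eq :: "(nat word \<Rightarrow>\<^sub>0 'f::field_char_0 residue_field) \<Rightarrow> (nat word \<Rightarrow>\<^sub>0 'f residue_field) \<Rightarrow> bool" where
  "form_eq a b \<longleftrightarrow> (\<forall>c. form0 (a * c) = form0 (b * c))"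

lemma form_eq_refl: "form_eq a a"
  by (simp add: form_eq_def)

quotient_type (overloaded) 'f form_ring = "nat word \<Rightarrow>\<^sub>0 'f::field_char_0 residue_field" / form_eq
proof (rule equivpI)
  show "reflp (form_eq :: _ \<Rightarrow> (nat word \<Rightarrow>\<^sub>0 'f residue_field) \<Rightarrow> _)" by (rule reflpI) (rule form_eq_refl)
  show "symp (form_eq :: _ \<Rightarrow> (nat word \<Rightarrow>\<^sub>0 'f residue_field) \<Rightarrow> _)" by (rule sympI) (simp add: form_eq_def)
  show "transp (form_eq :: _ \<Rightarrow> (nat word \<Rightarrow>\<^sub>0 'f residue_field) \<Rightarrow> _)" by (rule transpI) (simp add: form_eq_def)
qed

instantiation form_ring :: (field_char_0) ring_1
begin

lift_definition zero_form_ring :: "'a form_ring" is 0 .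
lift_definition one_form_ring :: "'a form_ring" is 1 .
lift_definition plus_form_ring :: "'a form_ring \<Rightarrow> 'a form_ring \<Rightarrow> 'a form_ring" is "(+)"
  by (simp add: form_eq_def distrib_right form0_add)
lift_definition uminus_form_ring :: "'a form_ring \<Rightarrow> 'a form_ring" is uminus
  by (simp add: form_eq_def form0_uminus)
lift_definition minus_form_ring :: "'a form_ring \<Rightarrow> 'a form_ring \<Rightarrow> 'a form_ring" is "(-)"
  by (simp add: form_eq_def diff_conv_add_uminus distrib_right form0_add form0_uminus del: add_uminus_conv_diff)
lift_definition times_form_ring :: "'a form_ring \<Rightarrow> 'a form_ring \<Rightarrow> 'a form_ring" is "(*)"
proof -
  fix a b c d :: "nat word \<Rightarrow>\<^sub>0 'a residue_field"
  assume ab: "form_eq a b" and cd: "form_eq c d"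
  have "form0 (a * c * x) = form0 (b * d * x)" for x
  proof -
    have "form0 (a * c * x) = form0 (b * (c * x))" using ab by (simp add: form_eq_def mult.assoc)
    also have "\<dots> = form0 (c * (x * b))" using form0_commute[of b "c * x"] by (simp add: mult.assoc)
    also have "\<dots> = form0 (d * (x * b))" using cd by (simp add: form_eq_def)
    also have "\<dots> = form0 (b * d * x)" using form0_commute[of b "d * x"] by (simp add: mult.assoc)
    finally show ?thesis .
  qed
  then show "form_eq (a * c) (b * d)" by (simp add: form_eq_def)
qed

instance
proof
  fix a b c :: "'a form_ring"
  show "a * b * c = a * (b * c)" by transfer (simp add: mult.assoc form_eq_refl)
  show "1 * a = a" "a * 1 = a" by (transfer, simp add: form_eq_refl)+
  show "a + b + c = a + (b + c)" by transfer (simp add: add.assoc form_eq_refl)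
  show "a + b = b + a" by transfer (simp add: add.commute form_eq_refl)
  show "0 + a = a" by transfer (simp add: form_eq_refl)
  show "- a + a = 0" by transfer (simp add: form_eq_refl)
  show "a - b = a + - b" by transfer (simp add: form_eq_refl)
  show "(a + b) * c = a * c + b * c" by transfer (simp add: distrib_right form_eq_refl)
  show "a * (b + c) = a * b + a * c" by transfer (simp add: distrib_left form_eq_refl)
  \<comment> \<open>The unit has trace n, which is not 0 in K, so it stays outside the
    radical.\<close>
  show "(0 :: 'a form_ring) \<noteq> 1"
  proof transfer
    have "(of_nat (deg0 TYPE('a)) :: 'a residue_field) = residue (Poly_Mapping.single 0 (of_nat (deg0 TYPE('a))))"
      by (simp add: residue_of_nat)
    also have "\<dots> \<noteq> 0" using ideal0(1)[where 'f = 'a] by (simp only: residue_const_eq_0) simp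
    finally have "(of_nat (deg0 TYPE('a)) :: 'a residue_field) \<noteq> 0" .
    moreover have "form0 1 = (of_nat (deg0 TYPE('a)) :: 'a residue_field)"
      using form0_single[of 0 "1 :: 'a residue_field"] by (simp add: word_residue_0)
    ultimately show "\<not> form_eq 0 (1 :: nat word \<Rightarrow>\<^sub>0 'a residue_field)"
      unfolding form_eq_def by (metis form0_0 mult_1 mult_zero_left)
  qed
qed

end

definition emb0 :: "'f::field_char_0 \<Rightarrow> 'f residue_field" where
  "emb0 a = residue (Poly_Mapping.single 0 a)"

definition con0 :: "'f::field_char_0 residue_field \<Rightarrow> 'f form_ring" where
  "con0 x = abs_form_ring (Poly_Mapping.single 0 x)"

lift_definition tau0 :: "'f::field_char_0 form_ring \<Rightarrow> 'f residue_field" is form0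
  by (metis form_eq_def mult.right_neutral)

lemma nondegenerate_trace_0: "nondegenerate_trace (emb0 :: 'f::field_char_0 \<Rightarrow> _) con0 tau0"
proof
  show "emb0 1 = (1 :: 'f residue_field)" by (simp add: emb0_def residue_1)
  show "emb0 (a + b) = emb0 a + emb0 b" "emb0 (a * b) = emb0 a * emb0 b" for a b :: 'f
    by (simp_all add: emb0_def single_add residue_add[symmetric] residue_mult[symmetric] mult_single)
  show "con0 1 = (1 :: 'f form_ring)" by (simp add: con0_def one_form_ring.abs_eq)
  fix x y :: "'f residue_field" and u v :: "'f form_ring"
  show "con0 (x + y) = con0 x + con0 y" by (simp add: con0_def single_add plus_form_ring.abs_eq)
  show "con0 (x * y) = con0 x * con0 y" by (simp add: con0_def mult_single times_form_ring.abs_eq)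
  have c: "Poly_Mapping.single 0 x * b = b * Poly_Mapping.single 0 x" for b :: "nat word \<Rightarrow>\<^sub>0 'f residue_field"
    by (induction b rule: poly_mapping_additive_induct) (simp_all add: mult_single distrib_left distrib_right mult.commute)
  show "con0 x * u = u * con0 x"
    unfolding con0_def by (induction u rule: form_ring.abs_induct) (simp add: times_form_ring.abs_eq c)
  show "tau0 (u + v) = tau0 u + tau0 v" by transfer (rule form0_add)
  show "tau0 (con0 x * u) = x * tau0 u"
    unfolding con0_def
    by (induction u rule: form_ring.abs_induct) (simp add: times_form_ring.abs_eq tau0.abs_eq form0_scale)
  show "tau0 (u * v) = tau0 (v * u)" by transfer (rule form0_commute)
next
  fix u :: "'f form_ring"
  show "(\<And>v. tau0 (u * v) = 0) \<Longrightarrow> u = 0"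
    by transfer (simp add: form_eq_def form0_0)
qed

global_interpretation N0: nondegenerate_trace "emb0 :: 'f::field_char_0 \<Rightarrow> _" con0 tau0
  by (rule nondegenerate_trace_0)

section \<open>The generic point and its kernel\<close>

definition generic :: "(nat, 'f::field_char_0) free_tr \<Rightarrow> 'f form_ring" where
  "generic = N0.ev (\<lambda>i. abs_form_ring (Poly_Mapping.single (Word [i]) 1))"

lemma generic_hom: "generic \<in> trace_hom free_trace_algebra N0.R"
  unfolding generic_def by (rule N0.ev_hom)

lemma generic_simps:
  "generic (p + q) = generic p + generic q" "generic (p * q) = generic p * generic q"
  "generic (free_trc p) = con0 (tau0 (generic p))" "generic (scal a) = con0 (emb0 a)"
  "generic (Defs.var v) = abs_form_ring (Poly_Mapping.single (Word [v]) 1)" "generic 1 = 1" "generic 0 = 0"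
  unfolding generic_def by (rule N0.ev_simps N0.ev_1 N0.ev_0)+

lemma generic_mon: "generic (mon w :: (nat, 'f::field_char_0) free_tr) = abs_form_ring (Poly_Mapping.single w 1)"
proof (cases w)
  case (Word xs)
  have "generic (mon (Word xs) :: (nat, 'f) free_tr) = abs_form_ring (Poly_Mapping.single (Word xs) 1)"
  proof (induction xs)
    case Nil
    have "mon (Word []) = (1 :: (nat, 'f) free_tr)" by (simp add: mon_def flip: zero_word_def)
    then show ?case using one_form_ring.abs_eq by (simp add: generic_simps flip: zero_word_def)
  next
    case (Cons x xs)
    have "mon (Word (x # xs)) = Defs.var x * (mon (Word xs) :: (nat, 'f) free_tr)"
      by (simp add: mon_def Defs.var_def fterm_mult plus_word_def)
    then show ?case
      using Cons by (simp add: generic_simps times_form_ring.abs_eq mult_single plus_word_def)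
  qed
  then show ?thesis using Word by simp
qed

text \<open>The trace of the target was built from the residues of the tr(w), so each trace variable
  goes to its own residue; multiplicativity extends this to monomials and additivity to the
  rest.\<close>

lemma generic_pure: "generic (pure z) = con0 (residue z)"
proof -
  have sc: "con0 (residue (Poly_Mapping.single 0 c)) = generic (pure (Poly_Mapping.single 0 c))" for c :: 'a
    by (simp add: pure_single generic_simps(4)[unfolded scal_def] emb0_def)
  have one: "generic (pure (Poly_Mapping.single (Poly_Mapping.single M k) 1))
      = con0 (residue (Poly_Mapping.single (Poly_Mapping.single M k) (1 :: 'a)))" for M k
  proof (induction k)
    case 0
    show ?case using sc[of 1] by simp
  next
    case (Suc k)
    let ?w = "rep_cyc M"
    have M: "abs_cyc ?w = M" by (rule Quotient3_abs_rep[OF Quotient3_cyc])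
    have s: "Poly_Mapping.single (Poly_Mapping.single M (Suc k)) (1 :: 'a)
        = Poly_Mapping.single (Poly_Mapping.single M 1) 1 * Poly_Mapping.single (Poly_Mapping.single M k) 1"
      by (simp add: mult_single flip: single_add)
    have "pure (Poly_Mapping.single (Poly_Mapping.single M 1) (1 :: 'a)) = free_trc (mon ?w)"
      by (simp add: pure_single mon_def M)
    then have "generic (pure (Poly_Mapping.single (Poly_Mapping.single M 1) (1 :: 'a)))
        = con0 (tau0 (abs_form_ring (Poly_Mapping.single ?w 1)))"
      by (simp only: generic_simps generic_mon)
    also have "\<dots> = con0 (residue (Poly_Mapping.single (Poly_Mapping.single M 1) 1))"
      by (simp add: tau0.abs_eq form0_single word_residue_def M)
    finally show ?case
      unfolding s pure_mult residue_mult N0.con_mult generic_simps Suc by simp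
  qed
  have T: "generic (pure (Poly_Mapping.single T 1)) = con0 (residue (Poly_Mapping.single T (1 :: 'a)))" for T
  proof (induction T rule: poly_mapping_additive_induct)
    case zero
    show ?case using sc[of 1] by simp
  next
    case (single M k)
    show ?case by (rule one)
  next
    case (add S T)
    have s: "Poly_Mapping.single (S + T) (1 :: 'a) = Poly_Mapping.single S 1 * Poly_Mapping.single T 1"
      by (simp add: mult_single)
    show ?case unfolding s pure_mult residue_mult N0.con_mult generic_simps add by simp
  qed
  show ?thesis
  proof (induction z rule: poly_mapping_additive_induct)
    case zero
    show ?case using sc[of 0] by simp
  next
    case (single T c)
    have s: "Poly_Mapping.single T c = Poly_Mapping.single 0 c * Poly_Mapping.single T 1"
      by (simp add: mult_single)
    show ?case unfolding s pure_mult residue_mult N0.con_mult generic_simps T sc ..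
  qed (simp add: pure_add residue_add N0.con_add generic_simps)
qed

lemma generic_trc_eq_0: "tau0 (generic p) = 0 \<longleftrightarrow> free_trc p \<in> ideal0"
proof -
  obtain z where z: "free_trc p = pure z" using free_trc_pure by blast
  have "con0 (tau0 (generic p)) = con0 (residue z)"
    using generic_pure[of z] by (simp add: z[symmetric] generic_simps)
  then have "tau0 (generic p) = residue z" by (simp only: N0.con_inject)
  then show ?thesis by (simp add: residue_eq_0 z)
qed

lemma form_ring_span:
  assumes "P 0" "\<And>u v. P u \<Longrightarrow> P v \<Longrightarrow> P (u + v)" "\<And>x w. P (con0 x * generic (mon w))"
  shows "P (u :: 'f::field_char_0 form_ring)"
proof (induction u rule: form_ring.abs_induct)
  case (1 b)
  show ?case
  proof (induction b rule: poly_mapping_additive_induct)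
    case zero
    show ?case using assms(1) by (simp add: zero_form_ring.abs_eq)
  next
    case (single w x)
    show ?case using assms(3)[of x w]
      by (simp add: con0_def generic_mon times_form_ring.abs_eq mult_single)
  next
    case (add a b)
    then show ?case using assms(2) by (simp flip: plus_form_ring.abs_eq)
  qed
qed

text \<open>If the value of \<open>p\<close> is 0, all traces of p b lie in the ideal and
  \<open>free_prime_nondegenerate\<close> applies. Conversely, the form on the target is
  nondegenerate, and only words have to be tested against \<open>p\<close>, as they span the target
  over K.\<close>

lemma generic_kernel: "generic p = 0 \<longleftrightarrow> p \<in> (ideal0 :: (nat, 'f::field_char_0) free_tr set)"
proof
  assume z: "generic p = 0"
  have t: "free_trc (p * mon w) \<in> ideal0" for w
    using generic_trc_eq_0[of "p * mon w"] by (simp add: generic_simps z N0.tau_0)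
  have "free_trc (p * b) \<in> ideal0" for b
  proof (induction b rule: free_tr_induct)
    case (fterm T w c)
    have "fterm T w c = pure (Poly_Mapping.single T c) * mon w"
      by (simp add: pure_single mon_def mult_single)
    moreover have "p * (pure (Poly_Mapping.single T c) * mon w) = pure (Poly_Mapping.single T c) * (p * mon w)"
      unfolding pure_single by (simp only: mult.assoc[symmetric] fterm_central[of T c p])
    ultimately have "free_trc (p * fterm T w c) = pure (Poly_Mapping.single T c) * free_trc (p * mon w)"
      by (simp only: free_trc_pure_mult)
    then show ?case using t ideal0_ideal(4) by metis
  next
    case (add a b)
    then show ?case using ideal0_ideal(2) by (simp add: distrib_left free_trc_add)
  qed
  then show "p \<in> ideal0"
    by (rule free_prime_nondegenerate[OF ideal0(5) T_ideal_CH[OF ideal0(2,3)]])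
next
  assume p: "p \<in> (ideal0 :: (nat, 'f) free_tr set)"
  show "generic p = 0"
  proof (rule N0.tau_nondegenerate)
    fix v
    show "tau0 (generic p * v) = 0"
    proof (induction v rule: form_ring_span)
      case (3 x w)
      have "free_trc (p * mon w) \<in> ideal0" by (intro ideal0_ideal p)
      then have "tau0 (generic p * generic (mon w)) = 0"
        using generic_trc_eq_0[of "p * mon w"] by (simp add: generic_simps)
      then show ?case by (simp add: N0.con_left N0.tau_con)
    qed (simp_all add: distrib_left N0.tau_add N0.tau_0)
  qed
qed

lemma generic_span: "u \<in> N0.kspan (range generic)"
  by (induction u rule: form_ring_span)
    (auto intro: N0.kspan.zero N0.kspan_add N0.kspan_scale N0.kspan_base)

section \<open>From the chosen ideal to all prime T-ideals\<close>

lemma block_ideal_chosen: "block_ideal (chosen :: nat \<times> (nat, 'f::field_char_0) free_tr set)"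
proof -
  interpret cayley_hamilton_trace "emb0 :: 'f \<Rightarrow> _" con0 tau0 "deg0 TYPE('f)"
  proof
    show "1 \<le> deg0 TYPE('f)" by (rule ideal0(1))
    \<comment> \<open>The Cayley-Hamilton identity is needed at every point over K, not only at
      values of trace polynomials with coefficients in F; density provides it.\<close>
    show "N0.ev s (CH (deg0 TYPE('f)) (Defs.var 0)) = 0" for s :: "nat \<Rightarrow> 'f form_ring"
      by (rule N0.ideal_vanishes[OF ideal0(2) generic_hom generic_kernel generic_span ideal0(3)])
  qed
  obtain ms as where "length ms = length as" "\<And>l. l < length ms \<Longrightarrow> 0 < ms ! l"
    "\<And>l. l < length ms \<Longrightarrow> 0 < as ! l" "(\<Sum>l<length ms. ms ! l * as ! l) = deg0 TYPE('f)"
    "(ideal0 :: (nat, 'f) free_tr set) = trace_identities free_trace_algebra (block_algebra ms as)"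
    by (rule identities_of_blocks[OF ideal0(2) generic_hom generic_kernel generic_span ideal0(4)])
      (rule that, assumption+)
  then have "block_ideal (deg0 TYPE('f), ideal0 :: (nat, 'f) free_tr set)"
    unfolding block_ideal_def case_prod_conv
    by (intro exI[of _ ms] exI[of _ as]) (auto simp: in_set_conv_nth)
  then show ?thesis by simp
qed

text \<open>\<open>chosen\<close> would be a counterexample if there were any, and it is not
  one.\<close>

lemma good_ideal_iff: "good_ideal (n, I) \<longleftrightarrow> n \<ge> 1 \<and> block_ideal (n, I)"
  using chosen(2)[OF block_ideal_chosen] good_block_ideal by (auto simp: good_ideal_def)

theorem theorem12p2p1:
  fixes n :: nat and I :: "(nat, 'f::field_char_0) free_tr set set"
  assumes "n \<ge> 1"
    and "T_ideal I (free_CH_algebra n)"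
  shows "prime_trace_ideal I (free_CH_algebra n) \<longleftrightarrow>
    (\<exists>ms as :: nat list. length ms = length as \<and>
       (\<forall>m\<in>set ms. 0 < m) \<and> (\<forall>a\<in>set as. 0 < a) \<and>
       (\<Sum>j<length ms. ms ! j * as ! j) = n \<and>
       I = trace_identities (free_CH_algebra n) (block_algebra ms as))"
proof (rule T_ideal_preimage[OF assms(2)])
  fix I' :: "(nat, 'f) free_tr set"
  assume T: "T_ideal I' free_trace_algebra"
    and CH: "CH n (Defs.var 0) \<in> I'" and one: "free_trc 1 - of_nat n \<in> I'"
    and prime: "prime_trace_ideal I (free_CH_algebra n) \<longleftrightarrow> free_prime I'"
    and ids: "\<And>A :: ('f, 'f mat list) trace_alg. trace_algebra A \<Longrightarrow>
      (\<And>h. h \<in> trace_hom (free_trace_algebra :: ('f, (nat, 'f) free_tr) trace_alg) A \<Longrightarrow>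
        h (CH n (Defs.var 0)) = \<zero>\<^bsub>A\<^esub> \<and> h (free_trc 1 - of_nat n) = \<zero>\<^bsub>A\<^esub>) \<Longrightarrow>
      I = trace_identities (free_CH_algebra n) A \<longleftrightarrow> I' = trace_identities free_trace_algebra A"
  \<comment> \<open>The other conditions of \<open>good_ideal\<close> are known for
    \<open>I'\<close>, so for it being good means being prime.\<close>
  have "free_prime I' \<longleftrightarrow> block_ideal (n, I')"
    using good_ideal_iff[of n I'] assms(1) T CH one by (simp add: good_ideal_def)
  also have "\<dots> \<longleftrightarrow> (\<exists>ms as :: nat list. length ms = length as \<and>
       (\<forall>m\<in>set ms. 0 < m) \<and> (\<forall>a\<in>set as. 0 < a) \<and>
       (\<Sum>j<length ms. ms ! j * as ! j) = n \<and>
       I = trace_identities (free_CH_algebra n) (block_algebra ms as))"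
  proof -
    \<comment> \<open>The numerical conditions make both defining relations vanish on the block
      algebra, which is what lets identities be compared across the quotient.\<close>
    have "I = trace_identities (free_CH_algebra n) (block_algebra ms as) \<longleftrightarrow>
        I' = trace_identities free_trace_algebra (block_algebra ms as)"
      if "length ms = length as" "\<forall>a\<in>set as. 0 < a" "(\<Sum>j<length ms. ms ! j * as ! j) = n" for ms as :: "nat list"
    proof (rule ids[OF trace_algebra_block])
      have as: "0 < as ! l" if "l < length ms" for l
        using that \<open>length ms = length as\<close> \<open>\<forall>a\<in>set as. 0 < a\<close> by simp
      show "h (CH n (Defs.var 0)) = \<zero>\<^bsub>block_algebra ms as\<^esub> \<and>
          h (free_trc 1 - of_nat n) = \<zero>\<^bsub>block_algebra ms as\<^esub>"
        if "h \<in> trace_hom (free_trace_algebra :: ('f, (nat, 'f) free_tr) trace_alg) (block_algebra ms as)" for h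
        using hom_block_CH[OF as \<open>_ = n\<close> that] hom_block_trace_one[OF as \<open>_ = n\<close> that] by blast
    qed
    then show ?thesis unfolding block_ideal_def by blast
  qed
  finally show ?thesis unfolding prime .
qed

end
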